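(* Let $\alpha>0$ and let $\Omega\subset\mathbb{R}^N$ be a bounded domain whose Poincaré constant $C_\Omega$ satisfies $C_\Omega<\sqrt2$. Let $\gamma_0>0$ and $\gamma_1>0$ satisfy $$\gamma_0<\frac{2-C_\Omega^2}{C_\Omega^2\,\max\big(\alpha^2+\alpha C_\Omega,\ 2(2-\alpha^2)\big)}\quad\text{and}\quad\gamma_1<\frac12,\qquad\text{if }\alpha<2,$$ or $$\gamma_0<\frac{2-C_\Omega^2}{\alpha^2C_\Omega^2+\alpha C_\Omega^3}\quad\text{and}\quad\gamma_1<1,\qquad\text{if }\alpha\ge2.$$ Let $\varepsilon$ satisfy $$\varepsilon<\frac1{C_\Omega}\qquad\text{and}\qquad\frac{\alpha\gamma_0C_\Omega^2}{2-C_\Omega^2(1+\alpha^2\gamma_0)}<\varepsilon<\frac{\alpha(1-\gamma_1)}{2+\alpha^2\gamma_1},$$ put $$\nu_0=2\varepsilon-\alpha\gamma_0C_\Omega^2-\varepsilon C_\Omega^2(1+\alpha^2\gamma_0),\qquad \nu_1=2\alpha-2\varepsilon-\alpha(\gamma_1+1)-\alpha^2\varepsilon\gamma_1,\qquad\beta=\min(\nu_0,\nu_1),$$ and let $$\theta>\frac{\min(\nu_0,\nu_1)}{1+\varepsilon C_\Omega+\varepsilon\alpha C_\Omega^2}.$$ Then for any initial condition $(z_0,z_1)\in H^1_0(\Omega)\times L^2(\Omega)$, $(z_0,z_1)\neq(0,0)$, with $$\eta_0(t)=\Big(\frac12\|z_1\|_{L^2(\Omega)}^2+\frac12\|\nabla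 z_0\|_{L^2(\Omega)}^2+\varepsilon\int_\Omega z_0z_1\Big)e^{-\theta t},$$ the system $$\left\{\begin{aligned}&\partial_t^2 z(t,x)-\Delta z(t,x)=-\alpha\,\partial_t z(t_k,x), && (t,x)\in[t_k,t_{k+1}[\times\Omega,\ \forall k\in\mathbb{N},\\ &z(t,x)=0, && (t,x)\in\mathbb{R}_+\times\partial\Omega,\\ &z(0,x)=z_0(x),\quad \partial_t z(0,x)=z_1(x), && x\in\Omega,\end{aligned}\right.$$ under the event-triggering mechanism $t_0=0$, $$t_{k+1}:=\inf\Big\{t\ge t_k:\ \|e_k(t)\|_{L^2(\Omega)}^2-\gamma_0\|z(t)\|_{L^2(\Omega)}^2-\gamma_1\|\partial_t z(t)\|_{L^2(\Omega)}^2-\eta_0(t)\ge 0\Big\},$$ with $e_k(t,\cdot):=\partial_t z(t,\cdot)-\partial_t z(t_k,\cdot)$ in $\Omega$, is exponentially stable with overshoot estimation $K$ and exponential rate $\delta$, that is, $$E(t)\le K e^{-\delta t}E(0)\quad\forall t>0,\qquad E(t):=\frac12\big(\|\partial_t z(t)\|_{L^2(\Omega)}^2+\|\nabla z(t)\|_{L^2(\Omega)}^2\big),$$ where $$K=\frac{1+\varepsilon C_\Omega+\varepsilon\alpha C_\Omega^2}{1-\varepsilon C_\Omega}\left[1+\frac{\alpha(1+\alpha\varepsilon)}{2\Big(\theta-\frac{\beta}{1+\varepsilon C_\Omega+\varepsilon\alpha C_\Omega^2}\Big)}\right],\qquad \delta=\frac{\beta}{1+\varepsilon C_\Omega+\varepsilon\alpha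 C_\Omega^2}.$$
   Context: $C_\Omega$ denotes the Poincaré constant of $\Omega$, i.e. the optimal constant such that $\|u\|_{L^2(\Omega)}\le C_\Omega\|\nabla u\|_{L^2(\Omega)}$ for all $u\in H^1_0(\Omega)$. The sampling times $(t_k)_{k\in\mathbb{N}}$ are generated along the solution by the event-triggering rule; if the set in the definition of $t_{k+1}$ is empty then $t_{k+1}=+\infty$ and no further sampling occurs. The function $\eta_0$ in the event-triggering mechanism is decreasing and strictly positive. The solution is the function $z\in C^0(\mathbb{R}_+;H^1_0(\Omega))\cap C^1(\mathbb{R}_+;L^2(\Omega))$ which on each interval $[t_k,t_{k+1}[$ solves, in the usual weak/semigroup sense, the linear wave equation with homogeneous Dirichlet boundary condition and time-independent source $-\alpha\partial_t z(t_k,\cdot)$. *)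

theory Defs
  imports "HOL-Analysis.Analysis"
begin

section \<open>Square-integrable functions\<close>

text \<open>Elements of \<open>L\<^sup>2(\<Omega>)\<close> are represented by functions on the whole space, of which only the
  almost-everywhere class on \<open>\<Omega>\<close> matters. The type \<open>'b\<close> is \<open>real\<close> for scalar functions and
  \<open>'a\<close> for gradients.\<close>

definition L2_space :: "'a::euclidean_space set \<Rightarrow> ('a \<Rightarrow> 'b::euclidean_space) set" where
  "L2_space \<Omega> = {f. f \<in> borel_measurable (lebesgue_on \<Omega>) \<and>
                     integrable (lebesgue_on \<Omega>) (\<lambda>x. (norm (f x))\<^sup>2)}"

definition L2_inner :: "'a::euclidean_space set \<Rightarrow> ('a \<Rightarrow> 'b::euclidean_space) \<Rightarrow> ('a \<Rightarrow> 'b) \<Rightarrow> real" where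
  "L2_inner \<Omega> f g = (LINT x|lebesgue_on \<Omega>. f x \<bullet> g x)"

definition L2_norm :: "'a::euclidean_space set \<Rightarrow> ('a \<Rightarrow> 'b::euclidean_space) \<Rightarrow> real" where
  "L2_norm \<Omega> f = sqrt (LINT x|lebesgue_on \<Omega>. (norm (f x))\<^sup>2)"


section \<open>Sobolev spaces\<close>

primrec Ck :: "nat \<Rightarrow> ('a::euclidean_space \<Rightarrow> real) \<Rightarrow> bool" where
  "Ck 0 f \<longleftrightarrow> continuous_on UNIV f"
| "Ck (Suc k) f \<longleftrightarrow> f differentiable_on UNIV \<and>
     (\<forall>i\<in>Basis. Ck k (\<lambda>x. frechet_derivative f (at x) i))"

definition test_functions :: "'a::euclidean_space set \<Rightarrow> ('a \<Rightarrow> real) set" where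
  "test_functions \<Omega> = {\<phi>. (\<forall>k. Ck k \<phi>) \<and> compact (closure {x. \<phi> x \<noteq> 0}) \<and>
                           closure {x. \<phi> x \<noteq> 0} \<subseteq> \<Omega>}"

text \<open>Only used for \<open>u\<close> and \<open>g\<close> in \<open>L\<^sup>2(\<Omega>)\<close>, for which all integrals below exist.\<close>

definition is_weak_gradient ::
    "'a::euclidean_space set \<Rightarrow> ('a \<Rightarrow> real) \<Rightarrow> ('a \<Rightarrow> 'a) \<Rightarrow> bool" where
  "is_weak_gradient \<Omega> u g \<longleftrightarrow> (\<forall>\<phi>\<in>test_functions \<Omega>. \<forall>i\<in>Basis.
     (LINT x|lebesgue_on \<Omega>. u x * frechet_derivative \<phi> (at x) i)
       = - (LINT x|lebesgue_on \<Omega>. (g x \<bullet> i) * \<phi> x))"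

definition H1_space :: "'a::euclidean_space set \<Rightarrow> ('a \<Rightarrow> real) set" where
  "H1_space \<Omega> = {u \<in> L2_space \<Omega>. \<exists>g\<in>L2_space \<Omega>. is_weak_gradient \<Omega> u g}"

text \<open>For \<open>u\<close> in \<open>H\<^sup>1(\<Omega>)\<close>, a representative of the weak gradient, which is unique up to a
  null set.\<close>

definition wgrad :: "'a::euclidean_space set \<Rightarrow> ('a \<Rightarrow> real) \<Rightarrow> ('a \<Rightarrow> 'a)" where
  "wgrad \<Omega> u = (SOME g. g \<in> L2_space \<Omega> \<and> is_weak_gradient \<Omega> u g)"

definition H1_norm :: "'a::euclidean_space set \<Rightarrow> ('a \<Rightarrow> real) \<Rightarrow> real" where
  "H1_norm \<Omega> u = sqrt ((L2_norm \<Omega> u)\<^sup>2 + (L2_norm \<Omega> (wgrad \<Omega> u))\<^sup>2)"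

definition H10_space :: "'a::euclidean_space set \<Rightarrow> ('a \<Rightarrow> real) set" where
  "H10_space \<Omega> = {u \<in> H1_space \<Omega>. \<exists>\<phi>::nat \<Rightarrow> 'a \<Rightarrow> real.
     (\<forall>n. \<phi> n \<in> test_functions \<Omega>) \<and> (\<lambda>n. H1_norm \<Omega> (\<lambda>x. u x - \<phi> n x)) \<longlonglongrightarrow> 0}"

definition poincare_constant :: "'a::euclidean_space set \<Rightarrow> real" where
  "poincare_constant \<Omega> =
     Inf {C. 0 \<le> C \<and> (\<forall>u\<in>H10_space \<Omega>. L2_norm \<Omega> u \<le> C * L2_norm \<Omega> (wgrad \<Omega> u))}"


section \<open>The event-triggered damped wave equation\<close>

definition C0_H10 :: "'a::euclidean_space set \<Rightarrow> (real \<Rightarrow> 'a \<Rightarrow> real) \<Rightarrow> bool" where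
  "C0_H10 \<Omega> z \<longleftrightarrow> (\<forall>t\<ge>0. z t \<in> H10_space \<Omega> \<and>
     ((\<lambda>s. H1_norm \<Omega> (\<lambda>x. z s x - z t x)) \<longlongrightarrow> 0) (at t within {0..}))"

text \<open>\<open>C1_L2 \<Omega> z dz\<close>: \<open>z\<close> belongs to \<open>C\<^sup>1(\<real>\<^sub>+; L\<^sup>2(\<Omega>))\<close> and its derivative, as a curve in
  \<open>L\<^sup>2(\<Omega>)\<close>, is \<open>dz\<close>.\<close>

definition C1_L2 ::
    "'a::euclidean_space set \<Rightarrow> (real \<Rightarrow> 'a \<Rightarrow> real) \<Rightarrow> (real \<Rightarrow> 'a \<Rightarrow> real) \<Rightarrow> bool" where
  "C1_L2 \<Omega> z dz \<longleftrightarrow> (\<forall>t\<ge>0. z t \<in> L2_space \<Omega> \<and> dz t \<in> L2_space \<Omega> \<and>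
     ((\<lambda>s. L2_norm \<Omega> (\<lambda>x. (z s x - z t x) / (s - t) - dz t x)) \<longlongrightarrow> 0) (at t within {0..}) \<and>
     ((\<lambda>s. L2_norm \<Omega> (\<lambda>x. dz s x - dz t x)) \<longlongrightarrow> 0) (at t within {0..}))"

text \<open>The infimum is taken in the extended reals, so that it is \<open>\<infinity>\<close> over the empty set; once
  a sampling time is \<open>\<infinity>\<close>, so are all later ones, and the value of the sample at
  \<open>real_of_ereal \<infinity>\<close> is irrelevant.\<close>

primrec sampling_time ::
    "'a::euclidean_space set \<Rightarrow> real \<Rightarrow> real \<Rightarrow> (real \<Rightarrow> real) \<Rightarrow>
     (real \<Rightarrow> 'a \<Rightarrow> real) \<Rightarrow> (real \<Rightarrow> 'a \<Rightarrow> real) \<Rightarrow> nat \<Rightarrow> ereal" where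
  "sampling_time \<Omega> \<gamma>\<^sub>0 \<gamma>\<^sub>1 \<eta>\<^sub>0 z dz 0 = 0"
| "sampling_time \<Omega> \<gamma>\<^sub>0 \<gamma>\<^sub>1 \<eta>\<^sub>0 z dz (Suc k) =
     (let t\<^sub>k = sampling_time \<Omega> \<gamma>\<^sub>0 \<gamma>\<^sub>1 \<eta>\<^sub>0 z dz k;
          e\<^sub>k = (\<lambda>t x. dz t x - dz (real_of_ereal t\<^sub>k) x)
      in Inf {ereal t | t. t\<^sub>k \<le> ereal t \<and>
           (L2_norm \<Omega> (e\<^sub>k t))\<^sup>2 - \<gamma>\<^sub>0 * (L2_norm \<Omega> (z t))\<^sup>2 - \<gamma>\<^sub>1 * (L2_norm \<Omega> (dz t))\<^sup>2 - \<eta>\<^sub>0 t \<ge> 0})"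

text \<open>Weak formulation on \<open>[a, b[\<close> of \<open>\<partial>\<^sub>t\<^sup>2 z - \<Delta> z = f\<close> with a time-independent source \<open>f\<close>: for every
  \<open>\<phi>\<close> in \<open>H\<^sup>1\<^sub>0(\<Omega>)\<close>, \<open>d/dt \<langle>\<partial>\<^sub>t z, \<phi>\<rangle> + \<langle>\<nabla>z, \<nabla>\<phi>\<rangle> = \<langle>f, \<phi>\<rangle>\<close> (right derivative at \<open>a\<close>). Since
  \<open>t \<mapsto> \<nabla>z(t)\<close> is continuous, asking for the derivative at every \<open>t\<close> is no restriction. The
  Dirichlet condition is part of \<open>z(t) \<in> H\<^sup>1\<^sub>0(\<Omega>)\<close>.\<close>

definition weak_wave_on ::
    "'a::euclidean_space set \<Rightarrow> ereal \<Rightarrow> ereal \<Rightarrow> ('a \<Rightarrow> real) \<Rightarrow>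
     (real \<Rightarrow> 'a \<Rightarrow> real) \<Rightarrow> (real \<Rightarrow> 'a \<Rightarrow> real) \<Rightarrow> bool" where
  "weak_wave_on \<Omega> a b f z dz \<longleftrightarrow> (\<forall>\<phi>\<in>H10_space \<Omega>. \<forall>t. a \<le> ereal t \<and> ereal t < b \<longrightarrow>
     ((\<lambda>s. L2_inner \<Omega> (dz s) \<phi>) has_real_derivative
        (L2_inner \<Omega> f \<phi> - L2_inner \<Omega> (wgrad \<Omega> (z t)) (wgrad \<Omega> \<phi>)))
       (at t within {s. a \<le> ereal s \<and> ereal s < b}))"

definition event_triggered_solution ::
    "'a::euclidean_space set \<Rightarrow> real \<Rightarrow> real \<Rightarrow> real \<Rightarrow> (real \<Rightarrow> real) \<Rightarrow> ('a \<Rightarrow> real) \<Rightarrow> ('a \<Rightarrow> real) \<Rightarrow>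
     (real \<Rightarrow> 'a \<Rightarrow> real) \<Rightarrow> (real \<Rightarrow> 'a \<Rightarrow> real) \<Rightarrow> bool" where
  "event_triggered_solution \<Omega> \<alpha> \<gamma>\<^sub>0 \<gamma>\<^sub>1 \<eta>\<^sub>0 z\<^sub>0 z\<^sub>1 z dz \<longleftrightarrow>
     C0_H10 \<Omega> z \<and> C1_L2 \<Omega> z dz \<and>
     (AE x in lebesgue_on \<Omega>. z 0 x = z\<^sub>0 x) \<and> (AE x in lebesgue_on \<Omega>. dz 0 x = z\<^sub>1 x) \<and>
     (\<forall>k. let t\<^sub>k = sampling_time \<Omega> \<gamma>\<^sub>0 \<gamma>\<^sub>1 \<eta>\<^sub>0 z dz k;
              t\<^sub>k\<^sub>1 = sampling_time \<Omega> \<gamma>\<^sub>0 \<gamma>\<^sub>1 \<eta>\<^sub>0 z dz (Suc k)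
          in weak_wave_on \<Omega> t\<^sub>k t\<^sub>k\<^sub>1 (\<lambda>x. - \<alpha> * dz (real_of_ereal t\<^sub>k) x) z dz)"

definition energy ::
    "'a::euclidean_space set \<Rightarrow> (real \<Rightarrow> 'a \<Rightarrow> real) \<Rightarrow> (real \<Rightarrow> 'a \<Rightarrow> real) \<Rightarrow> real \<Rightarrow> real" where
  "energy \<Omega> z dz t = 1/2 * ((L2_norm \<Omega> (dz t))\<^sup>2 + (L2_norm \<Omega> (wgrad \<Omega> (z t)))\<^sup>2)"

end

theory Submission
  imports Defs
begin

text \<open>
  The proof is a Lyapunov argument for
  \<open>V = E + \<epsilon> \<langle>z, \<partial>\<^sub>t z\<rangle> + (\<epsilon> \<alpha> / 2) \<parallel>z\<parallel>\<^sup>2\<close>. By the Poincare inequality,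
  \<open>(1 - \<epsilon> C) E \<le> V \<le> (1 + \<epsilon> C + \<epsilon> \<alpha> C\<^sup>2) E\<close>. Between two samples the source is
  \<open>- \<alpha> \<partial>\<^sub>t z + \<alpha> e\<^sub>k\<close>, where the triggering rule bounds \<open>\<parallel>e\<^sub>k\<parallel>\<^sup>2\<close> by
  \<open>\<gamma>\<^sub>0 \<parallel>z\<parallel>\<^sup>2 + \<gamma>\<^sub>1 \<parallel>\<partial>\<^sub>t z\<parallel>\<^sup>2 + \<eta>\<^sub>0\<close>. Young's inequality turns this into
  \<open>V' \<le> - \<beta> E + (\<alpha> (1 + \<alpha> \<epsilon>) / 2) \<eta>\<^sub>0 \<le> - \<delta> V + (\<alpha> (1 + \<alpha> \<epsilon>) / 2) \<eta>\<^sub>0\<close>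
  (\<open>dissipation_inequality\<close>). As \<open>\<eta>\<^sub>0\<close> decays at the faster rate \<open>\<theta> > \<delta>\<close> and is at most
  \<open>V(0)\<close> at the start, the claim follows by integration
  (\<open>Gronwall_exponential_forcing\<close>), provided that three points are settled.

  First, the solution is too weak for the energy to be differentiated directly, because
  \<open>\<partial>\<^sub>t z(t)\<close> is not an admissible test function. Since the source \<open>f\<close> is constant in time between
  samples, the energy balance takes the form that \<open>E - \<langle>f, z\<rangle>\<close> is constant. It is derived from the
  kernel \<open>\<langle>\<partial>\<^sub>t z(t), \<partial>\<^sub>t z(s)\<rangle> + \<langle>\<nabla>z(t), \<nabla>z(s)\<rangle>\<close> at two different times, which needs only
  increments of \<open>z\<close> as test functions (\<open>symmetric_kernel_diagonal_constant\<close>,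
  \<open>weak_wave_energy_identity\<close>).

  Second, the sampling times must not accumulate, since the equation is imposed on the sampling
  intervals alone. At an accumulation point the sampling errors would tend to \<open>0\<close>
  by continuity of \<open>\<partial>\<^sub>t z\<close>, whereas each event needs a squared error of at least \<open>\<eta>\<^sub>0 > 0\<close>
  (\<open>sampling_times_unbounded\<close>). Positivity of \<open>\<eta>\<^sub>0\<close> comes from \<open>\<epsilon> C < 1\<close> and the nonzero
  initial condition.

  Third, the Sobolev space has to behave as expected: the weak gradient is unique, hence linear,
  and the Poincare constant satisfies the Poincare inequality
  (\<open>weak_gradient_unique\<close>, \<open>poincare_constant\<close>). The former rests on smooth bump functions that
  approximate indicators of boxes, the latter on integration by parts for test functions.
\<close>

section \<open>The inner product space of square-integrable functions\<close>

lemma L2_spaceI: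
  "f \<in> borel_measurable (lebesgue_on \<Omega>) \<Longrightarrow> integrable (lebesgue_on \<Omega>) (\<lambda>x. (norm (f x))\<^sup>2)
    \<Longrightarrow> f \<in> L2_space \<Omega>"
  by (simp add: L2_space_def)

lemma L2_space_measurable: "f \<in> L2_space \<Omega> \<Longrightarrow> f \<in> borel_measurable (lebesgue_on \<Omega>)"
  and L2_space_integrable: "f \<in> L2_space \<Omega> \<Longrightarrow> integrable (lebesgue_on \<Omega>) (\<lambda>x. (norm (f x))\<^sup>2)"
  by (simp_all add: L2_space_def)

lemma L2_space_inner_integrable:
  assumes f: "f \<in> L2_space \<Omega>" and g: "g \<in> L2_space \<Omega>"
  shows "integrable (lebesgue_on \<Omega>) (\<lambda>x. f x \<bullet> g x)"
proof (rule Bochner_Integration.integrable_bound)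
  show "integrable (lebesgue_on \<Omega>) (\<lambda>x. (norm (f x))\<^sup>2 + (norm (g x))\<^sup>2)"
    using f g by (intro Bochner_Integration.integrable_add L2_space_integrable)
  show "(\<lambda>x. f x \<bullet> g x) \<in> borel_measurable (lebesgue_on \<Omega>)"
    using L2_space_measurable[OF f] L2_space_measurable[OF g] by measurable
  have "\<bar>f x \<bullet> g x\<bar> \<le> (norm (f x))\<^sup>2 + (norm (g x))\<^sup>2" for x
  proof -
    have "\<bar>f x \<bullet> g x\<bar> \<le> norm (f x) * norm (g x)" by (rule Cauchy_Schwarz_ineq2)
    also have "\<dots> \<le> (norm (f x))\<^sup>2 + (norm (g x))\<^sup>2"
      using sum_squares_bound[of "norm (f x)" "norm (g x)"]
        mult_nonneg_nonneg[OF norm_ge_zero[of "f x"] norm_ge_zero[of "g x"]] by linarith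
    finally show ?thesis .
  qed
  then show "AE x in lebesgue_on \<Omega>. norm (f x \<bullet> g x) \<le> norm ((norm (f x))\<^sup>2 + (norm (g x))\<^sup>2)"
    by (auto intro!: AE_I2)
qed

lemma L2_space_lincomb:
  assumes f: "f \<in> L2_space \<Omega>" and g: "g \<in> L2_space \<Omega>"
  shows "(\<lambda>x. a *\<^sub>R f x + b *\<^sub>R g x) \<in> L2_space \<Omega>"
proof (rule L2_spaceI)
  show "(\<lambda>x. a *\<^sub>R f x + b *\<^sub>R g x) \<in> borel_measurable (lebesgue_on \<Omega>)"
    using L2_space_measurable[OF f] L2_space_measurable[OF g] by measurable
  have "integrable (lebesgue_on \<Omega>)
      (\<lambda>x. a\<^sup>2 * (norm (f x))\<^sup>2 + 2 * a * b * (f x \<bullet> g x) + b\<^sup>2 * (norm (g x))\<^sup>2)"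
    using f g by (intro Bochner_Integration.integrable_add integrable_mult_right
        L2_space_integrable L2_space_inner_integrable)
  then show "integrable (lebesgue_on \<Omega>) (\<lambda>x. (norm (a *\<^sub>R f x + b *\<^sub>R g x))\<^sup>2)"
    unfolding power2_norm_eq_inner
    by (simp add: inner_add_left inner_add_right inner_commute algebra_simps power2_eq_square
        del: dot_square_norm)
qed

lemma L2_space_add: "f \<in> L2_space \<Omega> \<Longrightarrow> g \<in> L2_space \<Omega> \<Longrightarrow> (\<lambda>x. f x + g x) \<in> L2_space \<Omega>"
  and L2_space_diff: "f \<in> L2_space \<Omega> \<Longrightarrow> g \<in> L2_space \<Omega> \<Longrightarrow> (\<lambda>x. f x - g x) \<in> L2_space \<Omega>"
  using L2_space_lincomb[of f \<Omega> g 1 1] L2_space_lincomb[of f \<Omega> g 1 "-1"] by simp_all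

lemma L2_space_scaleR: "f \<in> L2_space \<Omega> \<Longrightarrow> (\<lambda>x. c *\<^sub>R f x) \<in> L2_space \<Omega>"
  using L2_space_lincomb[of f \<Omega> f c 0] by simp

lemma L2_space_mult:
  fixes f :: "'a::euclidean_space \<Rightarrow> real"
  shows "f \<in> L2_space \<Omega> \<Longrightarrow> (\<lambda>x. c * f x) \<in> L2_space \<Omega>"
  using L2_space_scaleR[of f \<Omega> c] by simp

lemma L2_inner_commute: "L2_inner \<Omega> f g = L2_inner \<Omega> g f"
  by (simp add: L2_inner_def inner_commute)

lemma L2_inner_add_left:
  "f \<in> L2_space \<Omega> \<Longrightarrow> g \<in> L2_space \<Omega> \<Longrightarrow> h \<in> L2_space \<Omega> \<Longrightarrow>
    L2_inner \<Omega> (\<lambda>x. f x + g x) h = L2_inner \<Omega> f h + L2_inner \<Omega> g h"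
  and L2_inner_diff_left:
  "f \<in> L2_space \<Omega> \<Longrightarrow> g \<in> L2_space \<Omega> \<Longrightarrow> h \<in> L2_space \<Omega> \<Longrightarrow>
    L2_inner \<Omega> (\<lambda>x. f x - g x) h = L2_inner \<Omega> f h - L2_inner \<Omega> g h"
  by (simp_all add: L2_inner_def inner_simps L2_space_inner_integrable)

lemma L2_inner_scaleR_left: "L2_inner \<Omega> (\<lambda>x. c *\<^sub>R f x) h = c * L2_inner \<Omega> f h"
  by (simp add: L2_inner_def)

lemma L2_inner_scaleR_right: "L2_inner \<Omega> h (\<lambda>x. c *\<^sub>R f x) = c * L2_inner \<Omega> h f"
  by (simp add: L2_inner_def)

lemma L2_inner_add_right:
  "f \<in> L2_space \<Omega> \<Longrightarrow> g \<in> L2_space \<Omega> \<Longrightarrow> h \<in> L2_space \<Omega> \<Longrightarrow>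
    L2_inner \<Omega> h (\<lambda>x. f x + g x) = L2_inner \<Omega> h f + L2_inner \<Omega> h g"
  and L2_inner_diff_right:
  "f \<in> L2_space \<Omega> \<Longrightarrow> g \<in> L2_space \<Omega> \<Longrightarrow> h \<in> L2_space \<Omega> \<Longrightarrow>
    L2_inner \<Omega> h (\<lambda>x. f x - g x) = L2_inner \<Omega> h f - L2_inner \<Omega> h g"
  by (simp_all add: L2_inner_def inner_simps L2_space_inner_integrable)

lemma L2_inner_mult_left:
  fixes f :: "'a::euclidean_space \<Rightarrow> real"
  shows "L2_inner \<Omega> (\<lambda>x. c * f x) h = c * L2_inner \<Omega> f h"
  using L2_inner_scaleR_left[of \<Omega> c f h] by simp

lemma L2_inner_self_nonneg: "0 \<le> L2_inner \<Omega> f f"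
  by (simp add: L2_inner_def)

lemma L2_norm_eq_sqrt_inner: "L2_norm \<Omega> f = sqrt (L2_inner \<Omega> f f)"
  by (simp add: L2_norm_def L2_inner_def power2_norm_eq_inner)

lemma L2_norm_sq: "(L2_norm \<Omega> f)\<^sup>2 = L2_inner \<Omega> f f"
  by (simp add: L2_norm_eq_sqrt_inner L2_inner_self_nonneg)

lemma L2_norm_nonneg: "0 \<le> L2_norm \<Omega> f"
  by (simp add: L2_norm_eq_sqrt_inner L2_inner_self_nonneg)

lemma L2_norm_scaleR: "L2_norm \<Omega> (\<lambda>x. c *\<^sub>R f x) = \<bar>c\<bar> * L2_norm \<Omega> f"
  by (simp add: L2_norm_eq_sqrt_inner L2_inner_scaleR_left L2_inner_scaleR_right
      real_sqrt_mult flip: mult.assoc)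

lemma L2_norm_minus_commute: "L2_norm \<Omega> (\<lambda>x. f x - g x) = L2_norm \<Omega> (\<lambda>x. g x - f x)"
  by (simp add: L2_norm_def norm_minus_commute)

lemma L2_inner_cong_AE:
  assumes "f \<in> L2_space \<Omega>" "f' \<in> L2_space \<Omega>" "g \<in> L2_space \<Omega>" "g' \<in> L2_space \<Omega>"
    and "AE x in lebesgue_on \<Omega>. f x = f' x" "AE x in lebesgue_on \<Omega>. g x = g' x"
  shows "L2_inner \<Omega> f g = L2_inner \<Omega> f' g'"
  unfolding L2_inner_def
proof (rule integral_cong_AE)
  show "AE x in lebesgue_on \<Omega>. f x \<bullet> g x = f' x \<bullet> g' x"
    using assms(5,6) by eventually_elim simp
qed (use assms in \<open>simp_all add: borel_measurable_integrable L2_space_inner_integrable\<close>)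

lemma L2_norm_cong_AE:
  "f \<in> L2_space \<Omega> \<Longrightarrow> f' \<in> L2_space \<Omega> \<Longrightarrow> AE x in lebesgue_on \<Omega>. f x = f' x \<Longrightarrow>
    L2_norm \<Omega> f = L2_norm \<Omega> f'"
  using L2_inner_cong_AE[of f \<Omega> f' f f'] by (simp add: L2_norm_eq_sqrt_inner)

lemma L2_norm_eq_0_iff:
  assumes "f \<in> L2_space \<Omega>"
  shows "L2_norm \<Omega> f = 0 \<longleftrightarrow> (AE x in lebesgue_on \<Omega>. f x = 0)"
  unfolding L2_norm_def
  by (simp add: integral_nonneg_eq_0_iff_AE[OF L2_space_integrable[OF assms]])

lemma discriminant_le:
  fixes a b c :: real
  assumes a: "0 \<le> a" and nonneg: "\<And>s. 0 \<le> a * s\<^sup>2 + (2 * b) * s + c"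
  shows "b\<^sup>2 \<le> a * c"
proof (cases "a = 0")
  case True
  have "b = 0"
  proof (rule ccontr)
    assume "b \<noteq> 0"
    then show False
      using nonneg[of "- (c + 1) / (2 * b)"] True by simp
  qed
  with True show ?thesis by simp
next
  case False
  show ?thesis
    using False a nonneg[of "- b / a"] by (simp add: field_simps power2_eq_square)
qed

lemma L2_Cauchy_Schwarz:
  assumes f: "f \<in> L2_space \<Omega>" and g: "g \<in> L2_space \<Omega>"
  shows "\<bar>L2_inner \<Omega> f g\<bar> \<le> L2_norm \<Omega> f * L2_norm \<Omega> g"
proof -
  have "0 \<le> L2_inner \<Omega> g g * s\<^sup>2 + (2 * L2_inner \<Omega> f g) * s + L2_inner \<Omega> f f" for s
  proof -
    have sg: "(\<lambda>x. s *\<^sub>R g x) \<in> L2_space \<Omega>" using g by (rule L2_space_scaleR)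
    have "0 \<le> L2_inner \<Omega> (\<lambda>x. f x + s *\<^sub>R g x) (\<lambda>x. f x + s *\<^sub>R g x)"
      by (rule L2_inner_self_nonneg)
    also have "\<dots> = L2_inner \<Omega> g g * s\<^sup>2 + (2 * L2_inner \<Omega> f g) * s + L2_inner \<Omega> f f"
      using f g sg
      by (simp add: L2_inner_add_left L2_inner_add_right L2_space_add L2_inner_scaleR_left
          L2_inner_scaleR_right L2_inner_commute[of \<Omega> g f] power2_eq_square algebra_simps
          del: real_scaleR_def)
    finally show ?thesis .
  qed
  then have "(L2_inner \<Omega> f g)\<^sup>2 \<le> L2_inner \<Omega> g g * L2_inner \<Omega> f f"
    by (rule discriminant_le[OF L2_inner_self_nonneg])
  then have "(L2_inner \<Omega> f g)\<^sup>2 \<le> (L2_norm \<Omega> f * L2_norm \<Omega> g)\<^sup>2"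
    by (simp add: power_mult_distrib L2_norm_sq mult.commute)
  then show ?thesis
    by (simp add: abs_le_square_iff[symmetric] L2_norm_nonneg abs_mult)
qed

lemma L2_norm_triangle:
  assumes f: "f \<in> L2_space \<Omega>" and g: "g \<in> L2_space \<Omega>"
  shows "L2_norm \<Omega> (\<lambda>x. f x + g x) \<le> L2_norm \<Omega> f + L2_norm \<Omega> g"
proof (rule power2_le_imp_le)
  show "(L2_norm \<Omega> (\<lambda>x. f x + g x))\<^sup>2 \<le> (L2_norm \<Omega> f + L2_norm \<Omega> g)\<^sup>2"
  proof -
    have "(L2_norm \<Omega> (\<lambda>x. f x + g x))\<^sup>2
        = (L2_norm \<Omega> f)\<^sup>2 + 2 * L2_inner \<Omega> f g + (L2_norm \<Omega> g)\<^sup>2"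
      using f g L2_inner_commute[of \<Omega> g f]
      by (simp add: L2_norm_sq L2_inner_add_left L2_inner_add_right L2_space_add)
    also have "\<dots> \<le> (L2_norm \<Omega> f + L2_norm \<Omega> g)\<^sup>2"
      using L2_Cauchy_Schwarz[OF f g] unfolding power2_sum by linarith
    finally show ?thesis .
  qed
qed (simp add: L2_norm_nonneg)

lemma L2_norm_triangle_diff:
  assumes f: "f \<in> L2_space \<Omega>" and g: "g \<in> L2_space \<Omega>" and h: "h \<in> L2_space \<Omega>"
  shows "L2_norm \<Omega> (\<lambda>x. f x - h x) \<le> L2_norm \<Omega> (\<lambda>x. f x - g x) + L2_norm \<Omega> (\<lambda>x. g x - h x)"
  using L2_norm_triangle[OF L2_space_diff[OF f g] L2_space_diff[OF g h]] by simp

lemma L2_norm_le_add_diff: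
  assumes f: "f \<in> L2_space \<Omega>" and g: "g \<in> L2_space \<Omega>"
  shows "L2_norm \<Omega> f \<le> L2_norm \<Omega> (\<lambda>x. f x - g x) + L2_norm \<Omega> g"
  using L2_norm_triangle[OF L2_space_diff[OF f g] g] by simp

lemma L2_norm_diff_le:
  assumes "f \<in> L2_space \<Omega>" "g \<in> L2_space \<Omega>"
  shows "L2_norm \<Omega> (\<lambda>x. f x - g x) \<le> L2_norm \<Omega> f + L2_norm \<Omega> g"
  using L2_norm_triangle[OF assms(1) L2_space_scaleR[OF assms(2), of "-1"]]
    L2_norm_scaleR[of \<Omega> "-1" g] by simp

lemma L2_norm_mono:
  assumes "f \<in> L2_space \<Omega>" and "g \<in> L2_space \<Omega>" and "0 \<le> c"
    and "\<And>x. x \<in> \<Omega> \<Longrightarrow> norm (f x) \<le> c * norm (g x)"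
  shows "L2_norm \<Omega> f \<le> c * L2_norm \<Omega> g"
proof -
  have "(LINT x|lebesgue_on \<Omega>. (norm (f x))\<^sup>2) \<le> (LINT x|lebesgue_on \<Omega>. (norm (c *\<^sub>R g x))\<^sup>2)"
    using assms by (intro integral_mono L2_space_integrable L2_space_scaleR) (auto intro!: power_mono)
  then have "L2_norm \<Omega> f \<le> L2_norm \<Omega> (\<lambda>x. c *\<^sub>R g x)" by (simp add: L2_norm_def)
  then show ?thesis using \<open>0 \<le> c\<close> by (simp add: L2_norm_scaleR)
qed

lemma L2_space_inner_const:
  assumes g: "g \<in> L2_space \<Omega>"
  shows "(\<lambda>x. g x \<bullet> i) \<in> L2_space \<Omega>"
proof (rule L2_spaceI)
  show meas: "(\<lambda>x. g x \<bullet> i) \<in> borel_measurable (lebesgue_on \<Omega>)"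
    using L2_space_measurable[OF g] by measurable
  show "integrable (lebesgue_on \<Omega>) (\<lambda>x. (norm (g x \<bullet> i))\<^sup>2)"
  proof (rule Bochner_Integration.integrable_bound)
    show "integrable (lebesgue_on \<Omega>) (\<lambda>x. (norm i)\<^sup>2 * (norm (g x))\<^sup>2)"
      using L2_space_integrable[OF g] by (rule integrable_mult_right)
    have "(norm (g x \<bullet> i))\<^sup>2 \<le> (norm i)\<^sup>2 * (norm (g x))\<^sup>2" for x
      using power_mono[OF Cauchy_Schwarz_ineq2[of "g x" i], of 2]
      by (simp add: power_mult_distrib mult.commute)
    then show "AE x in lebesgue_on \<Omega>. norm ((norm (g x \<bullet> i))\<^sup>2) \<le> norm ((norm i)\<^sup>2 * (norm (g x))\<^sup>2)"
      by (intro AE_I2) simp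
  qed (use meas in measurable)
qed

lemma tendsto_L2_inner:
  assumes f: "((\<lambda>s. L2_norm \<Omega> (\<lambda>x. f s x - f0 x)) \<longlongrightarrow> 0) F"
    and g: "((\<lambda>s. L2_norm \<Omega> (\<lambda>x. g s x - g0 x)) \<longlongrightarrow> 0) F"
    and L2: "\<forall>\<^sub>F s in F. f s \<in> L2_space \<Omega> \<and> g s \<in> L2_space \<Omega>"
      "f0 \<in> L2_space \<Omega>" "g0 \<in> L2_space \<Omega>"
  shows "((\<lambda>s. L2_inner \<Omega> (f s) (g s)) \<longlongrightarrow> L2_inner \<Omega> f0 g0) F"
proof -
  let ?df = "\<lambda>s x. f s x - f0 x" and ?dg = "\<lambda>s x. g s x - g0 x"
  have "((\<lambda>s. L2_inner \<Omega> (f s) (g s) - L2_inner \<Omega> f0 g0) \<longlongrightarrow> 0) F"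
  proof (rule Lim_null_comparison)
    show "\<forall>\<^sub>F s in F. norm (L2_inner \<Omega> (f s) (g s) - L2_inner \<Omega> f0 g0)
        \<le> L2_norm \<Omega> (?df s) * L2_norm \<Omega> (?dg s) + L2_norm \<Omega> (?df s) * L2_norm \<Omega> g0
          + L2_norm \<Omega> f0 * L2_norm \<Omega> (?dg s)"
      using L2(1)
    proof eventually_elim
      case (elim s)
      then have mem: "?df s \<in> L2_space \<Omega>" "?dg s \<in> L2_space \<Omega>"
        using L2 by (auto intro: L2_space_diff)
      have "L2_inner \<Omega> (f s) (g s) - L2_inner \<Omega> f0 g0
          = L2_inner \<Omega> (?df s) (?dg s) + L2_inner \<Omega> (?df s) g0 + L2_inner \<Omega> f0 (?dg s)"
        using elim L2 mem by (simp add: L2_inner_diff_left L2_inner_diff_right)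
      then show ?case
        using L2_Cauchy_Schwarz[OF mem] L2_Cauchy_Schwarz[OF mem(1) L2(3)]
          L2_Cauchy_Schwarz[OF L2(2) mem(2)]
        by (simp add: abs_le_iff)
    qed
    show "((\<lambda>s. L2_norm \<Omega> (?df s) * L2_norm \<Omega> (?dg s) + L2_norm \<Omega> (?df s) * L2_norm \<Omega> g0
          + L2_norm \<Omega> f0 * L2_norm \<Omega> (?dg s)) \<longlongrightarrow> 0) F"
      using f g by (auto intro!: tendsto_eq_intros)
  qed
  then show ?thesis by (simp add: LIM_zero_iff)
qed

section \<open>Smooth functions and test functions\<close>

lemma Ck_SucI:
  assumes "\<And>x. (f has_derivative D x) (at x)" and "\<And>i. i \<in> Basis \<Longrightarrow> Ck k (\<lambda>x. D x i)"
  shows "Ck (Suc k) f"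
proof -
  have "frechet_derivative f (at x) = D x" for x
    using assms(1) frechet_derivative_at by metis
  then show ?thesis
    using assms by (auto simp: differentiable_on_def differentiable_def)
qed

lemma Ck_Suc_has_derivative:
  assumes "Ck (Suc k) f"
  shows "(f has_derivative frechet_derivative f (at x)) (at x)"
  using assms by (simp add: differentiable_on_def frechet_derivative_works)

lemma Ck_SucD: "Ck (Suc k) f \<Longrightarrow> Ck k f"
proof (induction k arbitrary: f)
  case 0
  then show ?case by (auto intro: differentiable_imp_continuous_on)
next
  case (Suc k)
  then show ?case by simp
qed

lemma Ck_const: "Ck k (\<lambda>x. c)"
proof (induction k arbitrary: c)
  case (Suc k)
  show ?case by (rule Ck_SucI[where D="\<lambda>_ _. 0"]) (use Suc in auto)
qed simp

lemma Ck_add: "Ck k f \<Longrightarrow> Ck k g \<Longrightarrow> Ck k (\<lambda>x. f x + g x)"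
proof (induction k arbitrary: f g)
  case 0
  then show ?case by (simp add: continuous_on_add)
next
  case (Suc k)
  show ?case
    by (rule Ck_SucI[OF has_derivative_add[OF Suc.prems[THEN Ck_Suc_has_derivative]]])
      (use Suc in simp)
qed

lemma Ck_mult: "Ck k f \<Longrightarrow> Ck k g \<Longrightarrow> Ck k (\<lambda>x. f x * g x)"
proof (induction k arbitrary: f g)
  case 0
  then show ?case by (simp add: continuous_on_mult)
next
  case (Suc k)
  show ?case
    by (rule Ck_SucI[OF has_derivative_mult[OF Suc.prems[THEN Ck_Suc_has_derivative]]])
      (use Suc.prems Suc.IH Ck_SucD[OF Suc.prems(1)] Ck_SucD[OF Suc.prems(2)]
       in \<open>simp add: Ck_add\<close>)
qed

lemma Ck_diff: "Ck k f \<Longrightarrow> Ck k g \<Longrightarrow> Ck k (\<lambda>x. f x - g x)"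
  using Ck_add[of k f "\<lambda>x. (-1) * g x"] Ck_mult[OF Ck_const[of k "-1"], of g] by simp

lemma Ck_prod: "(\<And>i. i \<in> I \<Longrightarrow> Ck k (f i)) \<Longrightarrow> Ck k (\<lambda>x. \<Prod>i\<in>I. f i x)"
  by (induction I rule: infinite_finite_induct) (simp_all add: Ck_const Ck_mult)

text \<open>The derivative of \<open>e\<^sup>-\<^sup>1\<^sup>/\<^sup>t / t\<^sup>m\<close> is a combination of the same functions with larger \<open>m\<close>.
  Treating the whole family at once therefore makes the smoothness at \<open>0\<close> a plain induction.\<close>

definition flat :: "nat \<Rightarrow> real \<Rightarrow> real" where
  "flat m t = (if t > 0 then exp (- 1 / t) / t ^ m else 0)"

lemma flat_tendsto_0: "(flat m \<longlongrightarrow> 0) (at_right 0)"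
proof (rule Lim_transform_eventually)
  have "((\<lambda>s. s ^ m / exp s) \<longlongrightarrow> (0::real)) at_top"
    by (rule tendsto_power_div_exp_0)
  then show "((\<lambda>t. inverse t ^ m / exp (inverse t)) \<longlongrightarrow> (0::real)) (at_right 0)"
    by (rule filterlim_compose) (rule filterlim_inverse_at_top_right)
  show "\<forall>\<^sub>F t in at_right 0. inverse t ^ m / exp (inverse t) = flat m t"
    using eventually_at_right_less[of "0::real"]
    by eventually_elim (simp add: flat_def exp_minus field_simps)
qed

lemma flat_has_real_derivative:
  "(flat m has_real_derivative flat (m + 2) t - real m * flat (m + 1) t) (at t)"
proof (cases t "0::real" rule: linorder_cases)
  case less
  have "((\<lambda>_. 0) has_real_derivative 0) (at t)" by simp
  then have "(flat m has_real_derivative 0) (at t)"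
    by (rule DERIV_cong_ev[THEN iffD1, rotated -1])
      (use less eventually_nhds_in_open[of "{..<0}" t] in
        \<open>auto elim!: eventually_mono simp: flat_def\<close>)
  then show ?thesis using less by (simp add: flat_def)
next
  case equal
  have "((\<lambda>h. flat m h / h) \<longlongrightarrow> 0) (at_right 0)"
    by (rule Lim_transform_eventually[OF flat_tendsto_0[of "Suc m"]])
      (use eventually_at_right_less[of "0::real"] in
        \<open>auto elim!: eventually_mono simp: flat_def field_simps\<close>)
  moreover have "((\<lambda>h. flat m h / h) \<longlongrightarrow> 0) (at_left 0)"
    by (rule tendsto_eventually)
      (simp add: flat_def eventually_at_filter)
  ultimately have "((\<lambda>h. flat m h / h) \<longlongrightarrow> 0) (at 0)"
    by (rule filterlim_split_at[rotated])
  then show ?thesis using equal by (simp add: DERIV_def flat_def)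
next
  case greater
  have "((\<lambda>t. exp (- 1 / t) / t ^ m) has_real_derivative
      flat (m + 2) t - real m * flat (m + 1) t) (at t)"
    using greater
    by (auto intro!: derivative_eq_intros simp: flat_def field_simps power2_eq_square)
      (cases m; simp add: field_simps)
  then show ?thesis
    by (rule DERIV_cong_ev[THEN iffD1, rotated -1])
      (use greater eventually_nhds_in_open[of "{0<..}" t] in
        \<open>auto elim!: eventually_mono simp: flat_def\<close>)
qed

lemma Ck_flat_affine: "Ck k (\<lambda>x. flat m (x \<bullet> v + d))"
proof (induction k arbitrary: m)
  case 0
  have "continuous_on UNIV (flat m)"
    by (meson DERIV_continuous_on flat_has_real_derivative has_field_derivative_at_within)
  then show ?case
    by (auto intro!: continuous_intros continuous_on_compose2[of UNIV "flat m"])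
next
  case (Suc k)
  let ?D = "\<lambda>x h. (h \<bullet> v) * (flat (m + 2) (x \<bullet> v + d) + (- real m) * flat (m + 1) (x \<bullet> v + d))"
  have "((\<lambda>x. flat m (x \<bullet> v + d)) has_derivative ?D x) (at x)" for x
  proof -
    have "((\<lambda>x. x \<bullet> v + d) has_derivative (\<lambda>h. h \<bullet> v)) (at x)"
      by (auto intro!: derivative_eq_intros)
    from has_derivative_compose[OF this
        flat_has_real_derivative[of m, unfolded has_field_derivative_def]]
    show ?thesis by (simp add: mult.commute algebra_simps)
  qed
  then show ?case
    by (rule Ck_SucI) (intro Ck_mult Ck_add Ck_const Suc)
qed

definition box_bump :: "'a::euclidean_space \<Rightarrow> 'a \<Rightarrow> nat \<Rightarrow> 'a \<Rightarrow> real" where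
  "box_bump a b n x = (\<Prod>i\<in>Basis. flat 0 (real (Suc n) * ((x - a) \<bullet> i)) * flat 0 (real (Suc n) * ((b - x) \<bullet> i)))"

lemma Ck_box_bump: "Ck k (box_bump a b n)"
proof -
  have "Ck k (\<lambda>x. flat 0 (x \<bullet> (real (Suc n) *\<^sub>R i) + (- real (Suc n) * (a \<bullet> i)))
      * flat 0 (x \<bullet> (- real (Suc n) *\<^sub>R i) + real (Suc n) * (b \<bullet> i)))" for i
    by (intro Ck_mult Ck_flat_affine)
  then have "Ck k (\<lambda>x. flat 0 (real (Suc n) * ((x - a) \<bullet> i)) * flat 0 (real (Suc n) * ((b - x) \<bullet> i)))" for i
    by (simp add: inner_diff_left algebra_simps)
  then show ?thesis unfolding box_bump_def by (intro Ck_prod)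
qed

lemma flat_0_bounds: "0 \<le> flat 0 t" "flat 0 t \<le> 1"
  by (simp_all add: flat_def)

text \<open>Since \<open>e\<^sup>-\<^sup>1\<^sup>/\<^sup>n\<^sup>s \<longrightarrow> 1\<close> for \<open>s > 0\<close>, rescaling a function that vanishes to infinite order at \<open>0\<close>
  approximates indicators of open boxes from below, without any mollification.\<close>

lemma box_bump_bounds: "0 \<le> box_bump a b n x" "box_bump a b n x \<le> 1"
  unfolding box_bump_def
  by (auto intro!: prod_nonneg prod_le_1 mult_le_one simp: flat_0_bounds)

lemma box_bump_eq_0: "x \<notin> box a b \<Longrightarrow> box_bump a b n x = 0"
  by (auto simp: box_bump_def mem_box flat_def inner_diff_left zero_less_mult_iff prod_zero_iff)

lemma box_bump_tendsto: "(\<lambda>n. box_bump a b n x) \<longlonglongrightarrow> indicat_real (box a b) x"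
proof (cases "x \<in> box a b")
  case True
  have lim: "(\<lambda>n. flat 0 (real (Suc n) * s)) \<longlonglongrightarrow> 1" if "s > 0" for s
  proof -
    have "(\<lambda>n. exp (- (inverse (real (Suc n)) * (1 / s)))) \<longlonglongrightarrow> exp (- (0 * (1 / s)))"
      by (intro tendsto_intros LIMSEQ_inverse_real_of_nat)
    moreover have "flat 0 (real (Suc n) * s) = exp (- (inverse (real (Suc n)) * (1 / s)))" for n
      using that by (simp add: flat_def divide_simps del: of_nat_Suc)
    ultimately show ?thesis by simp
  qed
  have "(\<lambda>n. box_bump a b n x) \<longlonglongrightarrow> (\<Prod>i\<in>(Basis::'a set). 1 * 1)"
    unfolding box_bump_def
    by (intro tendsto_prod tendsto_mult lim) (use True in \<open>auto simp: mem_box inner_diff_left\<close>)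
  then show ?thesis using True by simp
qed (simp add: box_bump_eq_0)

lemma test_functionsI:
  assumes "\<And>k. Ck k \<phi>" and "compact K" and "K \<subseteq> \<Omega>" and "\<And>x. x \<notin> K \<Longrightarrow> \<phi> x = 0"
  shows "\<phi> \<in> test_functions \<Omega>"
proof -
  have sub: "closure {x. \<phi> x \<noteq> 0} \<subseteq> K"
    using assms by (intro closure_minimal compact_imp_closed) auto
  have "compact (closure {x. \<phi> x \<noteq> 0})"
    unfolding compact_closure
    using compact_imp_bounded[OF assms(2)] by (rule bounded_subset) (use assms(4) in blast)
  with sub assms show ?thesis by (auto simp: test_functions_def)
qed

lemma box_bump_test_function:
  assumes "cbox a b \<subseteq> \<Omega>"
  shows "box_bump a b n \<in> test_functions \<Omega>"
  using assms box_bump_eq_0[of _ a b n] box_subset_cbox[of a b]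
  by (intro test_functionsI[where K="cbox a b"] Ck_box_bump compact_cbox) auto

lemma test_function_diff:
  assumes "\<phi> \<in> test_functions \<Omega>" and "\<psi> \<in> test_functions \<Omega>"
  shows "(\<lambda>x. \<phi> x - \<psi> x) \<in> test_functions \<Omega>"
proof (rule test_functionsI)
  let ?K = "closure {x. \<phi> x \<noteq> 0} \<union> closure {x. \<psi> x \<noteq> 0}"
  show "compact ?K" "?K \<subseteq> \<Omega>" "Ck k (\<lambda>x. \<phi> x - \<psi> x)" for k
    using assms unfolding test_functions_def by (blast intro: compact_Un Ck_diff)+
  show "\<phi> x - \<psi> x = 0" if "x \<notin> ?K" for x
  proof -
    have "\<phi> x = 0" "\<psi> x = 0"
      using that closure_subset[of "{x. \<phi> x \<noteq> 0}"] closure_subset[of "{x. \<psi> x \<noteq> 0}"] by blast+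
    then show ?thesis by simp
  qed
qed

lemma test_function_has_derivative:
  assumes "\<phi> \<in> test_functions \<Omega>"
  shows "(\<phi> has_derivative frechet_derivative \<phi> (at x)) (at x)"
proof -
  have "Ck (Suc 0) \<phi>" using assms unfolding test_functions_def by blast
  then show ?thesis by (rule Ck_Suc_has_derivative)
qed

lemma test_function_continuous: "\<phi> \<in> test_functions \<Omega> \<Longrightarrow> continuous_on UNIV \<phi>"
  unfolding test_functions_def by (metis (mono_tags, lifting) Ck.simps(1) mem_Collect_eq)

lemma test_function_partial_continuous:
  assumes "\<phi> \<in> test_functions \<Omega>" and "i \<in> Basis"
  shows "continuous_on UNIV (\<lambda>x. frechet_derivative \<phi> (at x) i)"
proof -
  have "Ck (Suc 0) \<phi>" using assms unfolding test_functions_def by blast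
  then show ?thesis using assms(2) by simp
qed

lemma test_function_eq_0: "\<phi> \<in> test_functions \<Omega> \<Longrightarrow> x \<notin> \<Omega> \<Longrightarrow> \<phi> x = 0"
  using closure_subset[of "{x. \<phi> x \<noteq> 0}"] unfolding test_functions_def by blast

lemma test_function_partial_eq_0:
  assumes "\<phi> \<in> test_functions \<Omega>" and "x \<notin> \<Omega>"
  shows "frechet_derivative \<phi> (at x) i = 0"
proof -
  let ?U = "- closure {x. \<phi> x \<noteq> 0}"
  have "closure {x. \<phi> x \<noteq> 0} \<subseteq> \<Omega>" using assms(1) unfolding test_functions_def by blast
  then have x: "x \<in> ?U" using assms(2) by blast
  have zero: "\<phi> y = 0" if "y \<in> ?U" for y
    using that closure_subset[of "{x. \<phi> x \<noteq> 0}"] by blast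
  have open_U: "open ?U" by (rule open_Compl) (rule closed_closure)
  have "((\<lambda>_. 0::real) has_derivative (\<lambda>_. 0)) (at x)" by simp
  then have "(\<phi> has_derivative (\<lambda>_. 0)) (at x)"
    by (rule has_derivative_transform_within_open[OF _ open_U x]) (rule zero[symmetric])
  from frechet_derivative_at[OF this, symmetric] show ?thesis by (rule fun_cong)
qed

lemma test_function_support_bounded:
  assumes "\<phi> \<in> test_functions \<Omega>"
  obtains R where "R > 0" "\<And>x. norm x > R \<Longrightarrow> \<phi> x = 0"
proof -
  have "compact (closure {x. \<phi> x \<noteq> 0})" using assms unfolding test_functions_def by blast
  then have "bounded {x. \<phi> x \<noteq> 0}" by (rule bounded_subset[OF compact_imp_bounded closure_subset])
  then obtain R where "R > 0" "\<forall>x\<in>{x. \<phi> x \<noteq> 0}. norm x \<le> R"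
    unfolding bounded_pos by blast
  then show ?thesis by (intro that[of R]) fastforce+
qed

section \<open>Integration by parts\<close>

lemma continuous_bounded_support_bounded:
  fixes f :: "'a::euclidean_space \<Rightarrow> 'b::real_normed_vector"
  assumes "continuous_on UNIV f" and "\<And>x. norm x > R \<Longrightarrow> f x = 0"
  obtains B where "B > 0" "\<And>x. norm (f x) \<le> B"
proof -
  have "bounded (f ` cball 0 R)"
    by (intro compact_imp_bounded compact_continuous_image continuous_on_subset[OF assms(1)])
      auto
  then obtain B where "B > 0" and B: "\<And>x. x \<in> cball 0 R \<Longrightarrow> norm (f x) \<le> B"
    unfolding bounded_pos by blast
  have "norm (f x) \<le> B" for x
    using B[of x] assms(2)[of x] \<open>B > 0\<close> by (cases "norm x > R") auto
  with \<open>B > 0\<close> show ?thesis by (rule that)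
qed

lemma integrable_bounded_support:
  fixes f :: "'a::euclidean_space \<Rightarrow> real"
  assumes "f \<in> borel_measurable borel" and "\<And>x. norm x > R \<Longrightarrow> f x = 0" and "\<And>x. \<bar>f x\<bar> \<le> B"
  shows "integrable lborel f"
proof (rule Bochner_Integration.integrable_bound)
  show "integrable lborel (\<lambda>x::'a. B * indicat_real (cball 0 R) x)"
    by (intro integrable_mult_right integrable_real_indicator)
      (simp_all add: emeasure_bounded_finite[OF bounded_cball, unfolded infinity_ennreal_def])
  show "AE x in lborel. norm (f x) \<le> norm (B * indicat_real (cball 0 R) x)"
  proof (rule AE_I2)
    fix x
    show "norm (f x) \<le> norm (B * indicat_real (cball 0 R) x)"
      using assms(2)[of x] assms(3)[of x] by (cases "norm x \<le> R") auto
  qed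
qed (use assms in simp)

lemma integrable_continuous_bounded_support:
  fixes f :: "'a::euclidean_space \<Rightarrow> real"
  assumes "continuous_on UNIV f" and "\<And>x. norm x > R \<Longrightarrow> f x = 0"
  shows "integrable lborel f"
proof -
  obtain B where "\<And>x. norm (f x) \<le> B"
    using continuous_bounded_support_bounded[OF assms] by metis
  then show ?thesis
    using assms by (intro integrable_bounded_support[of f R B] borel_measurable_continuous_onI) auto
qed

lemma integral_translation:
  fixes f :: "'a::euclidean_space \<Rightarrow> real"
  assumes "f \<in> borel_measurable borel"
  shows "(LINT x|lborel. f (x + c)) = (LINT x|lborel. f x)"
proof -
  have "(LINT x|lborel. f x) = integral\<^sup>L (distr lborel borel ((+) c)) f"
    by (simp add: lborel_distr_plus)
  also have "\<dots> = (LINT x|lborel. f (c + x))"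
    using assms by (subst integral_distr) auto
  finally show ?thesis by (simp add: add.commute)
qed

text \<open>The difference quotients have integral \<open>0\<close> because Lebesgue measure is translation
  invariant, and they converge to the derivative boundedly, on a bounded set.\<close>

lemma integral_directional_derivative_eq_0:
  fixes f D :: "'a::euclidean_space \<Rightarrow> real"
  assumes der: "\<And>x. ((\<lambda>h. f (x + h *\<^sub>R u)) has_real_derivative D x) (at 0)"
    and cont: "continuous_on UNIV f" "continuous_on UNIV D"
    and supp: "\<And>x. norm x > R \<Longrightarrow> f x = 0" "\<And>x. norm x > R \<Longrightarrow> D x = 0"
  shows "(LINT x|lborel. D x) = 0"
proof -
  obtain B where B: "B > 0" "\<And>x. \<bar>D x\<bar> \<le> B"
    using continuous_bounded_support_bounded[OF cont(2) supp(2)] by (metis real_norm_def)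
  define h where "h n = inverse (real (Suc n))" for n
  have h: "h n > 0" "h n \<le> 1" for n by (simp_all add: h_def field_simps)
  define q where "q n x = (f (x + h n *\<^sub>R u) - f x) / h n" for n x
  have meas: "f \<in> borel_measurable borel" "D \<in> borel_measurable borel"
    using cont by (auto intro: borel_measurable_continuous_onI)
  have int: "integrable lborel f"
    using cont(1) supp(1) by (rule integrable_continuous_bounded_support)
  have bound: "\<bar>q n x\<bar> \<le> B" for n x
  proof -
    have "((\<lambda>s. f (x + s *\<^sub>R u)) has_real_derivative D (x + s *\<^sub>R u)) (at s)" for s
      using der[of "x + s *\<^sub>R u"] DERIV_shift[of "\<lambda>s. f (x + s *\<^sub>R u)" "D (x + s *\<^sub>R u)" 0 s]
      by (simp add: algebra_simps)
    then obtain s where "f (x + h n *\<^sub>R u) - f (x + 0 *\<^sub>R u) = (h n - 0) * D (x + s *\<^sub>R u)"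
      using MVT2[OF h(1)[of n], of "\<lambda>s. f (x + s *\<^sub>R u)" "\<lambda>s. D (x + s *\<^sub>R u)"] by blast
    then have "q n x = D (x + s *\<^sub>R u)"
      using h(1)[of n] by (simp add: q_def)
    then show ?thesis using B(2) by simp
  qed
  have "(\<lambda>n. LINT x|lborel. q n x) \<longlonglongrightarrow> (LINT x|lborel. D x)"
  proof (rule integral_dominated_convergence)
    show "integrable lborel (\<lambda>x::'a. B * indicat_real (cball 0 (R + norm u)) x)"
      by (intro integrable_mult_right integrable_real_indicator)
        (simp_all add: emeasure_bounded_finite[OF bounded_cball, unfolded infinity_ennreal_def])
    show "AE x in lborel. (\<lambda>n. q n x) \<longlonglongrightarrow> D x"
    proof (rule AE_I2)
      fix x
      have "filterlim h (at 0) sequentially"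
        using h(1) LIMSEQ_inverse_real_of_nat
        by (simp add: filterlim_at h_def[abs_def] del: of_nat_Suc)
      from filterlim_compose[OF der[of x, unfolded DERIV_def] this]
      show "(\<lambda>n. q n x) \<longlonglongrightarrow> D x" by (simp add: q_def)
    qed
    show "AE x in lborel. norm (q n x) \<le> B * indicat_real (cball 0 (R + norm u)) x" for n
    proof (rule AE_I2)
      fix x
      show "norm (q n x) \<le> B * indicat_real (cball 0 (R + norm u)) x"
      proof (cases "norm x \<le> R + norm u")
        case False
        have "norm (h n *\<^sub>R u) \<le> norm u"
          using h[of n] by (simp add: mult_left_le_one_le)
        then have "norm (x + h n *\<^sub>R u) > R"
          using False norm_diff_ineq[of x "h n *\<^sub>R u"] by linarith
        moreover have "norm x > R" using False norm_ge_zero[of u] by linarith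
        ultimately have "q n x = 0" by (simp add: q_def supp)
        then show ?thesis using B by simp
      qed (use bound in simp)
    qed
  qed (use meas in \<open>simp_all add: q_def\<close>)
  moreover have "(LINT x|lborel. q n x) = 0" for n
  proof -
    have "integrable lborel (\<lambda>x. f (x + h n *\<^sub>R u))"
    proof (rule integrable_continuous_bounded_support)
      show "continuous_on UNIV (\<lambda>x. f (x + h n *\<^sub>R u))"
        by (intro continuous_on_compose2[OF cont(1)] continuous_intros) auto
      show "f (x + h n *\<^sub>R u) = 0" if "norm x > R + norm (h n *\<^sub>R u)" for x
        using that norm_diff_ineq[of x "h n *\<^sub>R u"] by (intro supp(1)) linarith
    qed
    then show ?thesis
      using int meas(1) by (simp add: q_def integral_translation)
  qed
  ultimately show ?thesis by (simp add: LIMSEQ_const_iff)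
qed

lemma integral_lebesgue_on_eq_lborel:
  fixes f :: "'a::euclidean_space \<Rightarrow> real"
  assumes "f \<in> borel_measurable borel" and "\<Omega> \<in> sets lebesgue" and "\<And>x. x \<notin> \<Omega> \<Longrightarrow> f x = 0"
  shows "(LINT x|lebesgue_on \<Omega>. f x) = (LINT x|lborel. f x)"
proof -
  have "(LINT x|lebesgue_on \<Omega>. f x) = (LINT x|lebesgue. indicator \<Omega> x *\<^sub>R f x)"
    using assms(2) by (intro integral_restrict_space) simp
  also have "(\<lambda>x. indicator \<Omega> x *\<^sub>R f x) = f"
    using assms(3) by (force simp: indicator_def)
  also have "(LINT x|lebesgue. f x) = (LINT x|lborel. f x)"
    using assms(1) by (intro integral_completion) simp
  finally show ?thesis .
qed

lemma L2_space_continuous_bounded_support: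
  fixes f :: "'a::euclidean_space \<Rightarrow> 'b::euclidean_space"
  assumes cont: "continuous_on UNIV f" and supp: "\<And>x. norm x > R \<Longrightarrow> f x = 0"
    and \<Omega>: "\<Omega> \<in> sets lebesgue"
  shows "f \<in> L2_space \<Omega>"
proof (rule L2_spaceI)
  have "f \<in> borel_measurable lborel" using cont by (simp add: borel_measurable_continuous_onI)
  then show "f \<in> borel_measurable (lebesgue_on \<Omega>)"
    by (intro measurable_restrict_space1 measurable_completion)
  have "integrable lborel (\<lambda>x. (norm (f x))\<^sup>2)"
    by (rule integrable_continuous_bounded_support[of _ R]) (auto intro!: continuous_intros cont simp: supp)
  then have "integrable lebesgue (\<lambda>x. (norm (f x))\<^sup>2)"
    using cont by (subst integrable_completion) (auto intro!: borel_measurable_continuous_onI continuous_intros)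
  then show "integrable (lebesgue_on \<Omega>) (\<lambda>x. (norm (f x))\<^sup>2)"
    using \<Omega> by (subst integrable_restrict_space)
      (simp, rule integrable_mult_indicator)
qed

definition classical_gradient :: "('a::euclidean_space \<Rightarrow> real) \<Rightarrow> 'a \<Rightarrow> 'a" where
  "classical_gradient \<phi> x = (\<Sum>i\<in>Basis. frechet_derivative \<phi> (at x) i *\<^sub>R i)"

lemma classical_gradient_inner:
  "i \<in> Basis \<Longrightarrow> classical_gradient \<phi> x \<bullet> i = frechet_derivative \<phi> (at x) i"
  by (simp add: classical_gradient_def inner_sum_left_Basis)

lemma test_function_directional_derivative:
  assumes \<phi>: "\<phi> \<in> test_functions \<Omega>"
  shows "((\<lambda>h. \<phi> (x + h *\<^sub>R i)) has_real_derivative frechet_derivative \<phi> (at x) i) (at 0)"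
proof -
  have "((\<lambda>h. x + h *\<^sub>R i) has_derivative (\<lambda>h. h *\<^sub>R i)) (at 0)"
    by (auto intro!: derivative_eq_intros)
  moreover have "(\<phi> has_derivative frechet_derivative \<phi> (at x)) (at (x + 0 *\<^sub>R i))"
    using test_function_has_derivative[OF \<phi>] by simp
  ultimately have "((\<lambda>h. \<phi> (x + h *\<^sub>R i)) has_derivative (\<lambda>h. frechet_derivative \<phi> (at x) (h *\<^sub>R i))) (at 0)"
    by (rule has_derivative_compose)
  moreover have "linear (frechet_derivative \<phi> (at x))"
    using test_function_has_derivative[OF \<phi>] has_derivative_linear by blast
  ultimately show ?thesis
    by (simp add: has_field_derivative_def linear_scale mult_commute_abs)
qed

lemma test_function_partial_support:
  assumes \<phi>: "\<phi> \<in> test_functions \<Omega>"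
  obtains R where "R > 0" "\<And>x. norm x > R \<Longrightarrow> \<phi> x = 0" "\<And>x i. norm x > R \<Longrightarrow> frechet_derivative \<phi> (at x) i = 0"
proof -
  obtain R where R: "R > 0" "\<And>x. norm x > R \<Longrightarrow> \<phi> x = 0"
    using test_function_support_bounded[OF \<phi>] by blast
  have "closure {x. \<phi> x \<noteq> 0} \<subseteq> cball 0 R"
    using R(2) by (intro closure_minimal) (force simp: not_less)+
  then have "\<phi> \<in> test_functions (cball 0 R)"
    using \<phi> unfolding test_functions_def by blast
  from test_function_partial_eq_0[OF this] R show ?thesis
    by (intro that[of R]) auto
qed

lemma test_function_L2:
  assumes \<Omega>: "\<Omega> \<in> sets lebesgue" and \<phi>: "\<phi> \<in> test_functions \<Omega>"
  shows "\<phi> \<in> L2_space \<Omega>"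
  using L2_space_continuous_bounded_support[OF test_function_continuous[OF \<phi>] _ \<Omega>]
    test_function_support_bounded[OF \<phi>] by metis

lemma classical_gradient_L2:
  assumes \<Omega>: "\<Omega> \<in> sets lebesgue" and \<phi>: "\<phi> \<in> test_functions \<Omega>"
  shows "classical_gradient \<phi> \<in> L2_space \<Omega>"
proof -
  obtain R where "\<And>x i. norm x > R \<Longrightarrow> frechet_derivative \<phi> (at x) i = 0"
    using test_function_partial_support[OF \<phi>] by metis
  then show ?thesis
    unfolding classical_gradient_def
    by (intro L2_space_continuous_bounded_support[where R=R] \<Omega> continuous_intros
        test_function_partial_continuous[OF \<phi>]) simp_all
qed

lemma classical_gradient_is_weak_gradient:
  fixes \<Omega> :: "'a::euclidean_space set"
  assumes \<Omega>: "\<Omega> \<in> sets lebesgue" and \<phi>: "\<phi> \<in> test_functions \<Omega>"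
  shows "is_weak_gradient \<Omega> \<phi> (classical_gradient \<phi>)"
  unfolding is_weak_gradient_def
proof (intro ballI)
  fix \<psi> :: "'a \<Rightarrow> real" and i :: 'a
  assume \<psi>: "\<psi> \<in> test_functions \<Omega>" and i: "i \<in> Basis"
  let ?d\<phi> = "\<lambda>x. frechet_derivative \<phi> (at x) i" and ?d\<psi> = "\<lambda>x. frechet_derivative \<psi> (at x) i"
  obtain R where R: "\<And>x. norm x > R \<Longrightarrow> \<phi> x = 0" "\<And>x. norm x > R \<Longrightarrow> ?d\<phi> x = 0"
    using test_function_partial_support[OF \<phi>] by metis
  note cont = test_function_continuous[OF \<phi>] test_function_continuous[OF \<psi>]
    test_function_partial_continuous[OF \<phi> i] test_function_partial_continuous[OF \<psi> i]
  have int: "integrable lborel (\<lambda>x. \<phi> x * ?d\<psi> x)" "integrable lborel (\<lambda>x. ?d\<phi> x * \<psi> x)"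
    by (rule integrable_continuous_bounded_support[of _ R], intro continuous_intros cont, simp add: R)+
  have "(LINT x|lborel. \<phi> x * ?d\<psi> x + ?d\<phi> x * \<psi> x) = 0"
  proof (rule integral_directional_derivative_eq_0[where R=R])
    show "((\<lambda>h. \<phi> (x + h *\<^sub>R i) * \<psi> (x + h *\<^sub>R i)) has_real_derivative
        \<phi> x * ?d\<psi> x + ?d\<phi> x * \<psi> x) (at 0)" for x
      using DERIV_mult[OF test_function_directional_derivative[OF \<phi>, of x i]
          test_function_directional_derivative[OF \<psi>, of x i]]
      by (simp add: algebra_simps)
    show "continuous_on UNIV (\<lambda>x. \<phi> x * \<psi> x)"
      "continuous_on UNIV (\<lambda>x. \<phi> x * ?d\<psi> x + ?d\<phi> x * \<psi> x)"
      by (intro continuous_intros cont)+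
  qed (simp_all add: R)
  moreover have "(LINT x|lebesgue_on \<Omega>. \<phi> x * ?d\<psi> x) = (LINT x|lborel. \<phi> x * ?d\<psi> x)"
    "(LINT x|lebesgue_on \<Omega>. ?d\<phi> x * \<psi> x) = (LINT x|lborel. ?d\<phi> x * \<psi> x)"
    using \<Omega> test_function_eq_0[OF \<phi>] test_function_eq_0[OF \<psi>]
    by (auto intro!: integral_lebesgue_on_eq_lborel borel_measurable_continuous_onI continuous_intros cont)
  ultimately show "(LINT x|lebesgue_on \<Omega>. \<phi> x * ?d\<psi> x)
      = - (LINT x|lebesgue_on \<Omega>. (classical_gradient \<phi> x \<bullet> i) * \<psi> x)"
    using int i by (simp add: classical_gradient_inner)
qed

section \<open>The weak gradient and the Poincare inequality\<close>

lemma open_sets_lebesgue: "open \<Omega> \<Longrightarrow> \<Omega> \<in> sets lebesgue"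
  by (simp add: borel_open)

text \<open>Open boxes are stable under intersection and generate the Borel sets, so a vanishing integral
  passes from them to all Borel sets by the \<open>\<pi>\<close>-\<open>\<lambda>\<close> principle; a Lebesgue set differs from a Borel
  set by a null set.\<close>

lemma set_integral_eq_0_of_boxes:
  fixes f :: "'a::euclidean_space \<Rightarrow> real"
  assumes f: "integrable lebesgue f" and total: "(LINT x|lebesgue. f x) = 0"
    and boxes: "\<And>c d. (LINT x:box c d|lebesgue. f x) = 0" and A: "A \<in> sets lebesgue"
  shows "(LINT x:A|lebesgue. f x) = 0"
proof -
  have set_int: "set_integrable lebesgue A f" if "A \<in> sets lebesgue" for A
    using that f unfolding set_integrable_def by (rule integrable_mult_indicator)
  have borel: "(LINT x:A|lebesgue. f x) = 0" if "A \<in> sets borel" for A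
  proof -
    let ?G = "range (\<lambda>(a, b). box a b :: 'a set)"
    have sets_G: "sets borel = sigma_sets UNIV ?G"
      unfolding borel_eq_box by (rule sets_measure_of) simp
    then have leb: "B \<in> sets lebesgue" if "B \<in> sigma_sets UNIV ?G" for B
      using that by (metis sets_completionI_sets sets_lborel)
    have "Int_stable ?G"
    proof (rule Int_stableI)
      fix A B assume "A \<in> ?G" "B \<in> ?G"
      then obtain a b c d where "A = box a b" "B = box c d" by auto
      then obtain l u where "A \<inter> B = box l u" using box_Int_box by blast
      then show "A \<inter> B \<in> ?G" by (intro range_eqI[of _ _ "(l, u)"]) simp
    qed
    moreover have "?G \<subseteq> Pow UNIV" by simp
    moreover have "A \<in> sigma_sets UNIV ?G" using that sets_G by simp
    ultimately show ?thesis
    proof (induction A rule: sigma_sets_induct_disjoint)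
      case (basic A)
      then show ?case using boxes by auto
    next
      case empty
      show ?case by (simp add: set_lebesgue_integral_def)
    next
      case (compl A)
      have "(LINT x:UNIV - A|lebesgue. f x) = (LINT x|lebesgue. f x) - (LINT x:A|lebesgue. f x)"
      proof -
        have "indicator (UNIV - A) x *\<^sub>R f x = f x - indicator A x *\<^sub>R f x" for x
          by (simp add: indicator_def)
        then show ?thesis
          using f set_int[OF leb[OF compl(1)]] unfolding set_lebesgue_integral_def set_integrable_def
          by (simp only: Bochner_Integration.integral_diff)
      qed
      then show ?case using total compl by simp
    next
      case (union A)
      have "\<And>i. A i \<in> sets lebesgue" using union(2) leb by blast
      moreover have "(\<Union>i. A i) \<in> sets lebesgue" using calculation by blast
      ultimately have "(LINT x:(\<Union>i. A i)|lebesgue. f x) = (\<Sum>i. (LINT x:A i|lebesgue. f x))"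
        using disjoint_family_onD[OF union(1) UNIV_I UNIV_I] set_int
        by (intro lebesgue_integral_countable_add) simp_all
      then show ?case using union(3) by simp
    qed
  qed
  obtain S N N' where SN: "A = S \<union> N" "N \<subseteq> N'" "N' \<in> null_sets lborel" "S \<in> sets lborel"
    using A by (rule sets_completionE)
  have "(LINT x:A|lebesgue. f x) = (LINT x:S|lebesgue. f x)"
    unfolding set_lebesgue_integral_def
  proof (rule integral_cong_AE)
    have "AE x in lborel. x \<notin> N'" using SN(3) by (rule AE_not_in)
    then have "AE x in lebesgue. x \<notin> N'" by (rule AE_completion)
    then show "AE x in lebesgue. indicator A x *\<^sub>R f x = indicator S x *\<^sub>R f x"
      by eventually_elim (use SN(1,2) in \<open>auto simp: indicator_def\<close>)
    have "S \<in> sets lebesgue" using SN(4) by auto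
    then show "(\<lambda>x. indicator A x *\<^sub>R f x) \<in> borel_measurable lebesgue"
      "(\<lambda>x. indicator S x *\<^sub>R f x) \<in> borel_measurable lebesgue"
      using set_int A unfolding set_integrable_def by blast+
  qed
  then show ?thesis using borel SN(4) by simp
qed

text \<open>The fundamental lemma of the calculus of variations. Bumps on an open box converge boundedly to
  its indicator, so that \<open>g\<close> has integral \<open>0\<close> over every box whose closure lies in \<open>\<Omega>\<close>, hence over
  all measurable subsets of such a box. Countably many of these boxes cover \<open>\<Omega>\<close> up to a null set.\<close>

lemma AE_eq_0_of_test_functions:
  fixes g :: "'a::euclidean_space \<Rightarrow> real"
  assumes \<Omega>: "open \<Omega>" and g: "g \<in> L2_space \<Omega>"
    and test: "\<And>\<phi>. \<phi> \<in> test_functions \<Omega> \<Longrightarrow> (LINT x|lebesgue_on \<Omega>. g x * \<phi> x) = 0"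
  shows "AE x in lebesgue_on \<Omega>. g x = 0"
proof -
  have \<Omega>_leb: "\<Omega> \<in> sets lebesgue" using \<Omega> by (rule open_sets_lebesgue)
  have box_AE: "AE x in lebesgue. x \<in> box a b \<longrightarrow> g x = 0" if ab: "cbox a b \<subseteq> \<Omega>" for a b
  proof -
    define f where "f x = indicator (box a b) x * g x" for x
    have sub: "box a b \<subseteq> \<Omega>" using ab box_subset_cbox by blast
    have box_leb: "box c d \<in> sets lebesgue" for c d :: 'a
      by (rule open_sets_lebesgue) (rule open_box)
    have gm: "(\<lambda>x. indicator \<Omega> x *\<^sub>R g x) \<in> borel_measurable lebesgue"
      using L2_space_measurable[OF g] \<Omega>_leb by (simp add: borel_measurable_restrict_space_iff)
    have g2: "integrable lebesgue (\<lambda>x. indicator \<Omega> x *\<^sub>R (norm (g x))\<^sup>2)"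
      using L2_space_integrable[OF g] \<Omega>_leb by (subst integrable_restrict_space[symmetric]) auto
    have fm: "f \<in> borel_measurable lebesgue"
    proof -
      have "(\<lambda>x. indicator (box a b) x * (indicator \<Omega> x *\<^sub>R g x)) \<in> borel_measurable lebesgue"
        using gm box_leb by (intro borel_measurable_times borel_measurable_indicator) auto
      moreover have "(\<lambda>x. indicator (box a b) x * (indicator \<Omega> x *\<^sub>R g x)) = f"
        using sub by (auto simp: f_def indicator_def fun_eq_iff)
      ultimately show ?thesis by simp
    qed
    have f: "integrable lebesgue f"
    proof (rule Bochner_Integration.integrable_bound)
      have "integrable lebesgue (indicat_real (box a b))"
        by (intro integrable_real_indicator box_leb)
          (simp add: emeasure_completion[of _ lborel] emeasure_bounded_finite[OF bounded_box, unfolded infinity_ennreal_def])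
      with g2 show "integrable lebesgue (\<lambda>x. indicator \<Omega> x *\<^sub>R (norm (g x))\<^sup>2 + indicat_real (box a b) x)"
        by (rule Bochner_Integration.integrable_add)
      have le: "\<bar>t\<bar> \<le> t\<^sup>2 + 1" for t :: real
        using sum_squares_bound[of "\<bar>t\<bar>" 1] by (simp add: power2_eq_square) 
      show "AE x in lebesgue. norm (f x) \<le> norm (indicator \<Omega> x *\<^sub>R (norm (g x))\<^sup>2 + indicat_real (box a b) x)"
        using sub le by (intro AE_I2) (auto simp: f_def indicator_def)
    qed (rule fm)
    have boxes: "(LINT x:box c d|lebesgue. f x) = 0" for c d
    proof -
      obtain l u where lu: "box a b \<inter> box c d = box l u" by (simp add: box_Int_box)
      show ?thesis
      proof (cases "box l u = {}")
        case True
        then have "(\<lambda>x. indicator (box c d) x *\<^sub>R f x) = (\<lambda>x. 0)"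
          using lu by (auto simp: f_def indicator_def fun_eq_iff)
        then show ?thesis unfolding set_lebesgue_integral_def by simp
      next
        case False
        then have "cbox l u \<subseteq> cbox a b"
          using lu box_ne_empty closure_mono[of "box l u" "box a b"] 
          by (metis Int_lower1 closure_box closure_empty inf_bot_left)
        then have test_bump: "box_bump l u n \<in> test_functions \<Omega>" for n
          using ab by (intro box_bump_test_function) blast
        have "(\<lambda>n. LINT x|lebesgue_on \<Omega>. g x * box_bump l u n x) \<longlonglongrightarrow> (LINT x|lebesgue_on \<Omega>. g x * indicator (box l u) x)"
        proof (rule integral_dominated_convergence)
          have "integrable lebesgue (\<lambda>x. indicator \<Omega> x *\<^sub>R \<bar>f x\<bar>)"
            using f \<Omega>_leb by (intro integrable_mult_indicator integrable_abs)
          then show "integrable (lebesgue_on \<Omega>) (\<lambda>x. \<bar>f x\<bar>)"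
            using \<Omega>_leb by (subst integrable_restrict_space) auto
          show "AE x in lebesgue_on \<Omega>. (\<lambda>n. g x * box_bump l u n x) \<longlonglongrightarrow> g x * indicator (box l u) x"
            by (intro AE_I2 tendsto_mult tendsto_const box_bump_tendsto)
          show "AE x in lebesgue_on \<Omega>. norm (g x * box_bump l u n x) \<le> \<bar>f x\<bar>" for n
          proof (rule AE_I2)
            fix x
            show "norm (g x * box_bump l u n x) \<le> \<bar>f x\<bar>"
            proof (cases "x \<in> box l u")
              case True
              then have "x \<in> box a b" using lu by blast
              then show ?thesis
                using box_bump_bounds[of l u n x] by (simp add: f_def abs_mult mult_left_le)
            qed (simp add: box_bump_eq_0)
          qed
          have "box_bump l u n \<in> borel_measurable (lebesgue_on \<Omega>)" for n
            by (intro L2_space_measurable test_function_L2 \<Omega>_leb test_bump)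
          then show "(\<lambda>x. g x * box_bump l u n x) \<in> borel_measurable (lebesgue_on \<Omega>)" for n
            using L2_space_measurable[OF g] by (rule borel_measurable_times[rotated])
          have "indicat_real (box l u) \<in> borel_measurable (lebesgue_on \<Omega>)"
            by (intro measurable_restrict_space1 borel_measurable_indicator box_leb)
          then show "(\<lambda>x. g x * indicator (box l u) x) \<in> borel_measurable (lebesgue_on \<Omega>)"
            using L2_space_measurable[OF g] by (rule borel_measurable_times[rotated])
        qed
        then have "(LINT x|lebesgue_on \<Omega>. g x * indicator (box l u) x) = 0"
          using test[OF test_bump] by (simp add: LIMSEQ_const_iff)
        moreover have "(LINT x|lebesgue_on \<Omega>. g x * indicator (box l u) x)
            = (LINT x|lebesgue. indicator \<Omega> x *\<^sub>R (g x * indicator (box l u) x))"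
          using \<Omega>_leb by (intro integral_restrict_space) simp
        moreover have "indicator \<Omega> x *\<^sub>R (g x * indicator (box l u) x) = indicator (box c d) x *\<^sub>R f x" for x
          using lu sub by (auto simp: f_def indicator_def)
        ultimately show ?thesis by (simp add: set_lebesgue_integral_def)
      qed
    qed
    have total: "(LINT x|lebesgue. f x) = 0"
      using boxes[of a b] unfolding set_lebesgue_integral_def
      by (simp add: f_def mult.assoc[symmetric] flip: indicator_inter_arith)
    have "finite_measure (lebesgue_on (box a b))"
      by (rule finite_measure_lebesgue_on) (rule lmeasurable_box)
    then have sigma_finite: "sigma_finite_measure (lebesgue_on (box a b))"
      by (rule finite_measure.axioms)
    have "AE x in lebesgue_on (box a b). f x = 0"
    proof (rule sigma_finite_measure.density_zero[OF sigma_finite])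
      show "integrable (lebesgue_on (box a b)) f"
        using f box_leb by (subst integrable_restrict_space) (simp, rule integrable_mult_indicator)
      fix A assume A: "A \<in> sets (lebesgue_on (box a b))"
      then have A: "A \<in> sets lebesgue" "A \<subseteq> box a b"
        using box_leb by (auto simp: sets_restrict_space_iff)
      have "(LINT x:A|lebesgue_on (box a b). f x) = (LINT x|lebesgue. indicator (box a b) x *\<^sub>R indicator A x *\<^sub>R f x)"
        unfolding set_lebesgue_integral_def using box_leb by (intro integral_restrict_space) simp
      also have "\<dots> = (LINT x:A|lebesgue. f x)"
        unfolding set_lebesgue_integral_def using A(2)
        by (intro Bochner_Integration.integral_cong) (auto simp: indicator_def)
      also have "\<dots> = 0"
        using f total boxes A(1) by (rule set_integral_eq_0_of_boxes)
      finally show "(LINT x:A|lebesgue_on (box a b). f x) = 0" .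
    qed
    then show ?thesis
      using box_leb by (simp add: AE_restrict_space_iff f_def indicator_def cong: conj_cong imp_cong)
  qed
  obtain \<D> where \<D>: "countable \<D>" "\<D> \<subseteq> Pow \<Omega>" "\<And>X. X \<in> \<D> \<Longrightarrow> \<exists>a b. X = cbox a b" "\<Union>\<D> = \<Omega>"
    using open_countable_Union_open_cbox[OF \<Omega>] by metis
  \<comment> \<open>the covering sets are closed boxes, and only their interiors have been treated; the faces
    are null sets\<close>
  have "AE x in lebesgue. \<forall>X\<in>\<D>. x \<in> X \<longrightarrow> g x = 0"
  proof (subst AE_ball_countable[OF \<D>(1)], rule)
    fix X assume X: "X \<in> \<D>"
    then obtain a b where ab: "X = cbox a b" using \<D>(3) by blast
    have "AE x in lebesgue. x \<notin> cbox a b - box a b"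
      using negligible_frontier_interval[of a b] by (intro AE_not_in) (simp add: negligible_iff_null_sets)
    moreover have "AE x in lebesgue. x \<in> box a b \<longrightarrow> g x = 0"
      using X \<D>(2) ab by (intro box_AE) auto
    ultimately show "AE x in lebesgue. x \<in> X \<longrightarrow> g x = 0"
      unfolding ab by eventually_elim auto
  qed
  then have "AE x in lebesgue. x \<in> \<Omega> \<longrightarrow> g x = 0"
    by eventually_elim (use \<D>(4) in blast)
  then show ?thesis using \<Omega>_leb by (simp add: AE_restrict_space_iff)
qed

lemma weak_gradient_diff:
  assumes \<Omega>: "open \<Omega>"
    and u: "u \<in> L2_space \<Omega>" "g \<in> L2_space \<Omega>" "is_weak_gradient \<Omega> u g"
    and v: "v \<in> L2_space \<Omega>" "h \<in> L2_space \<Omega>" "is_weak_gradient \<Omega> v h"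
  shows "is_weak_gradient \<Omega> (\<lambda>x. u x - v x) (\<lambda>x. g x - h x)"
  unfolding is_weak_gradient_def
proof (intro ballI)
  fix \<phi> and i :: 'a assume \<phi>: "\<phi> \<in> test_functions \<Omega>" and i: "i \<in> Basis"
  let ?d = "\<lambda>x. frechet_derivative \<phi> (at x) i"
  have \<phi>2: "\<phi> \<in> L2_space \<Omega>" and d: "?d \<in> L2_space \<Omega>"
    using test_function_L2[OF open_sets_lebesgue[OF \<Omega>] \<phi>] classical_gradient_inner[OF i]
      L2_space_inner_const[OF classical_gradient_L2[OF open_sets_lebesgue[OF \<Omega>] \<phi>], of i]
    by simp_all
  have "(LINT x|lebesgue_on \<Omega>. u x * ?d x) = - (LINT x|lebesgue_on \<Omega>. (g x \<bullet> i) * \<phi> x)"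
    "(LINT x|lebesgue_on \<Omega>. v x * ?d x) = - (LINT x|lebesgue_on \<Omega>. (h x \<bullet> i) * \<phi> x)"
    using u(3) v(3) \<phi> i unfolding is_weak_gradient_def by blast+
  then show "(LINT x|lebesgue_on \<Omega>. (u x - v x) * ?d x)
      = - (LINT x|lebesgue_on \<Omega>. ((g x - h x) \<bullet> i) * \<phi> x)"
    using L2_space_inner_integrable[OF u(1) d] L2_space_inner_integrable[OF v(1) d]
      L2_space_inner_integrable[OF L2_space_inner_const[OF u(2), of i] \<phi>2]
      L2_space_inner_integrable[OF L2_space_inner_const[OF v(2), of i] \<phi>2]
    by (simp add: left_diff_distrib inner_diff_left)
qed

text \<open>Uniqueness is what makes the gradient chosen by \<open>wgrad\<close> linear up to null sets, and makes it
  agree with the classical gradient on test functions.\<close>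

lemma weak_gradient_unique:
  assumes \<Omega>: "open \<Omega>" and g: "g \<in> L2_space \<Omega>" "is_weak_gradient \<Omega> u g"
    and h: "h \<in> L2_space \<Omega>" "is_weak_gradient \<Omega> u h"
  shows "AE x in lebesgue_on \<Omega>. g x = h x"
proof -
  have "AE x in lebesgue_on \<Omega>. (g x - h x) \<bullet> i = 0" if i: "i \<in> Basis" for i
  proof (rule AE_eq_0_of_test_functions[OF \<Omega>])
    show "(\<lambda>x. (g x - h x) \<bullet> i) \<in> L2_space \<Omega>"
      using g h by (intro L2_space_inner_const L2_space_diff)
    fix \<phi> assume \<phi>: "\<phi> \<in> test_functions \<Omega>"
    have \<phi>2: "\<phi> \<in> L2_space \<Omega>" using test_function_L2[OF open_sets_lebesgue[OF \<Omega>] \<phi>] .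
    have "- (LINT x|lebesgue_on \<Omega>. (g x \<bullet> i) * \<phi> x) = - (LINT x|lebesgue_on \<Omega>. (h x \<bullet> i) * \<phi> x)"
      using g(2)[unfolded is_weak_gradient_def, rule_format, OF \<phi> i]
        h(2)[unfolded is_weak_gradient_def, rule_format, OF \<phi> i] by (rule trans[OF sym])
    then show "(LINT x|lebesgue_on \<Omega>. (g x - h x) \<bullet> i * \<phi> x) = 0"
      using L2_space_inner_integrable[OF L2_space_inner_const[OF g(1), of i] \<phi>2]
        L2_space_inner_integrable[OF L2_space_inner_const[OF h(1), of i] \<phi>2]
      by (simp add: left_diff_distrib inner_diff_left)
  qed
  then have "AE x in lebesgue_on \<Omega>. \<forall>i\<in>Basis. (g x - h x) \<bullet> i = 0"
    by (subst AE_ball_countable) (auto intro: countable_finite)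
  then show ?thesis by eventually_elim (rule euclidean_eqI, simp add: inner_diff_left)
qed

lemma H1_space_L2: "u \<in> H1_space \<Omega> \<Longrightarrow> u \<in> L2_space \<Omega>"
  by (simp add: H1_space_def)

lemma wgrad_props:
  assumes "u \<in> H1_space \<Omega>"
  shows wgrad_L2: "wgrad \<Omega> u \<in> L2_space \<Omega>"
    and wgrad_is_weak_gradient: "is_weak_gradient \<Omega> u (wgrad \<Omega> u)"
proof -
  have "\<exists>g. g \<in> L2_space \<Omega> \<and> is_weak_gradient \<Omega> u g"
    using assms by (auto simp: H1_space_def)
  from someI_ex[OF this] show "wgrad \<Omega> u \<in> L2_space \<Omega>" "is_weak_gradient \<Omega> u (wgrad \<Omega> u)"
    unfolding wgrad_def by blast+
qed

lemma H10_space_H1: "u \<in> H10_space \<Omega> \<Longrightarrow> u \<in> H1_space \<Omega>"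
  by (simp add: H10_space_def)

lemmas H10_space_L2 = H1_space_L2[OF H10_space_H1]
lemmas H10_wgrad_L2 = wgrad_L2[OF H10_space_H1]

lemma L2_norm_le_H1_norm: "L2_norm \<Omega> u \<le> H1_norm \<Omega> u"
  and L2_norm_wgrad_le_H1_norm: "L2_norm \<Omega> (wgrad \<Omega> u) \<le> H1_norm \<Omega> u"
  unfolding H1_norm_def by (rule real_le_rsqrt; simp)+

lemma H1_norm_le: "H1_norm \<Omega> u \<le> L2_norm \<Omega> u + L2_norm \<Omega> (wgrad \<Omega> u)"
  unfolding H1_norm_def by (rule sqrt_sum_squares_le_sum) (simp_all add: L2_norm_nonneg)

lemma H1_space_diff:
  assumes \<Omega>: "open \<Omega>" and u: "u \<in> H1_space \<Omega>" and v: "v \<in> H1_space \<Omega>"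
  shows "(\<lambda>x. u x - v x) \<in> H1_space \<Omega>"
proof -
  have "is_weak_gradient \<Omega> (\<lambda>x. u x - v x) (\<lambda>x. wgrad \<Omega> u x - wgrad \<Omega> v x)"
    using u v by (intro weak_gradient_diff \<Omega> H1_space_L2 wgrad_props)
  then show ?thesis
    using L2_space_diff[OF H1_space_L2[OF u] H1_space_L2[OF v]] L2_space_diff[OF wgrad_L2[OF u] wgrad_L2[OF v]]
    unfolding H1_space_def by blast
qed

lemma wgrad_diff:
  assumes \<Omega>: "open \<Omega>" and u: "u \<in> H1_space \<Omega>" and v: "v \<in> H1_space \<Omega>"
  shows "AE x in lebesgue_on \<Omega>. wgrad \<Omega> (\<lambda>x. u x - v x) x = wgrad \<Omega> u x - wgrad \<Omega> v x"
  using u v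
  by (intro weak_gradient_unique[OF \<Omega>, of _ "\<lambda>x. u x - v x"] weak_gradient_diff \<Omega> L2_space_diff
      H1_space_L2 wgrad_props H1_space_diff)

lemma L2_norm_wgrad_diff:
  assumes \<Omega>: "open \<Omega>" and u: "u \<in> H1_space \<Omega>" and v: "v \<in> H1_space \<Omega>"
  shows "L2_norm \<Omega> (wgrad \<Omega> (\<lambda>x. u x - v x)) = L2_norm \<Omega> (\<lambda>x. wgrad \<Omega> u x - wgrad \<Omega> v x)"
  using u v by (intro L2_norm_cong_AE wgrad_diff L2_space_diff wgrad_L2 H1_space_diff \<Omega>)

text \<open>The function \<open>0\<close> is a weak gradient of \<open>u - v\<close>.\<close>

lemma L2_norm_wgrad_cong_AE:
  assumes \<Omega>: "open \<Omega>" and u: "u \<in> H1_space \<Omega>" and v: "v \<in> H1_space \<Omega>"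
    and eq: "AE x in lebesgue_on \<Omega>. u x = v x"
  shows "L2_norm \<Omega> (wgrad \<Omega> u) = L2_norm \<Omega> (wgrad \<Omega> v)"
proof (rule L2_norm_cong_AE)
  have "(LINT x|lebesgue_on \<Omega>. (u x - v x) * D x) = 0" for D :: "'a \<Rightarrow> real"
    by (rule integral_eq_zero_AE) (use eq in eventually_elim, simp)
  then have "is_weak_gradient \<Omega> (\<lambda>x. u x - v x) (\<lambda>_. 0)" by (simp add: is_weak_gradient_def)
  moreover have "(\<lambda>_. 0) \<in> L2_space \<Omega>" by (simp add: L2_space_def)
  ultimately have "AE x in lebesgue_on \<Omega>. wgrad \<Omega> (\<lambda>x. u x - v x) x = 0"
    using u v by (intro weak_gradient_unique[OF \<Omega>, of _ "\<lambda>x. u x - v x"] wgrad_props H1_space_diff[OF \<Omega>]) 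
  with wgrad_diff[OF \<Omega> u v] show "AE x in lebesgue_on \<Omega>. wgrad \<Omega> u x = wgrad \<Omega> v x"
    by eventually_elim simp
qed (use u v in \<open>simp_all add: wgrad_L2\<close>)

lemma L2_inner_wgrad_diff:
  assumes \<Omega>: "open \<Omega>" and u: "u \<in> H1_space \<Omega>" and v: "v \<in> H1_space \<Omega>" and g: "g \<in> L2_space \<Omega>"
  shows "L2_inner \<Omega> g (wgrad \<Omega> (\<lambda>x. u x - v x)) = L2_inner \<Omega> g (wgrad \<Omega> u) - L2_inner \<Omega> g (wgrad \<Omega> v)"
proof -
  have "L2_inner \<Omega> g (wgrad \<Omega> (\<lambda>x. u x - v x)) = L2_inner \<Omega> g (\<lambda>x. wgrad \<Omega> u x - wgrad \<Omega> v x)"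
    using u v g by (intro L2_inner_cong_AE wgrad_diff L2_space_diff wgrad_L2 H1_space_diff \<Omega>) auto
  then show ?thesis using u v g by (simp add: L2_inner_diff_right wgrad_L2)
qed

lemma test_function_H1: "open \<Omega> \<Longrightarrow> \<phi> \<in> test_functions \<Omega> \<Longrightarrow> \<phi> \<in> H1_space \<Omega>"
  unfolding H1_space_def
  by (simp add: open_sets_lebesgue test_function_L2)
    (blast intro: open_sets_lebesgue classical_gradient_L2 classical_gradient_is_weak_gradient)

lemma wgrad_test_function:
  assumes \<Omega>: "open \<Omega>" and "\<phi> \<in> test_functions \<Omega>"
  shows "L2_norm \<Omega> (wgrad \<Omega> \<phi>) = L2_norm \<Omega> (classical_gradient \<phi>)"
  using open_sets_lebesgue[OF \<Omega>] assms
  by (intro L2_norm_cong_AE weak_gradient_unique[OF \<Omega>, of _ \<phi>] wgrad_props test_function_H1 \<Omega>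
      classical_gradient_L2 classical_gradient_is_weak_gradient)

lemma H10_space_diff:
  assumes \<Omega>: "open \<Omega>" and u: "u \<in> H10_space \<Omega>" and v: "v \<in> H10_space \<Omega>"
  shows "(\<lambda>x. u x - v x) \<in> H10_space \<Omega>"
proof -
  obtain \<phi> where \<phi>: "\<And>n::nat. \<phi> n \<in> test_functions \<Omega>" "(\<lambda>n. H1_norm \<Omega> (\<lambda>x. u x - \<phi> n x)) \<longlonglongrightarrow> 0"
    using u unfolding H10_space_def by blast
  obtain \<psi> where \<psi>: "\<And>n::nat. \<psi> n \<in> test_functions \<Omega>" "(\<lambda>n. H1_norm \<Omega> (\<lambda>x. v x - \<psi> n x)) \<longlonglongrightarrow> 0"
    using v unfolding H10_space_def by blast
  have "(\<lambda>n. H1_norm \<Omega> (\<lambda>x. (u x - v x) - (\<phi> n x - \<psi> n x))) \<longlonglongrightarrow> 0"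
  proof (rule Lim_null_comparison)
    show "(\<lambda>n. 2 * (H1_norm \<Omega> (\<lambda>x. u x - \<phi> n x) + H1_norm \<Omega> (\<lambda>x. v x - \<psi> n x))) \<longlonglongrightarrow> 0"
      using \<phi>(2) \<psi>(2) by (auto intro!: tendsto_eq_intros)
    show "\<forall>\<^sub>F n in sequentially. norm (H1_norm \<Omega> (\<lambda>x. (u x - v x) - (\<phi> n x - \<psi> n x)))
        \<le> 2 * (H1_norm \<Omega> (\<lambda>x. u x - \<phi> n x) + H1_norm \<Omega> (\<lambda>x. v x - \<psi> n x))"
    proof (rule always_eventually, rule allI)
      fix n
      define f g where "f = (\<lambda>x. u x - \<phi> n x)" and "g = (\<lambda>x. v x - \<psi> n x)"
      have H1: "f \<in> H1_space \<Omega>" "g \<in> H1_space \<Omega>"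
        unfolding f_def g_def
        by (intro H1_space_diff test_function_H1 \<Omega> \<phi> \<psi> H10_space_H1[OF u] H10_space_H1[OF v])+
      have "(\<lambda>x. f x - g x) = (\<lambda>x. (u x - v x) - (\<phi> n x - \<psi> n x))"
        by (simp add: fun_eq_iff f_def g_def)
      moreover have "H1_norm \<Omega> (\<lambda>x. f x - g x) \<le> 2 * (H1_norm \<Omega> f + H1_norm \<Omega> g)"
      proof -
        have "L2_norm \<Omega> (\<lambda>x. f x - g x) \<le> H1_norm \<Omega> f + H1_norm \<Omega> g"
          using L2_norm_diff_le[OF H1_space_L2[OF H1(1)] H1_space_L2[OF H1(2)]]
          by (rule order_trans) (intro add_mono L2_norm_le_H1_norm)
        moreover have "L2_norm \<Omega> (wgrad \<Omega> (\<lambda>x. f x - g x)) \<le> H1_norm \<Omega> f + H1_norm \<Omega> g"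
          unfolding L2_norm_wgrad_diff[OF \<Omega> H1] using L2_norm_diff_le[OF wgrad_L2[OF H1(1)] wgrad_L2[OF H1(2)]]
          by (rule order_trans) (intro add_mono L2_norm_wgrad_le_H1_norm)
        ultimately show ?thesis
          unfolding mult_2 by (rule order_trans[OF H1_norm_le add_mono])
      qed
      moreover have "0 \<le> H1_norm \<Omega> w" for w by (simp add: H1_norm_def)
      ultimately show "norm (H1_norm \<Omega> (\<lambda>x. (u x - v x) - (\<phi> n x - \<psi> n x)))
          \<le> 2 * (H1_norm \<Omega> (\<lambda>x. u x - \<phi> n x) + H1_norm \<Omega> (\<lambda>x. v x - \<psi> n x))"
        by (simp add: f_def g_def)
    qed
  qed
  moreover have "\<And>n. (\<lambda>x. \<phi> n x - \<psi> n x) \<in> test_functions \<Omega>"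
    using \<phi>(1) \<psi>(1) by (intro test_function_diff)
  moreover have "(\<lambda>x. u x - v x) \<in> H1_space \<Omega>"
    using u v by (intro H1_space_diff H10_space_H1 \<Omega>)
  ultimately show ?thesis
    unfolding H10_space_def by (auto intro!: exI[of _ "\<lambda>n x. \<phi> n x - \<psi> n x"])
qed

text \<open>If \<open>\<Omega>\<close> lies in the ball of radius \<open>R\<close>, integrating
  \<open>\<partial>\<^sub>i (x\<^sub>i \<phi>\<^sup>2) = \<phi>\<^sup>2 + 2 x\<^sub>i \<phi> \<partial>\<^sub>i \<phi>\<close>
  bounds \<open>\<parallel>\<phi>\<parallel>\<^sup>2\<close> by \<open>2 R \<parallel>\<phi>\<parallel> \<parallel>\<nabla>\<phi>\<parallel>\<close>.\<close>

lemma Poincare_test_function: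
  assumes \<Omega>: "open \<Omega>" and \<phi>: "\<phi> \<in> test_functions \<Omega>" and R: "0 \<le> R" "\<And>x. x \<in> \<Omega> \<Longrightarrow> norm x \<le> R"
  shows "L2_norm \<Omega> \<phi> \<le> 2 * R * L2_norm \<Omega> (classical_gradient \<phi>)"
proof -
  obtain i :: 'a where i: "i \<in> Basis" using nonempty_Basis by blast
  note leb = open_sets_lebesgue[OF \<Omega>]
  let ?d = "\<lambda>x. frechet_derivative \<phi> (at x) i" and ?h = "\<lambda>x. (x \<bullet> i) * frechet_derivative \<phi> (at x) i"
  obtain S where S: "\<And>x. norm x > S \<Longrightarrow> \<phi> x = 0" "\<And>x. norm x > S \<Longrightarrow> ?d x = 0"
    using test_function_partial_support[OF \<phi>] by metis
  note cont = test_function_continuous[OF \<phi>] test_function_partial_continuous[OF \<phi> i]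
  have \<phi>2: "\<phi> \<in> L2_space \<Omega>" using leb \<phi> by (rule test_function_L2)
  have h: "?h \<in> L2_space \<Omega>"
  proof (rule L2_space_continuous_bounded_support[where R=S, OF _ _ leb])
    show "continuous_on UNIV ?h" by (intro continuous_intros cont)
    show "?h x = 0" if "norm x > S" for x using that by (simp add: S(2))
  qed
  have "(LINT x|lborel. \<phi> x * \<phi> x + 2 * (\<phi> x * ?h x)) = 0"
  proof (rule integral_directional_derivative_eq_0[where R=S])
    have lin: "((\<lambda>h. (x + h *\<^sub>R i) \<bullet> i) has_real_derivative 1) (at 0)" for x
      using i by (auto intro!: derivative_eq_intros simp: inner_add_left)
    note d = test_function_directional_derivative[OF \<phi>, of _ i]
    show "((\<lambda>h. ((x + h *\<^sub>R i) \<bullet> i) * (\<phi> (x + h *\<^sub>R i) * \<phi> (x + h *\<^sub>R i))) has_real_derivative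
        \<phi> x * \<phi> x + 2 * (\<phi> x * ?h x)) (at 0)" for x
      using DERIV_mult[OF lin[of x] DERIV_mult[OF d[of x] d[of x]]] by (simp add: algebra_simps)
    show "continuous_on UNIV (\<lambda>x. (x \<bullet> i) * (\<phi> x * \<phi> x))"
      "continuous_on UNIV (\<lambda>x. \<phi> x * \<phi> x + 2 * (\<phi> x * ?h x))"
      by (intro continuous_intros cont)+
  qed (simp_all add: S)
  also have "(LINT x|lborel. \<phi> x * \<phi> x + 2 * (\<phi> x * ?h x)) = (LINT x|lebesgue_on \<Omega>. \<phi> x * \<phi> x + 2 * (\<phi> x * ?h x))"
    using leb test_function_eq_0[OF \<phi>]
    by (intro integral_lebesgue_on_eq_lborel[symmetric] borel_measurable_continuous_onI continuous_intros cont) auto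
  finally have "(L2_norm \<Omega> \<phi>)\<^sup>2 + 2 * L2_inner \<Omega> \<phi> ?h = 0"
    using L2_space_inner_integrable[OF \<phi>2 \<phi>2] L2_space_inner_integrable[OF \<phi>2 h]
    by (simp add: L2_norm_sq L2_inner_def)
  then have "(L2_norm \<Omega> \<phi>)\<^sup>2 \<le> 2 * (L2_norm \<Omega> \<phi> * L2_norm \<Omega> ?h)"
    using L2_Cauchy_Schwarz[OF \<phi>2 h] by linarith
  moreover have "L2_norm \<Omega> ?h \<le> R * L2_norm \<Omega> (classical_gradient \<phi>)"
  proof (rule L2_norm_mono[OF h classical_gradient_L2[OF leb \<phi>] R(1)])
    fix x assume x: "x \<in> \<Omega>"
    have "\<bar>x \<bullet> i\<bar> \<le> R" using Basis_le_norm[OF i, of x] R(2)[OF x] by linarith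
    moreover have "\<bar>?d x\<bar> \<le> norm (classical_gradient \<phi> x)"
      using Basis_le_norm[OF i, of "classical_gradient \<phi> x"] by (simp add: classical_gradient_inner[OF i])
    ultimately show "norm (?h x) \<le> R * norm (classical_gradient \<phi> x)"
      using R(1) by (simp add: abs_mult mult_mono)
  qed
  moreover have "a \<le> 2 * b" if "a\<^sup>2 \<le> 2 * (a * h)" "h \<le> b" "0 \<le> a" "0 \<le> b" for a b h :: real
  proof (cases "a = 0")
    case False
    have "a * a \<le> a * (2 * h)" using that(1) by (simp add: power2_eq_square)
    then have "a \<le> 2 * h" using False that(3) by (simp add: mult_le_cancel_left)
    then show ?thesis using that(2) by linarith
  qed (use that(4) in simp)
  moreover have "0 \<le> R * L2_norm \<Omega> (classical_gradient \<phi>)"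
    using R(1) by (simp add: L2_norm_nonneg)
  ultimately have "L2_norm \<Omega> \<phi> \<le> 2 * (R * L2_norm \<Omega> (classical_gradient \<phi>))"
    using L2_norm_nonneg by blast
  then show ?thesis by (simp add: mult.assoc)
qed

lemma Poincare_H10:
  assumes \<Omega>: "open \<Omega>" and u: "u \<in> H10_space \<Omega>" and R: "0 \<le> R" "\<And>x. x \<in> \<Omega> \<Longrightarrow> norm x \<le> R"
  shows "L2_norm \<Omega> u \<le> 2 * R * L2_norm \<Omega> (wgrad \<Omega> u)"
proof -
  obtain \<phi> where \<phi>: "\<And>n::nat. \<phi> n \<in> test_functions \<Omega>" and lim: "(\<lambda>n. H1_norm \<Omega> (\<lambda>x. u x - \<phi> n x)) \<longlonglongrightarrow> 0"
    using u unfolding H10_space_def by blast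
  have "L2_norm \<Omega> u \<le> H1_norm \<Omega> (\<lambda>x. u x - \<phi> n x)
      + 2 * R * (H1_norm \<Omega> (\<lambda>x. u x - \<phi> n x) + L2_norm \<Omega> (wgrad \<Omega> u))" for n
  proof -
    note H1 = H10_space_H1[OF u] test_function_H1[OF \<Omega> \<phi>[of n]]
    have "L2_norm \<Omega> u \<le> L2_norm \<Omega> (\<lambda>x. u x - \<phi> n x) + L2_norm \<Omega> (\<phi> n)"
      using H1 by (intro L2_norm_le_add_diff H1_space_L2)
    moreover have "L2_norm \<Omega> (\<phi> n) \<le> 2 * R * L2_norm \<Omega> (wgrad \<Omega> (\<phi> n))"
      using Poincare_test_function[OF \<Omega> \<phi> R] \<phi> by (simp add: wgrad_test_function[OF \<Omega>])
    moreover have "L2_norm \<Omega> (wgrad \<Omega> (\<phi> n))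
        \<le> L2_norm \<Omega> (wgrad \<Omega> (\<lambda>x. u x - \<phi> n x)) + L2_norm \<Omega> (wgrad \<Omega> u)"
      using L2_norm_le_add_diff[OF wgrad_L2[OF H1(2)] wgrad_L2[OF H1(1)]] L2_norm_wgrad_diff[OF \<Omega> H1]
      by (simp add: L2_norm_minus_commute[of \<Omega> "wgrad \<Omega> u"])
    then have "L2_norm \<Omega> (wgrad \<Omega> (\<phi> n)) \<le> H1_norm \<Omega> (\<lambda>x. u x - \<phi> n x) + L2_norm \<Omega> (wgrad \<Omega> u)"
      using L2_norm_wgrad_le_H1_norm[of \<Omega> "\<lambda>x. u x - \<phi> n x"] by linarith
    then have "2 * R * L2_norm \<Omega> (wgrad \<Omega> (\<phi> n)) \<le> 2 * R * (H1_norm \<Omega> (\<lambda>x. u x - \<phi> n x) + L2_norm \<Omega> (wgrad \<Omega> u))"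
      using R(1) by (intro mult_left_mono) auto
    ultimately show ?thesis
      using L2_norm_le_H1_norm[of \<Omega> "\<lambda>x. u x - \<phi> n x"] by linarith
  qed
  moreover have "(\<lambda>n. H1_norm \<Omega> (\<lambda>x. u x - \<phi> n x)
      + 2 * R * (H1_norm \<Omega> (\<lambda>x. u x - \<phi> n x) + L2_norm \<Omega> (wgrad \<Omega> u)))
      \<longlonglongrightarrow> 0 + 2 * R * (0 + L2_norm \<Omega> (wgrad \<Omega> u))"
    using lim by (intro tendsto_intros)
  ultimately show ?thesis
    by (intro LIMSEQ_le_const[of _ "2 * R * L2_norm \<Omega> (wgrad \<Omega> u)"]) auto
qed

text \<open>The inequality with the constant \<open>2 R\<close> shows that the infimum defining the Poincare constant is
  taken over a nonempty set. The infimum is attained because admissibility of a constant is a closed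
  condition.\<close>

lemma poincare_constant:
  assumes \<Omega>: "open \<Omega>" and "bounded \<Omega>"
  shows poincare_constant_nonneg: "0 \<le> poincare_constant \<Omega>"
    and poincare_constant_ineq: "u \<in> H10_space \<Omega> \<Longrightarrow> L2_norm \<Omega> u \<le> poincare_constant \<Omega> * L2_norm \<Omega> (wgrad \<Omega> u)"
proof -
  let ?S = "{C. 0 \<le> C \<and> (\<forall>u\<in>H10_space \<Omega>. L2_norm \<Omega> u \<le> C * L2_norm \<Omega> (wgrad \<Omega> u))}"
  obtain R where "R > 0" "\<And>x. x \<in> \<Omega> \<Longrightarrow> norm x \<le> R"
    using assms unfolding bounded_pos by blast
  then have ne: "2 * R \<in> ?S" using Poincare_H10[OF \<Omega>, of _ R] by auto
  then have "?S \<noteq> {}" by blast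
  then show "0 \<le> poincare_constant \<Omega>"
    unfolding poincare_constant_def by (rule cInf_greatest) simp
  show "L2_norm \<Omega> u \<le> poincare_constant \<Omega> * L2_norm \<Omega> (wgrad \<Omega> u)" if u: "u \<in> H10_space \<Omega>"
  proof (cases "L2_norm \<Omega> (wgrad \<Omega> u) = 0")
    case True
    then show ?thesis using ne u by fastforce
  next
    case False
    then have pos: "L2_norm \<Omega> (wgrad \<Omega> u) > 0" using L2_norm_nonneg[of \<Omega> "wgrad \<Omega> u"] by simp
    have "L2_norm \<Omega> u / L2_norm \<Omega> (wgrad \<Omega> u) \<le> poincare_constant \<Omega>"
      unfolding poincare_constant_def
      using \<open>?S \<noteq> {}\<close> by (rule cInf_greatest) (use u pos in \<open>auto simp: divide_le_eq\<close>)
    then show ?thesis using pos by (simp add: divide_le_eq)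
  qed
qed

section \<open>A symmetric kernel that is constant on the diagonal\<close>

lemma integral_near_const:
  fixes f :: "real \<Rightarrow> real"
  assumes "a \<le> b" and cont: "continuous_on {a..b} f" and "\<And>s. s \<in> {a..b} \<Longrightarrow> \<bar>f s - c\<bar> \<le> \<epsilon>"
  shows "\<bar>integral {a..b} f - (b - a) * c\<bar> \<le> \<epsilon> * (b - a)"
proof -
  have "norm (integral {a..b} (\<lambda>s. f s - c)) \<le> \<epsilon> * (b - a)"
    using assms by (intro integral_bound continuous_intros) auto
  also have "integral {a..b} (\<lambda>s. f s - c) = integral {a..b} f - (b - a) * c"
    using cont \<open>a \<le> b\<close> by (simp add: Henstock_Kurzweil_Integration.integral_diff integrable_continuous_real)
  finally show ?thesis by simp
qed

text \<open>Let \<open>H(t, r) = \<integral>\<^sub>t\<^sup>r e(t, s) ds\<close>, which by assumption is also \<open>\<integral>\<^sub>t\<^sup>r e(r, s) ds\<close>. The first form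
  gives \<open>\<partial>\<^sub>r H = e(t, r)\<close> and the second \<open>\<partial>\<^sub>t H = - e(r, t)\<close>, so by symmetry \<open>H(t, t + h)\<close> does not
  depend on \<open>t\<close>. Dividing by \<open>h\<close> and letting \<open>h\<close> tend to \<open>0\<close> gives the diagonal values.\<close>

lemma symmetric_kernel_diagonal_constant:
  fixes e :: "real \<Rightarrow> real \<Rightarrow> real"
  assumes cont: "continuous_on ({p..q} \<times> {p..q}) (\<lambda>(t, s). e t s)"
    and sym: "\<And>t s. e t s = e s t"
    and balance: "\<And>t r. \<lbrakk>p \<le> t; t \<le> r; r \<le> q\<rbrakk> \<Longrightarrow> integral {t..r} (e r) = integral {t..r} (e t)"
    and "p \<le> q"
  shows "e p p = e q q"
proof (cases "p = q")
  case False
  with \<open>p \<le> q\<close> have pq: "p < q" by simp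
  have cont1: "continuous_on {a..b} (e t)" if "t \<in> {p..q}" "p \<le> a" "b \<le> q" for a b t
  proof -
    have "continuous_on {a..b} (\<lambda>s. case (t, s) of (t, s) \<Rightarrow> e t s)"
      using that by (intro continuous_on_compose2[OF cont, of "{a..b}" "\<lambda>s. (t, s)"] continuous_intros) auto
    then show ?thesis by simp
  qed
  define close where "close d \<epsilon> \<longleftrightarrow> (\<forall>a\<in>{p..q}. \<forall>b\<in>{p..q}. \<forall>a'\<in>{p..q}. \<forall>b'\<in>{p..q}.
      \<bar>a - a'\<bar> \<le> d \<and> \<bar>b - b'\<bar> \<le> d \<longrightarrow> \<bar>e a b - e a' b'\<bar> \<le> \<epsilon>)" for d \<epsilon>
  have closeD: "\<bar>e a b - e a' b'\<bar> \<le> \<epsilon>"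
    if "close d \<epsilon>" "a \<in> {p..q}" "b \<in> {p..q}" "a' \<in> {p..q}" "b' \<in> {p..q}" "\<bar>a - a'\<bar> \<le> d" "\<bar>b - b'\<bar> \<le> d"
    for d \<epsilon> a b a' b'
    using that unfolding close_def by blast
  have unif: "\<exists>d>0. close d \<epsilon>" if "\<epsilon> > 0" for \<epsilon>
  proof -
    have "uniformly_continuous_on ({p..q} \<times> {p..q}) (\<lambda>(t, s). e t s)"
      using cont by (intro compact_uniformly_continuous compact_Times) auto
    then obtain d where d: "d > 0" "\<And>x y. \<lbrakk>x \<in> {p..q} \<times> {p..q}; y \<in> {p..q} \<times> {p..q}; dist y x < d\<rbrakk>
        \<Longrightarrow> dist (case y of (t, s) \<Rightarrow> e t s) (case x of (t, s) \<Rightarrow> e t s) < \<epsilon>"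
      using \<open>\<epsilon> > 0\<close> unfolding uniformly_continuous_on_def by metis
    show ?thesis
      unfolding close_def
    proof (intro exI[of _ "d / 3"] conjI ballI impI)
      fix a b a' b' assume mem: "a \<in> {p..q}" "b \<in> {p..q}" "a' \<in> {p..q}" "b' \<in> {p..q}"
        and "\<bar>a - a'\<bar> \<le> d / 3 \<and> \<bar>b - b'\<bar> \<le> d / 3"
      then have "dist (a, b) (a', b') < d"
        using d(1) sqrt_sum_squares_le_sum_abs[of "a - a'" "b - b'"]
        by (simp add: dist_Pair_Pair dist_real_def)
      from d(2)[OF _ _ this] mem show "\<bar>e a b - e a' b'\<bar> \<le> \<epsilon>"
        by (simp add: dist_real_def)
    qed (use d(1) in simp)
  qed
  define g where "g h t = integral {t..t + h} (e t)" for h t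
  have const: "g h (q - h) = g h p" if h: "0 < h" "h < q - p" for h
  proof -
    \<comment> \<open>\<open>g h t\<close> is \<open>H(t, t + h)\<close>; moving its two arguments by \<open>\<delta>\<close> changes \<open>H\<close> by amounts close to
      \<open>\<delta> e(t, t + h)\<close>, with opposite signs\<close>
    have step: "\<bar>g h (t + \<delta>) - g h t\<bar> \<le> 2 * \<epsilon> * \<delta>"
      if t: "p \<le> t" "0 \<le> \<delta>" "\<delta> \<le> h" "t + \<delta> \<le> q - h" "\<delta> \<le> d"
        and d: "close d \<epsilon>" for t \<delta> d \<epsilon>
    proof -
      have int: "e x integrable_on {a..b}" if "x \<in> {p..q}" "p \<le> a" "b \<le> q" for x a b
        using cont1[OF that] by (rule integrable_continuous_real)
      have mem: "t \<in> {p..q}" "t + \<delta> \<in> {p..q}" "t + h \<in> {p..q}"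
        and bounds: "t \<le> t + \<delta>" "t + \<delta> \<le> t + h" "t + h \<le> t + h + \<delta>" "t \<le> t + h" "p \<le> t + \<delta>"
          "p \<le> t + h" "t + \<delta> \<le> q" "t + h \<le> q" "t + h + \<delta> \<le> q"
        using t h by simp_all
      have 1: "g h (t + \<delta>) = integral {t + \<delta>..t + h} (e (t + h)) + integral {t + h..t + h + \<delta>} (e (t + \<delta>))"
      proof -
        have end_eq: "t + \<delta> + h = t + h + \<delta>" by simp
        have "g h (t + \<delta>) = integral {t + \<delta>..t + h} (e (t + \<delta>)) + integral {t + h..t + h + \<delta>} (e (t + \<delta>))"
          unfolding g_def end_eq
          by (rule Henstock_Kurzweil_Integration.integral_combine[symmetric, OF bounds(2,3) int[OF mem(2) bounds(5,9)]])
        then show ?thesis unfolding balance[OF bounds(5,2,8)] .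
      qed
      have 2: "g h t = integral {t..t + \<delta>} (e (t + h)) + integral {t + \<delta>..t + h} (e (t + h))"
        unfolding g_def balance[OF t(1) bounds(4,8), symmetric]
        by (rule Henstock_Kurzweil_Integration.integral_combine[symmetric, OF bounds(1,2) int[OF mem(3) t(1) bounds(8)]])
      have "\<bar>integral {t + h..t + h + \<delta>} (e (t + \<delta>)) - ((t + h + \<delta>) - (t + h)) * e t (t + h)\<bar> \<le> \<epsilon> * ((t + h + \<delta>) - (t + h))"
      proof (rule integral_near_const[OF bounds(3) cont1[OF mem(2) bounds(6,9)]])
        fix s assume s: "s \<in> {t + h..t + h + \<delta>}"
        then have "s \<in> {p..q}" "\<bar>t + \<delta> - t\<bar> \<le> d" "\<bar>s - (t + h)\<bar> \<le> d"
          using t(2,5) bounds(6,9) by simp_all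
        then show "\<bar>e (t + \<delta>) s - e t (t + h)\<bar> \<le> \<epsilon>" using mem by (intro closeD[OF d])
      qed
      moreover have "\<bar>integral {t..t + \<delta>} (e (t + h)) - ((t + \<delta>) - t) * e (t + h) t\<bar> \<le> \<epsilon> * ((t + \<delta>) - t)"
      proof (rule integral_near_const[OF bounds(1) cont1[OF mem(3) t(1) bounds(7)]])
        fix s assume s: "s \<in> {t..t + \<delta>}"
        then have "s \<in> {p..q}" "\<bar>t + h - (t + h)\<bar> \<le> d" "\<bar>s - t\<bar> \<le> d"
          using t(1,2,5) bounds(7) by simp_all
        then show "\<bar>e (t + h) s - e (t + h) t\<bar> \<le> \<epsilon>" using mem by (intro closeD[OF d])
      qed
      ultimately show ?thesis
        unfolding 1 2 using sym[of t "t + h"] by (simp add: abs_le_iff)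
    qed
    have "(g h has_real_derivative 0) (at t within {p..q - h})" if t: "t \<in> {p..q - h}" for t
      unfolding has_field_derivative_iff
    proof (rule tendstoI)
      fix \<epsilon> :: real assume "\<epsilon> > 0"
      then obtain d where d: "d > 0" "close d (\<epsilon> / 4)"
        using unif[of "\<epsilon> / 4"] by auto
      have "dist ((g h s - g h t) / (s - t)) 0 < \<epsilon>"
        if s: "s \<in> {p..q - h}" "s \<noteq> t" "dist s t < min d h" for s
      proof -
        have "\<bar>g h s - g h t\<bar> \<le> 2 * (\<epsilon> / 4) * \<bar>s - t\<bar>"
        proof (cases "t \<le> s")
          case True
          then show ?thesis using step[of t "s - t" d "\<epsilon> / 4"] d(2) s t by (simp add: dist_real_def)
        next
          case False
          then have "\<bar>g h t - g h s\<bar> \<le> 2 * (\<epsilon> / 4) * (t - s)"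
            using step[of s "t - s" d "\<epsilon> / 4"] d(2) s t by (simp add: dist_real_def)
          then show ?thesis using False by (simp add: abs_minus_commute)
        qed
        also have "\<dots> < \<epsilon> * \<bar>s - t\<bar>" using s \<open>\<epsilon> > 0\<close> by simp
        finally show ?thesis using s by (simp add: field_simps)
      qed
      then show "\<forall>\<^sub>F s in at t within {p..q - h}. dist ((g h s - g h t) / (s - t)) 0 < \<epsilon>"
        unfolding eventually_at using d(1) h by (intro exI[of _ "min d h"]) auto
    qed
    then obtain c where "\<And>t. t \<in> {p..q - h} \<Longrightarrow> g h t = c"
      using has_field_derivative_zero_constant[of "{p..q - h}" "g h"] by auto
    then show ?thesis using h by simp
  qed
  have "\<bar>e p p - e q q\<bar> \<le> 0 + \<epsilon>" if \<epsilon>: "\<epsilon> > 0" for \<epsilon>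
  proof -
    obtain d where d: "d > 0" "close d (\<epsilon> / 4)"
      using unif[of "\<epsilon> / 4"] \<epsilon> by auto
    define h where "h = min d ((q - p) / 2)"
    have h: "0 < h" "h < q - p" "h \<le> d" using d(1) pq by (auto simp: h_def min_def)
    have near: "\<bar>g h t - h * e t t\<bar> \<le> h * (\<epsilon> / 4)" if t: "p \<le> t" "t + h \<le> q" for t
    proof -
      have "\<bar>integral {t..t + h} (e t) - ((t + h) - t) * e t t\<bar> \<le> (\<epsilon> / 4) * ((t + h) - t)"
        using t h by (intro integral_near_const cont1 closeD[OF d(2)]) auto
      then show ?thesis by (simp add: g_def mult.commute)
    qed
    have "\<bar>g h p - h * e p p\<bar> \<le> h * (\<epsilon> / 4)"
      "\<bar>g h (q - h) - h * e (q - h) (q - h)\<bar> \<le> h * (\<epsilon> / 4)"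
      using h by (intro near; simp)+
    then have "\<bar>h * e p p - h * e (q - h) (q - h)\<bar> \<le> h * (\<epsilon> / 4) + h * (\<epsilon> / 4)"
      using const[OF h(1,2)] by linarith
    then have "\<bar>h * e p p - h * e (q - h) (q - h)\<bar> \<le> h * (\<epsilon> / 2)" by (simp add: mult.commute)
    then have "h * \<bar>e p p - e (q - h) (q - h)\<bar> \<le> h * (\<epsilon> / 2)"
      using h(1) by (simp add: abs_mult flip: right_diff_distrib)
    then have "\<bar>e p p - e (q - h) (q - h)\<bar> \<le> \<epsilon> / 2" using h(1) by simp
    moreover have "\<bar>e (q - h) (q - h) - e q q\<bar> \<le> \<epsilon> / 4" using h pq by (intro closeD[OF d(2)]) auto
    ultimately show ?thesis using \<epsilon> by linarith
  qed
  then have "\<bar>e p p - e q q\<bar> \<le> 0" by (rule field_le_epsilon)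
  then show ?thesis by simp
qed simp

section \<open>Curves of square-integrable functions\<close>

definition L2_continuous_on ::
    "'a::euclidean_space set \<Rightarrow> real set \<Rightarrow> (real \<Rightarrow> 'a \<Rightarrow> 'b::euclidean_space) \<Rightarrow> bool" where
  "L2_continuous_on \<Omega> T w \<longleftrightarrow> (\<forall>t\<in>T. w t \<in> L2_space \<Omega> \<and>
     ((\<lambda>s. L2_norm \<Omega> (\<lambda>x. w s x - w t x)) \<longlongrightarrow> 0) (at t within T))"

lemma L2_continuous_on_const: "f \<in> L2_space \<Omega> \<Longrightarrow> L2_continuous_on \<Omega> T (\<lambda>_. f)"
  by (simp add: L2_continuous_on_def L2_norm_def)

lemma L2_continuous_on_subset: "L2_continuous_on \<Omega> T w \<Longrightarrow> S \<subseteq> T \<Longrightarrow> L2_continuous_on \<Omega> S w"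
  unfolding L2_continuous_on_def by (meson subset_iff tendsto_within_subset)

lemma L2_continuous_on_tendsto_compose:
  assumes "L2_continuous_on \<Omega> T w" and "t \<in> T"
    and "\<forall>\<^sub>F y in F. r y \<in> T" and "(r \<longlongrightarrow> t) F"
  shows "((\<lambda>y. L2_norm \<Omega> (\<lambda>x. w (r y) x - w t x)) \<longlongrightarrow> 0) F"
proof -
  let ?N = "\<lambda>s. L2_norm \<Omega> (\<lambda>x. w s x - w t x)"
  have 0: "?N t = 0" by (simp add: L2_norm_def)
  have "continuous (at t within T) ?N"
    using assms(1,2) unfolding L2_continuous_on_def continuous_within 0 by blast
  from continuous_within_tendsto_compose[OF this assms(3,4)] show ?thesis unfolding 0 .
qed

lemma L2_inner_continuous_on:
  assumes v: "L2_continuous_on \<Omega> T v" and w: "L2_continuous_on \<Omega> T w"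
  shows "continuous_on (T \<times> T) (\<lambda>(t, s). L2_inner \<Omega> (v t) (w s))"
  unfolding continuous_on_def
proof (rule ballI)
  fix p assume p: "p \<in> T \<times> T"
  let ?F = "at p within T \<times> T"
  have ev: "\<forall>\<^sub>F y in ?F. y \<in> T \<times> T" by (simp add: eventually_at_filter)
  have "((\<lambda>y. L2_inner \<Omega> (v (fst y)) (w (snd y))) \<longlongrightarrow> L2_inner \<Omega> (v (fst p)) (w (snd p))) ?F"
  proof (rule tendsto_L2_inner)
    show "((\<lambda>y. L2_norm \<Omega> (\<lambda>x. v (fst y) x - v (fst p) x)) \<longlongrightarrow> 0) ?F"
      using p ev by (intro L2_continuous_on_tendsto_compose[OF v]) (auto intro!: tendsto_intros elim: eventually_mono)
    show "((\<lambda>y. L2_norm \<Omega> (\<lambda>x. w (snd y) x - w (snd p) x)) \<longlongrightarrow> 0) ?F"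
      using p ev by (intro L2_continuous_on_tendsto_compose[OF w]) (auto intro!: tendsto_intros elim: eventually_mono)
    show "\<forall>\<^sub>F y in ?F. v (fst y) \<in> L2_space \<Omega> \<and> w (snd y) \<in> L2_space \<Omega>"
      using ev v w by (auto simp: L2_continuous_on_def elim: eventually_mono)
  qed (use p v w in \<open>auto simp: L2_continuous_on_def\<close>)
  then show "((\<lambda>(t, s). L2_inner \<Omega> (v t) (w s)) \<longlongrightarrow> (case p of (t, s) \<Rightarrow> L2_inner \<Omega> (v t) (w s))) ?F"
    by (simp add: case_prod_unfold)
qed

lemma L2_inner_diagonal_continuous_on:
  assumes v: "L2_continuous_on \<Omega> T v" and w: "L2_continuous_on \<Omega> T w"
  shows "continuous_on T (\<lambda>t. L2_inner \<Omega> (v t) (w t))"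
proof -
  have "continuous_on T (\<lambda>t. case (t, t) of (t, s) \<Rightarrow> L2_inner \<Omega> (v t) (w s))"
    by (rule continuous_on_compose2[OF L2_inner_continuous_on[OF v w]]) (auto intro!: continuous_intros)
  then show ?thesis by simp
qed

text \<open>The second factor is differentiated weakly, tested against the value \<open>z t\<close> of the first: this
  is what the wave equation provides when the second factor is \<open>\<partial>\<^sub>t z\<close>.\<close>

lemma L2_inner_has_derivative:
  assumes C1: "C1_L2 \<Omega> z dz" and t: "0 \<le> t" "t \<in> T" and T: "T \<subseteq> {0..}"
    and w: "L2_continuous_on \<Omega> T w"
    and D: "((\<lambda>s. L2_inner \<Omega> (z t) (w s)) has_real_derivative D) (at t within T)"
  shows "((\<lambda>s. L2_inner \<Omega> (z s) (w s)) has_real_derivative (L2_inner \<Omega> (dz t) (w t) + D)) (at t within T)"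
  unfolding has_field_derivative_iff
proof (rule Lim_transform_eventually)
  have ev: "\<forall>\<^sub>F s in at t within T. s \<in> T \<and> s \<noteq> t" by (simp add: eventually_at_filter)
  have z: "z s \<in> L2_space \<Omega>" "dz s \<in> L2_space \<Omega>" if "0 \<le> s" for s
    using C1 that unfolding C1_L2_def by blast+
  let ?q = "\<lambda>s x. (z s x - z t x) / (s - t)"
  have q: "?q s \<in> L2_space \<Omega>" if "0 \<le> s" for s
    using L2_space_mult[OF L2_space_diff[OF z(1)[OF that] z(1)[OF t(1)]], of "1 / (s - t)"] by simp
  have lim: "((\<lambda>s. L2_inner \<Omega> (?q s) (w s)) \<longlongrightarrow> L2_inner \<Omega> (dz t) (w t)) (at t within T)"
  proof (rule tendsto_L2_inner)
    have "((\<lambda>s. L2_norm \<Omega> (\<lambda>x. ?q s x - dz t x)) \<longlongrightarrow> 0) (at t within {0..})"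
      using C1 t(1) unfolding C1_L2_def by blast
    then show "((\<lambda>s. L2_norm \<Omega> (\<lambda>x. ?q s x - dz t x)) \<longlongrightarrow> 0) (at t within T)"
      using T by (rule tendsto_within_subset)
    show "((\<lambda>s. L2_norm \<Omega> (\<lambda>x. w s x - w t x)) \<longlongrightarrow> 0) (at t within T)" "w t \<in> L2_space \<Omega>"
      using w t(2) unfolding L2_continuous_on_def by blast+
    show "\<forall>\<^sub>F s in at t within T. ?q s \<in> L2_space \<Omega> \<and> w s \<in> L2_space \<Omega>"
      using ev
    proof eventually_elim
      case (elim s)
      then have "0 \<le> s" "w s \<in> L2_space \<Omega>" using T w unfolding L2_continuous_on_def by auto
      then show ?case using q by blast
    qed
  qed (use z(2) t(1) in auto)
  show "((\<lambda>s. L2_inner \<Omega> (?q s) (w s) + (L2_inner \<Omega> (z t) (w s) - L2_inner \<Omega> (z t) (w t)) / (s - t))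
      \<longlongrightarrow> L2_inner \<Omega> (dz t) (w t) + D) (at t within T)"
    using lim D unfolding has_field_derivative_iff by (rule tendsto_add)
  show "\<forall>\<^sub>F s in at t within T. L2_inner \<Omega> (?q s) (w s) + (L2_inner \<Omega> (z t) (w s) - L2_inner \<Omega> (z t) (w t)) / (s - t)
      = (L2_inner \<Omega> (z s) (w s) - L2_inner \<Omega> (z t) (w t)) / (s - t)"
    using ev
  proof eventually_elim
    case (elim s)
    then have s: "0 \<le> s" "w s \<in> L2_space \<Omega>" using T w unfolding L2_continuous_on_def by auto
    have "L2_inner \<Omega> (?q s) (w s) = (L2_inner \<Omega> (z s) (w s) - L2_inner \<Omega> (z t) (w s)) / (s - t)"
      using L2_inner_mult_left[of \<Omega> "1 / (s - t)" "\<lambda>x. z s x - z t x" "w s"]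
        L2_inner_diff_left[OF z(1)[OF s(1)] z(1)[OF t(1)] s(2)] by simp
    then show ?case by (simp add: diff_divide_distrib)
  qed
qed

lemma C1_L2_continuous_on:
  assumes "C1_L2 \<Omega> z dz"
  shows "L2_continuous_on \<Omega> {0..} dz"
  using assms by (auto simp: C1_L2_def L2_continuous_on_def)

lemma C0_H10_continuous_on:
  assumes \<Omega>: "open \<Omega>" and C0: "C0_H10 \<Omega> z"
  shows "L2_continuous_on \<Omega> {0..} z" and "L2_continuous_on \<Omega> {0..} (\<lambda>t. wgrad \<Omega> (z t))"
proof -
  have H10: "z t \<in> H10_space \<Omega>" if "0 \<le> t" for t
    using C0 that unfolding C0_H10_def by blast
  have lim: "((\<lambda>s. H1_norm \<Omega> (\<lambda>x. z s x - z t x)) \<longlongrightarrow> 0) (at t within {0..})" if "0 \<le> t" for t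
    using C0 that unfolding C0_H10_def by blast
  show "L2_continuous_on \<Omega> {0..} z"
    unfolding L2_continuous_on_def
  proof (intro ballI conjI)
    fix t :: real assume "t \<in> {0..}"
    then have t: "0 \<le> t" by simp
    show "z t \<in> L2_space \<Omega>" using H10[OF t] by (rule H10_space_L2)
    show "((\<lambda>s. L2_norm \<Omega> (\<lambda>x. z s x - z t x)) \<longlongrightarrow> 0) (at t within {0..})"
      using lim[OF t] by (rule Lim_null_comparison[rotated]) (simp add: L2_norm_nonneg L2_norm_le_H1_norm)
  qed
  show "L2_continuous_on \<Omega> {0..} (\<lambda>t. wgrad \<Omega> (z t))"
    unfolding L2_continuous_on_def
  proof (intro ballI conjI)
    fix t :: real assume "t \<in> {0..}"
    then have t: "0 \<le> t" by simp
    show "wgrad \<Omega> (z t) \<in> L2_space \<Omega>" using H10[OF t] by (rule H10_wgrad_L2)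
    have "\<forall>\<^sub>F s in at t within {0..}. 0 \<le> s" by (simp add: eventually_at_filter)
    then have "\<forall>\<^sub>F s in at t within {0..}. norm (L2_norm \<Omega> (\<lambda>x. wgrad \<Omega> (z s) x - wgrad \<Omega> (z t) x))
        \<le> H1_norm \<Omega> (\<lambda>x. z s x - z t x)"
    proof eventually_elim
      case (elim s)
      then show ?case
        using L2_norm_wgrad_diff[OF \<Omega> H10_space_H1[OF H10] H10_space_H1[OF H10[OF t]], of s]
          L2_norm_wgrad_le_H1_norm[of \<Omega> "\<lambda>x. z s x - z t x"]
        by (simp add: L2_norm_nonneg)
    qed
    then show "((\<lambda>s. L2_norm \<Omega> (\<lambda>x. wgrad \<Omega> (z s) x - wgrad \<Omega> (z t) x)) \<longlongrightarrow> 0) (at t within {0..})"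
      using lim[OF t] by (rule Lim_null_comparison)
  qed
qed

section \<open>The energy identity\<close>

text \<open>Formally this is the equation tested with \<open>\<partial>\<^sub>t z\<close>, but \<open>\<partial>\<^sub>t z(t)\<close> is only in \<open>L\<^sup>2\<close> and not an
  admissible test function. Instead the kernel
  \<open>e(t, s) = \<langle>\<partial>\<^sub>t z(t), \<partial>\<^sub>t z(s)\<rangle> + \<langle>\<nabla>z(t), \<nabla>z(s)\<rangle> - \<langle>f, z(t)\<rangle> - \<langle>f, z(s)\<rangle>\<close> is considered, which is
  continuous and symmetric. Testing with the increments \<open>z(r) - z(t)\<close>, which are in \<open>H\<^sup>1\<^sub>0\<close>, shows that
  it satisfies the hypothesis of \<open>symmetric_kernel_diagonal_constant\<close>, and half its diagonal is the
  energy minus \<open>\<langle>f, z\<rangle>\<close>.\<close>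

lemma weak_wave_energy_identity:
  assumes \<Omega>: "open \<Omega>" and C0: "C0_H10 \<Omega> z" and C1: "C1_L2 \<Omega> z dz" and f: "f \<in> L2_space \<Omega>"
    and wave: "weak_wave_on \<Omega> a b f z dz"
    and pq: "0 \<le> p" "p \<le> q" "a \<le> ereal p" "ereal q < b"
  shows "energy \<Omega> z dz q - L2_inner \<Omega> f (z q) = energy \<Omega> z dz p - L2_inner \<Omega> f (z p)"
proof -
  note cont = C0_H10_continuous_on[OF \<Omega> C0] C1_L2_continuous_on[OF C1]
  have sub: "{p..q} \<subseteq> {0..}" using pq by auto
  note cont' = cont[THEN L2_continuous_on_subset, OF sub]
  have H10: "z t \<in> H10_space \<Omega>" if "0 \<le> t" for t
    using C0 that unfolding C0_H10_def by blast
  have L2: "z t \<in> L2_space \<Omega>" "wgrad \<Omega> (z t) \<in> L2_space \<Omega>" "dz t \<in> L2_space \<Omega>" if "0 \<le> t" for t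
    using cont that unfolding L2_continuous_on_def by auto
  define e where "e t s = L2_inner \<Omega> (dz t) (dz s) + L2_inner \<Omega> (wgrad \<Omega> (z t)) (wgrad \<Omega> (z s))
      - L2_inner \<Omega> f (z t) - L2_inner \<Omega> f (z s)" for t s
  have e_cont: "continuous_on ({p..q} \<times> {p..q}) (\<lambda>(t, s). e t s)"
  proof -
    have "continuous_on ({p..q} \<times> {p..q}) (\<lambda>(t, s). L2_inner \<Omega> f (z t))"
      using L2_inner_continuous_on[OF cont'(1) L2_continuous_on_const[OF f]]
      by (simp add: L2_inner_commute[of \<Omega> f])
    then show ?thesis
      using L2_inner_continuous_on[OF cont'(3) cont'(3)] L2_inner_continuous_on[OF cont'(2) cont'(2)]
        L2_inner_continuous_on[OF L2_continuous_on_const[OF f] cont'(1)]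
      unfolding e_def case_prod_unfold by (intro continuous_intros)
  qed
  have "e p p = e q q"
  proof (rule symmetric_kernel_diagonal_constant[OF e_cont])
    show "e t s = e s t" for t s
      by (simp add: e_def L2_inner_commute[of \<Omega> "dz t"] L2_inner_commute[of \<Omega> "wgrad \<Omega> (z t)"])
    fix t r assume tr: "p \<le> t" "t \<le> r" "r \<le> q"
    let ?\<phi> = "\<lambda>x. z r x - z t x" and ?\<psi> = "\<lambda>x. dz r x - dz t x"
    have r0: "0 \<le> r" and t0: "0 \<le> t" using tr pq by auto
    have \<phi>: "?\<phi> \<in> H10_space \<Omega>" using H10[OF r0] H10[OF t0] by (rule H10_space_diff[OF \<Omega>])
    have \<phi>2: "?\<phi> \<in> L2_space \<Omega>" using \<phi> by (rule H10_space_L2)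
    have \<psi>: "?\<psi> \<in> L2_space \<Omega>" using L2(3)[OF r0] L2(3)[OF t0] by (rule L2_space_diff)
    \<comment> \<open>the function whose derivative in \<open>s\<close> is \<open>e(r, s) - e(t, s)\<close>; its values at \<open>t\<close> and \<open>r\<close> differ by
      \<open>\<langle>\<phi>, \<psi>\<rangle> - \<langle>\<psi>, \<phi>\<rangle> = 0\<close>\<close>
    let ?P = "\<lambda>s. L2_inner \<Omega> (z s) ?\<psi> - L2_inner \<Omega> (dz s) ?\<phi>"
    have "(?P has_vector_derivative (e r s - e t s)) (at s within {t..r})" if s: "s \<in> {t..r}" for s
    proof -
      have s0: "0 \<le> s" using s t0 by simp
      have "((\<lambda>s. L2_inner \<Omega> (z s) ?\<psi>) has_real_derivative (L2_inner \<Omega> (dz s) ?\<psi> + 0)) (at s within {t..r})"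
        using s t0 by (intro L2_inner_has_derivative[OF C1 s0 s _ L2_continuous_on_const[OF \<psi>]]) auto
      moreover have "((\<lambda>s. L2_inner \<Omega> (dz s) ?\<phi>) has_real_derivative
          (L2_inner \<Omega> f ?\<phi> - L2_inner \<Omega> (wgrad \<Omega> (z s)) (wgrad \<Omega> ?\<phi>))) (at s within {t..r})"
      proof (rule has_field_derivative_subset)
        have "a \<le> ereal s'" if "s' \<in> {t..r}" for s'
          using pq(3) tr that by (meson atLeastAtMost_iff ereal_less_eq(3) order_trans)
        moreover have "ereal s' < b" if "s' \<in> {t..r}" for s'
          using pq(4) tr that by (meson atLeastAtMost_iff ereal_less_eq(3) order_le_less_trans order_trans)
        ultimately show "{t..r} \<subseteq> {s. a \<le> ereal s \<and> ereal s < b}" by blast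
        with s show "((\<lambda>s. L2_inner \<Omega> (dz s) ?\<phi>) has_real_derivative
          (L2_inner \<Omega> f ?\<phi> - L2_inner \<Omega> (wgrad \<Omega> (z s)) (wgrad \<Omega> ?\<phi>))) (at s within {s. a \<le> ereal s \<and> ereal s < b})"
          using wave \<phi> unfolding weak_wave_on_def by blast
      qed
      ultimately have "(?P has_real_derivative (L2_inner \<Omega> (dz s) ?\<psi> + 0
          - (L2_inner \<Omega> f ?\<phi> - L2_inner \<Omega> (wgrad \<Omega> (z s)) (wgrad \<Omega> ?\<phi>)))) (at s within {t..r})"
        by (rule DERIV_diff)
      moreover have "L2_inner \<Omega> (dz s) ?\<psi> + 0
          - (L2_inner \<Omega> f ?\<phi> - L2_inner \<Omega> (wgrad \<Omega> (z s)) (wgrad \<Omega> ?\<phi>)) = e r s - e t s"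
        using L2_inner_diff_right[OF L2(3)[OF r0] L2(3)[OF t0] L2(3)[OF s0]]
          L2_inner_diff_right[OF L2(1)[OF r0] L2(1)[OF t0] f]
          L2_inner_wgrad_diff[OF \<Omega> H10_space_H1[OF H10[OF r0]] H10_space_H1[OF H10[OF t0]] L2(2)[OF s0]]
        by (simp add: e_def L2_inner_commute[of \<Omega> "dz s"] L2_inner_commute[of \<Omega> "wgrad \<Omega> (z s)"])
      ultimately show ?thesis by (simp add: has_real_derivative_iff_has_vector_derivative)
    qed
    then have "((\<lambda>s. e r s - e t s) has_integral (?P r - ?P t)) {t..r}"
      using tr(2) by (rule fundamental_theorem_of_calculus[rotated])
    moreover have "?P r - ?P t = 0"
      using L2_inner_diff_left[OF L2(1)[OF r0] L2(1)[OF t0] \<psi>] L2_inner_diff_left[OF L2(3)[OF r0] L2(3)[OF t0] \<phi>2]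
        L2_inner_commute[of \<Omega> ?\<phi> ?\<psi>] by simp
    ultimately have "integral {t..r} (\<lambda>s. e r s - e t s) = 0" by (simp add: integral_unique)
    moreover have "e x integrable_on {t..r}" if "x \<in> {p..q}" for x
    proof -
      have "continuous_on {t..r} (\<lambda>s. case (x, s) of (t, s) \<Rightarrow> e t s)"
        using that tr by (intro continuous_on_compose2[OF e_cont] continuous_intros) auto
      then show ?thesis by (intro integrable_continuous_real) simp
    qed
    ultimately show "integral {t..r} (e r) = integral {t..r} (e t)"
      using tr by (simp add: Henstock_Kurzweil_Integration.integral_diff)
  qed (rule pq)
  then show ?thesis by (simp add: e_def energy_def L2_norm_sq field_simps)
qed

section \<open>The Lyapunov functional\<close>

text \<open>The cross term makes the potential energy decay as well. The derivative of the last term cancels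
  the term \<open>- \<epsilon> \<alpha> \<langle>z, \<partial>\<^sub>t z\<rangle>\<close> that the damping contributes to the derivative of the cross term.\<close>

definition lyapunov ::
    "'a::euclidean_space set \<Rightarrow> real \<Rightarrow> real \<Rightarrow> (real \<Rightarrow> 'a \<Rightarrow> real) \<Rightarrow> (real \<Rightarrow> 'a \<Rightarrow> real) \<Rightarrow> real \<Rightarrow> real" where
  "lyapunov \<Omega> \<alpha> \<epsilon> z dz t =
     energy \<Omega> z dz t + \<epsilon> * L2_inner \<Omega> (z t) (dz t) + \<epsilon> * \<alpha> / 2 * (L2_norm \<Omega> (z t))\<^sup>2"

lemma lyapunov_has_derivative:
  assumes \<Omega>: "open \<Omega>" and C0: "C0_H10 \<Omega> z" and C1: "C1_L2 \<Omega> z dz" and f: "f \<in> L2_space \<Omega>"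
    and wave: "weak_wave_on \<Omega> (ereal a) b f z dz" and t: "0 \<le> a" "a < t" "ereal t < b"
  shows "(lyapunov \<Omega> \<alpha> \<epsilon> z dz has_real_derivative
      L2_inner \<Omega> f (dz t)
      + \<epsilon> * ((L2_norm \<Omega> (dz t))\<^sup>2 + L2_inner \<Omega> f (z t) - (L2_norm \<Omega> (wgrad \<Omega> (z t)))\<^sup>2)
      + \<epsilon> * \<alpha> * L2_inner \<Omega> (z t) (dz t)) (at t)"
proof -
  obtain c where c: "t < c" "ereal c < b" using ereal_dense2[OF t(3)] by auto
  let ?T = "{a..c}"
  have t_int: "t \<in> interior ?T" using t c by (simp add: interior_atLeastAtMost_real)
  then have at: "at t within ?T = at t" by (rule at_within_interior)
  have tT: "t \<in> ?T" and t0: "0 \<le> t" and T0: "?T \<subseteq> {0..}" using t c by auto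
  note cont = C0_H10_continuous_on[OF \<Omega> C0, THEN L2_continuous_on_subset, OF T0]
    C1_L2_continuous_on[OF C1, THEN L2_continuous_on_subset, OF T0]
  have zt: "z t \<in> H10_space \<Omega>" using C0 t0 unfolding C0_H10_def by blast
  have dzt: "dz t \<in> L2_space \<Omega>" using cont(3) tT unfolding L2_continuous_on_def by blast
  note deriv = L2_inner_has_derivative[OF C1 t0 tT T0]
  have const: "((\<lambda>s. L2_inner \<Omega> (z s) g) has_real_derivative L2_inner \<Omega> (dz t) g) (at t within ?T)"
    if "g \<in> L2_space \<Omega>" for g
    using deriv[OF L2_continuous_on_const[OF that], of 0] by simp
  have z_f: "((\<lambda>s. L2_inner \<Omega> f (z s)) has_real_derivative L2_inner \<Omega> f (dz t)) (at t within ?T)"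
    using const[OF f] by (simp add: L2_inner_commute[of \<Omega> f])
  have z_z: "((\<lambda>s. (L2_norm \<Omega> (z s))\<^sup>2) has_real_derivative 2 * L2_inner \<Omega> (z t) (dz t)) (at t within ?T)"
    using deriv[OF cont(1), of "L2_inner \<Omega> (dz t) (z t)"] const[OF H10_space_L2[OF zt]]
    by (simp add: L2_norm_sq L2_inner_commute[of \<Omega> "z t"])
  have "((\<lambda>s. L2_inner \<Omega> (dz s) (z t)) has_real_derivative
      L2_inner \<Omega> f (z t) - L2_inner \<Omega> (wgrad \<Omega> (z t)) (wgrad \<Omega> (z t))) (at t within ?T)"
  proof (rule has_field_derivative_subset)
    show "?T \<subseteq> {s. ereal a \<le> ereal s \<and> ereal s < b}"
      using c(2) by (auto intro: order.strict_trans1[of _ "ereal c"])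
    show "((\<lambda>s. L2_inner \<Omega> (dz s) (z t)) has_real_derivative
        L2_inner \<Omega> f (z t) - L2_inner \<Omega> (wgrad \<Omega> (z t)) (wgrad \<Omega> (z t)))
        (at t within {s. ereal a \<le> ereal s \<and> ereal s < b})"
      using wave zt t unfolding weak_wave_on_def by simp
  qed
  then have "((\<lambda>s. L2_inner \<Omega> (z t) (dz s)) has_real_derivative
      L2_inner \<Omega> f (z t) - (L2_norm \<Omega> (wgrad \<Omega> (z t)))\<^sup>2) (at t within ?T)"
    by (simp add: L2_inner_commute[of \<Omega> "z t"] L2_norm_sq)
  from deriv[OF cont(3) this]
  have z_dz: "((\<lambda>s. L2_inner \<Omega> (z s) (dz s)) has_real_derivative
      (L2_norm \<Omega> (dz t))\<^sup>2 + (L2_inner \<Omega> f (z t) - (L2_norm \<Omega> (wgrad \<Omega> (z t)))\<^sup>2)) (at t within ?T)"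
    by (simp add: L2_norm_sq)
  have energy: "energy \<Omega> z dz s = energy \<Omega> z dz a - L2_inner \<Omega> f (z a) + L2_inner \<Omega> f (z s)" if "s \<in> ?T" for s
  proof -
    have "ereal s < b" using that c(2) by (auto intro: order.strict_trans1[of _ "ereal c"])
    then show ?thesis
      using weak_wave_energy_identity[OF \<Omega> C0 C1 f wave t(1), of s] that by simp
  qed
  have "((\<lambda>s. (energy \<Omega> z dz a - L2_inner \<Omega> f (z a) + L2_inner \<Omega> f (z s)) + \<epsilon> * L2_inner \<Omega> (z s) (dz s)
      + \<epsilon> * \<alpha> / 2 * (L2_norm \<Omega> (z s))\<^sup>2) has_real_derivative
      L2_inner \<Omega> f (dz t)
      + \<epsilon> * ((L2_norm \<Omega> (dz t))\<^sup>2 + L2_inner \<Omega> f (z t) - (L2_norm \<Omega> (wgrad \<Omega> (z t)))\<^sup>2)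
      + \<epsilon> * \<alpha> * L2_inner \<Omega> (z t) (dz t)) (at t within ?T)"
    by (rule derivative_eq_intros z_f z_z z_dz refl)+ (simp add: algebra_simps)
  then have "(lyapunov \<Omega> \<alpha> \<epsilon> z dz has_real_derivative
      L2_inner \<Omega> f (dz t)
      + \<epsilon> * ((L2_norm \<Omega> (dz t))\<^sup>2 + L2_inner \<Omega> f (z t) - (L2_norm \<Omega> (wgrad \<Omega> (z t)))\<^sup>2)
      + \<epsilon> * \<alpha> * L2_inner \<Omega> (z t) (dz t)) (at t within ?T)"
    by (rule has_field_derivative_transform_within[OF _ zero_less_one tT])
      (simp only: lyapunov_def energy)
  then show ?thesis unfolding at .
qed

lemma lyapunov_continuous_on:
  assumes "open \<Omega>" "C0_H10 \<Omega> z" "C1_L2 \<Omega> z dz"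
  shows "continuous_on {0..} (lyapunov \<Omega> \<alpha> \<epsilon> z dz)"
proof -
  note cont = C0_H10_continuous_on[OF assms(1,2)] C1_L2_continuous_on[OF assms(3)]
  show ?thesis
    unfolding lyapunov_def energy_def L2_norm_sq
    by (intro continuous_intros L2_inner_diagonal_continuous_on cont)
qed

section \<open>The sampling times exhaust the half-line\<close>

lemma sampling_time_mono: "sampling_time \<Omega> \<gamma>\<^sub>0 \<gamma>\<^sub>1 \<eta> z dz k \<le> sampling_time \<Omega> \<gamma>\<^sub>0 \<gamma>\<^sub>1 \<eta> z dz (Suc k)"
  by (auto simp: Let_def intro!: Inf_greatest)

lemma sampling_time_nonneg: "0 \<le> sampling_time \<Omega> \<gamma>\<^sub>0 \<gamma>\<^sub>1 \<eta> z dz k"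
proof (induction k)
  case (Suc k)
  then show ?case using sampling_time_mono by (rule order_trans)
qed simp

lemma not_triggered_before_next_sample:
  assumes k: "sampling_time \<Omega> \<gamma>\<^sub>0 \<gamma>\<^sub>1 \<eta> z dz k = ereal a" and "a \<le> t"
    and "ereal t < sampling_time \<Omega> \<gamma>\<^sub>0 \<gamma>\<^sub>1 \<eta> z dz (Suc k)"
  shows "(L2_norm \<Omega> (\<lambda>x. dz t x - dz a x))\<^sup>2
    < \<gamma>\<^sub>0 * (L2_norm \<Omega> (z t))\<^sup>2 + \<gamma>\<^sub>1 * (L2_norm \<Omega> (dz t))\<^sup>2 + \<eta> t"
proof (rule ccontr)
  assume "\<not> ?thesis"
  then have "sampling_time \<Omega> \<gamma>\<^sub>0 \<gamma>\<^sub>1 \<eta> z dz (Suc k) \<le> ereal t"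
    using \<open>a \<le> t\<close> by (auto simp: Let_def k intro!: Inf_lower)
  with assms(3) show False by simp
qed

lemma triggered_near_next_sample:
  assumes k: "sampling_time \<Omega> \<gamma>\<^sub>0 \<gamma>\<^sub>1 \<eta> z dz k = ereal a"
    and "sampling_time \<Omega> \<gamma>\<^sub>0 \<gamma>\<^sub>1 \<eta> z dz (Suc k) < ereal b"
  obtains t where "a \<le> t" "t < b"
    "\<gamma>\<^sub>0 * (L2_norm \<Omega> (z t))\<^sup>2 + \<gamma>\<^sub>1 * (L2_norm \<Omega> (dz t))\<^sup>2 + \<eta> t \<le> (L2_norm \<Omega> (\<lambda>x. dz t x - dz a x))\<^sup>2"
  using assms(2) that by (auto simp: Let_def k Inf_less_iff)

text \<open>If the sampling times accumulated at a finite time \<open>T\<close>, each event would force an error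
  \<open>\<parallel>\<partial>\<^sub>t z(t) - \<partial>\<^sub>t z(t\<^sub>k)\<parallel>\<^sup>2 \<ge> \<eta>(t)\<close> that stays bounded away from \<open>0\<close>, contradicting the continuity of
  \<open>\<partial>\<^sub>t z\<close> at \<open>T\<close>.\<close>

lemma sampling_times_unbounded:
  assumes cont: "L2_continuous_on \<Omega> {0..} dz" and \<gamma>: "0 \<le> \<gamma>\<^sub>0" "0 \<le> \<gamma>\<^sub>1"
    and \<eta>: "\<And>t. 0 < \<eta> t" "\<And>s t. s \<le> t \<Longrightarrow> \<eta> t \<le> \<eta> s"
  shows "\<exists>k. ereal t < sampling_time \<Omega> \<gamma>\<^sub>0 \<gamma>\<^sub>1 \<eta> z dz k"
proof (rule ccontr)
  let ?\<tau> = "sampling_time \<Omega> \<gamma>\<^sub>0 \<gamma>\<^sub>1 \<eta> z dz"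
  assume "\<not> ?thesis"
  then have le: "?\<tau> k \<le> ereal t" for k by (simp add: not_less)
  define \<sigma> where "\<sigma> k = real_of_ereal (?\<tau> k)" for k
  have \<tau>: "?\<tau> k = ereal (\<sigma> k)" for k
    using le[of k] sampling_time_nonneg[of \<Omega> \<gamma>\<^sub>0 \<gamma>\<^sub>1 \<eta> z dz k]
    unfolding \<sigma>_def by (cases "?\<tau> k") auto
  have \<sigma>: "0 \<le> \<sigma> k" "\<sigma> k \<le> t" "\<sigma> k \<le> \<sigma> (Suc k)" for k
    using sampling_time_nonneg[of \<Omega> \<gamma>\<^sub>0 \<gamma>\<^sub>1 \<eta> z dz k] le[of k] sampling_time_mono[of \<Omega> \<gamma>\<^sub>0 \<gamma>\<^sub>1 \<eta> z dz k]
    unfolding \<tau> by simp_all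
  have "incseq \<sigma>" by (rule incseq_SucI) (rule \<sigma>)
  then obtain T where T: "\<sigma> \<longlonglongrightarrow> T" "\<And>k. \<sigma> k \<le> T"
    using incseq_convergent[of \<sigma> t] \<sigma>(2) by blast
  have "0 \<le> T" using \<sigma>(1)[of 0] T(2)[of 0] by simp
  define \<epsilon> where "\<epsilon> = sqrt (\<eta> (T + 1)) / 2"
  have \<epsilon>: "\<epsilon> > 0" using \<eta>(1) by (simp add: \<epsilon>_def)
  have "((\<lambda>s. L2_norm \<Omega> (\<lambda>x. dz s x - dz T x)) \<longlongrightarrow> 0) (at T within {0..})"
    using cont \<open>0 \<le> T\<close> unfolding L2_continuous_on_def by simp
  then have "\<forall>\<^sub>F s in at T within {0..}. dist (L2_norm \<Omega> (\<lambda>x. dz s x - dz T x)) 0 < \<epsilon>"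
    using \<epsilon> by (rule tendstoD)
  then obtain d where d: "d > 0"
    "\<And>s. \<lbrakk>0 \<le> s; s \<noteq> T; \<bar>s - T\<bar> < d\<rbrakk> \<Longrightarrow> \<bar>L2_norm \<Omega> (\<lambda>x. dz s x - dz T x)\<bar> < \<epsilon>"
    unfolding eventually_at by (auto simp: dist_real_def)
  have near: "L2_norm \<Omega> (\<lambda>x. dz s x - dz T x) < \<epsilon>" if "0 \<le> s" "\<bar>s - T\<bar> < d" for s
    using d(2)[of s] that \<epsilon> by (cases "s = T") (auto simp: L2_norm_def)
  obtain k where k: "\<bar>\<sigma> k - T\<bar> < d"
    using LIMSEQ_D[OF T(1) d(1)] by auto
  have "?\<tau> (Suc k) < ereal (T + min d 1)"
    using T(2)[of "Suc k"] d(1) unfolding \<tau> by simp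
  from triggered_near_next_sample[OF \<tau> this] obtain r where r: "\<sigma> k \<le> r" "r < T + min d 1"
    and trig: "\<gamma>\<^sub>0 * (L2_norm \<Omega> (z r))\<^sup>2 + \<gamma>\<^sub>1 * (L2_norm \<Omega> (dz r))\<^sup>2 + \<eta> r \<le> (L2_norm \<Omega> (\<lambda>x. dz r x - dz (\<sigma> k) x))\<^sup>2"
    by blast
  have L2: "dz s \<in> L2_space \<Omega>" if "0 \<le> s" for s
    using cont that unfolding L2_continuous_on_def by simp
  have r0: "0 \<le> r" and rT: "\<bar>r - T\<bar> < d" using r \<sigma>(1)[of k] k by auto
  have "L2_norm \<Omega> (\<lambda>x. dz r x - dz (\<sigma> k) x) < \<epsilon> + \<epsilon>"
    using L2_norm_triangle_diff[OF L2[OF r0] L2[OF \<open>0 \<le> T\<close>] L2[OF \<sigma>(1)[of k]]]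
      near[OF r0 rT] near[OF \<sigma>(1) k] L2_norm_minus_commute[of \<Omega> "dz T" "dz (\<sigma> k)"]
    by linarith
  then have "(L2_norm \<Omega> (\<lambda>x. dz r x - dz (\<sigma> k) x))\<^sup>2 < (\<epsilon> + \<epsilon>)\<^sup>2"
    by (intro power_strict_mono L2_norm_nonneg) auto
  also have "\<dots> = \<eta> (T + 1)" using \<eta>(1)[of "T + 1"] by (simp add: \<epsilon>_def)
  also have "\<dots> \<le> \<eta> r" using r by (intro \<eta>(2)) simp
  also have "\<dots> \<le> \<gamma>\<^sub>0 * (L2_norm \<Omega> (z r))\<^sup>2 + \<gamma>\<^sub>1 * (L2_norm \<Omega> (dz r))\<^sup>2 + \<eta> r" using \<gamma> by simp
  also note trig
  finally show False by simp
qed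

text \<open>Monotonicity on each sampling interval propagates to all times because the intervals cover the
  half-line; an infinite sampling time ends the propagation with an unbounded last interval.\<close>

lemma sampled_decreasing:
  fixes \<tau> :: "nat \<Rightarrow> ereal" and Y :: "real \<Rightarrow> real"
  assumes \<tau>: "\<tau> 0 = 0" "\<And>k. \<tau> k \<le> \<tau> (Suc k)" "\<And>t. \<exists>k. ereal t < \<tau> k"
    and Y: "\<And>k p q. \<lbrakk>\<tau> k = ereal p; p \<le> q; ereal q \<le> \<tau> (Suc k)\<rbrakk> \<Longrightarrow> Y q \<le> Y p"
    and "0 \<le> t"
  shows "Y t \<le> Y 0"
proof -
  have nonneg: "0 \<le> \<tau> k" for k using \<tau>(1,2) by (induction k) (auto intro: order_trans)
  have start: "Y p \<le> Y 0" if "\<tau> k = ereal p" for k p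
    using that
  proof (induction k arbitrary: p)
    case 0
    then show ?case using \<tau>(1) by (simp add: zero_ereal_def)
  next
    case (Suc k)
    have "0 \<le> \<tau> k" "\<tau> k \<le> ereal p" using nonneg[of k] \<tau>(2)[of k] unfolding Suc.prems by blast+
    then obtain a where a: "\<tau> k = ereal a" "a \<le> p" by (cases "\<tau> k") auto
    have "Y p \<le> Y a" by (rule Y[OF a]) (simp add: Suc.prems)
    also have "\<dots> \<le> Y 0" by (rule Suc.IH[OF a(1)])
    finally show ?case .
  qed
  define k where "k = (LEAST k. ereal t < \<tau> k)"
  have k: "ereal t < \<tau> k" unfolding k_def using \<tau>(3)[of t] by (rule LeastI_ex)
  have below: "\<tau> j \<le> ereal t" if "j < k" for j
    using not_less_Least[OF that[unfolded k_def]] by (rule leI)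
  have "k \<noteq> 0"
  proof
    assume "k = 0"
    with k have "ereal t < 0" unfolding \<tau>(1)[symmetric] by metis
    with \<open>0 \<le> t\<close> show False by simp
  qed
  then obtain j where j: "k = Suc j" by (cases k) auto
  have "0 \<le> \<tau> j" "\<tau> j \<le> ereal t" using nonneg[of j] below[of j] j by simp_all
  then obtain p where p: "\<tau> j = ereal p" "p \<le> t" by (cases "\<tau> j") auto
  have "Y t \<le> Y p" using p k j by (intro Y[of j]) auto
  with start[OF p(1)] show ?thesis by simp
qed

section \<open>Dissipation\<close>

lemma Young_of_Cauchy_Schwarz:
  fixes a u v c :: real
  assumes "\<bar>c\<bar> \<le> u * v"
  shows "a * c \<le> 1/2 * (a\<^sup>2 * u\<^sup>2 + v\<^sup>2)"
proof -
  have "a * c \<le> \<bar>a\<bar> * (u * v)"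
    using mult_left_mono[OF assms, of "\<bar>a\<bar>"] by (metis abs_ge_self abs_ge_zero abs_mult order_trans)
  moreover have "0 \<le> (\<bar>a\<bar> * u - v)\<^sup>2" by simp
  ultimately show ?thesis by (simp add: power2_diff power_mult_distrib)
qed

text \<open>Here \<open>u\<close>, \<open>v\<close> and \<open>g\<close> stand for \<open>z\<close>, \<open>\<partial>\<^sub>t z\<close> and \<open>\<nabla>z\<close> at a time, \<open>w\<close> for the last sample of \<open>\<partial>\<^sub>t z\<close>,
  and \<open>e = v - w\<close> for the sampling error, so that the source is \<open>- \<alpha> w = - \<alpha> v + \<alpha> e\<close>.
  Young's inequality is applied to \<open>\<langle>e, v\<rangle>\<close> with equal weights, and to \<open>\<alpha> \<langle>e, u\<rangle>\<close> with all of
  \<open>\<alpha>\<close> on \<open>e\<close>; this is what produces the constants \<open>\<nu>\<^sub>0\<close> and \<open>\<nu>\<^sub>1\<close>.\<close>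

lemma dissipation_inequality:
  fixes u v w :: "'a::euclidean_space \<Rightarrow> real" and g :: "'a \<Rightarrow> 'a"
  assumes L2: "u \<in> L2_space \<Omega>" "v \<in> L2_space \<Omega>" "w \<in> L2_space \<Omega>"
    and pos: "0 \<le> \<alpha>" "0 \<le> \<epsilon>" "0 \<le> \<gamma>\<^sub>0"
    and poincare: "(L2_norm \<Omega> u)\<^sup>2 \<le> C\<^sup>2 * (L2_norm \<Omega> g)\<^sup>2"
    and trigger: "(L2_norm \<Omega> (\<lambda>x. v x - w x))\<^sup>2 \<le> \<gamma>\<^sub>0 * (L2_norm \<Omega> u)\<^sup>2 + \<gamma>\<^sub>1 * (L2_norm \<Omega> v)\<^sup>2 + \<eta>"
  shows "L2_inner \<Omega> (\<lambda>x. - \<alpha> * w x) v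
      + \<epsilon> * ((L2_norm \<Omega> v)\<^sup>2 + L2_inner \<Omega> (\<lambda>x. - \<alpha> * w x) u - (L2_norm \<Omega> g)\<^sup>2)
      + \<epsilon> * \<alpha> * L2_inner \<Omega> u v
    \<le> - 1/2 * ((2 * \<alpha> - 2 * \<epsilon> - \<alpha> * (\<gamma>\<^sub>1 + 1) - \<alpha>\<^sup>2 * \<epsilon> * \<gamma>\<^sub>1) * (L2_norm \<Omega> v)\<^sup>2
      + (2 * \<epsilon> - \<alpha> * \<gamma>\<^sub>0 * C\<^sup>2 - \<epsilon> * C\<^sup>2 * (1 + \<alpha>\<^sup>2 * \<gamma>\<^sub>0)) * (L2_norm \<Omega> g)\<^sup>2)
      + \<alpha> * (1 + \<alpha> * \<epsilon>) / 2 * \<eta>"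
proof -
  let ?e = "\<lambda>x. v x - w x"
  define E V G U where "E = (L2_norm \<Omega> ?e)\<^sup>2" and "V = (L2_norm \<Omega> v)\<^sup>2"
    and "G = (L2_norm \<Omega> g)\<^sup>2" and "U = (L2_norm \<Omega> u)\<^sup>2"
  have e: "?e \<in> L2_space \<Omega>" using L2(2,3) by (rule L2_space_diff)
  have ev: "L2_inner \<Omega> ?e v \<le> 1/2 * (E + V)"
    using Young_of_Cauchy_Schwarz[OF L2_Cauchy_Schwarz[OF e L2(2)], of 1] by (simp add: E_def V_def)
  have eu: "\<alpha> * L2_inner \<Omega> ?e u \<le> 1/2 * (\<alpha>\<^sup>2 * E + U)"
    using Young_of_Cauchy_Schwarz[OF L2_Cauchy_Schwarz[OF e L2(1)], of \<alpha>] by (simp add: E_def U_def)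
  have "L2_inner \<Omega> (\<lambda>x. - \<alpha> * w x) v
      + \<epsilon> * ((L2_norm \<Omega> v)\<^sup>2 + L2_inner \<Omega> (\<lambda>x. - \<alpha> * w x) u - (L2_norm \<Omega> g)\<^sup>2)
      + \<epsilon> * \<alpha> * L2_inner \<Omega> u v
      = - (\<alpha> - \<epsilon>) * V - \<epsilon> * G + \<alpha> * L2_inner \<Omega> ?e v + \<epsilon> * (\<alpha> * L2_inner \<Omega> ?e u)"
    using L2_inner_diff_left[OF L2(2,3,2)] L2_inner_diff_left[OF L2(2,3,1)]
    by (simp only: L2_inner_mult_left) (simp add: V_def G_def L2_norm_sq L2_inner_commute[of \<Omega> u v] algebra_simps)
  also have "\<dots> \<le> - (\<alpha> - \<epsilon>) * V - \<epsilon> * G + \<alpha> * (1/2 * (E + V)) + \<epsilon> * (1/2 * (\<alpha>\<^sup>2 * E + U))"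
    using mult_left_mono[OF ev pos(1)] mult_left_mono[OF eu pos(2)] by linarith
  also have "\<dots> = - (\<alpha> - \<epsilon>) * V - \<epsilon> * G + \<alpha> / 2 * V + \<epsilon> / 2 * U + (\<alpha> * (1 + \<alpha> * \<epsilon>) / 2) * E"
    by (simp add: algebra_simps power2_eq_square add_divide_distrib)
  also have "\<dots> \<le> - (\<alpha> - \<epsilon>) * V - \<epsilon> * G + \<alpha> / 2 * V + \<epsilon> / 2 * U
      + (\<alpha> * (1 + \<alpha> * \<epsilon>) / 2) * (\<gamma>\<^sub>0 * U + \<gamma>\<^sub>1 * V + \<eta>)"
    using mult_left_mono[OF trigger, of "\<alpha> * (1 + \<alpha> * \<epsilon>) / 2"] pos by (simp add: E_def U_def V_def)
  also have "\<dots> = - (\<alpha> - \<epsilon>) * V - \<epsilon> * G + \<alpha> / 2 * V + (\<epsilon> / 2 + \<alpha> * (1 + \<alpha> * \<epsilon>) / 2 * \<gamma>\<^sub>0) * U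
      + (\<alpha> * (1 + \<alpha> * \<epsilon>) / 2) * (\<gamma>\<^sub>1 * V + \<eta>)"
    by (simp add: field_simps)
  also have "\<dots> \<le> - (\<alpha> - \<epsilon>) * V - \<epsilon> * G + \<alpha> / 2 * V + (\<epsilon> / 2 + \<alpha> * (1 + \<alpha> * \<epsilon>) / 2 * \<gamma>\<^sub>0) * (C\<^sup>2 * G)
      + (\<alpha> * (1 + \<alpha> * \<epsilon>) / 2) * (\<gamma>\<^sub>1 * V + \<eta>)"
    using mult_left_mono[OF poincare, of "\<epsilon> / 2 + \<alpha> * (1 + \<alpha> * \<epsilon>) / 2 * \<gamma>\<^sub>0"] pos by (simp add: U_def G_def)
  also have "\<dots> = - 1/2 * ((2 * \<alpha> - 2 * \<epsilon> - \<alpha> * (\<gamma>\<^sub>1 + 1) - \<alpha>\<^sup>2 * \<epsilon> * \<gamma>\<^sub>1) * V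
      + (2 * \<epsilon> - \<alpha> * \<gamma>\<^sub>0 * C\<^sup>2 - \<epsilon> * C\<^sup>2 * (1 + \<alpha>\<^sup>2 * \<gamma>\<^sub>0)) * G)
      + \<alpha> * (1 + \<alpha> * \<epsilon>) / 2 * \<eta>"
    by (simp add: field_simps power2_eq_square)
  finally show ?thesis unfolding V_def G_def .
qed

lemma lyapunov_energy_bounds:
  assumes L2: "u \<in> L2_space \<Omega>" "v \<in> L2_space \<Omega>"
    and C: "0 \<le> C" "L2_norm \<Omega> u \<le> C * L2_norm \<Omega> g" and pos: "0 \<le> \<alpha>" "0 \<le> \<epsilon>"
    and E: "E = 1/2 * ((L2_norm \<Omega> v)\<^sup>2 + (L2_norm \<Omega> g)\<^sup>2)"
  shows "(1 - \<epsilon> * C) * E \<le> E + \<epsilon> * L2_inner \<Omega> u v"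
    and "E + \<epsilon> * L2_inner \<Omega> u v + \<epsilon> * \<alpha> / 2 * (L2_norm \<Omega> u)\<^sup>2 \<le> (1 + \<epsilon> * C + \<epsilon> * \<alpha> * C\<^sup>2) * E"
proof -
  have "\<bar>L2_inner \<Omega> u v\<bar> \<le> (C * L2_norm \<Omega> g) * L2_norm \<Omega> v"
    using L2_Cauchy_Schwarz[OF L2] mult_right_mono[OF C(2) L2_norm_nonneg[of \<Omega> v]] by linarith
  also have "\<dots> = C * (L2_norm \<Omega> g * L2_norm \<Omega> v)" by simp
  also have "\<dots> \<le> C * E"
    using C(1) sum_squares_bound[of "L2_norm \<Omega> g" "L2_norm \<Omega> v"] unfolding E by (intro mult_left_mono) auto
  finally have "\<bar>L2_inner \<Omega> u v\<bar> \<le> C * E" .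
  then have "- (C * E) \<le> L2_inner \<Omega> u v" "L2_inner \<Omega> u v \<le> C * E" by linarith+
  from mult_left_mono[OF this(1) pos(2)] mult_left_mono[OF this(2) pos(2)]
  have uv: "- (\<epsilon> * C * E) \<le> \<epsilon> * L2_inner \<Omega> u v" "\<epsilon> * L2_inner \<Omega> u v \<le> \<epsilon> * C * E" by simp_all
  have "(L2_norm \<Omega> u)\<^sup>2 \<le> (C * L2_norm \<Omega> g)\<^sup>2" using C(2) by (intro power_mono L2_norm_nonneg)
  also have "\<dots> \<le> C\<^sup>2 * (2 * E)" unfolding E power_mult_distrib by (intro mult_left_mono) auto
  finally have uu: "\<epsilon> * \<alpha> / 2 * (L2_norm \<Omega> u)\<^sup>2 \<le> \<epsilon> * \<alpha> / 2 * (C\<^sup>2 * (2 * E))"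
    using pos by (intro mult_left_mono) auto
  show "(1 - \<epsilon> * C) * E \<le> E + \<epsilon> * L2_inner \<Omega> u v" using uv(1) by (simp add: algebra_simps)
  show "E + \<epsilon> * L2_inner \<Omega> u v + \<epsilon> * \<alpha> / 2 * (L2_norm \<Omega> u)\<^sup>2 \<le> (1 + \<epsilon> * C + \<epsilon> * \<alpha> * C\<^sup>2) * E"
    using uv(2) uu by (simp add: algebra_simps)
qed

text \<open>The left side minus the right side is the integral over \<open>[p, q]\<close> of
  \<open>(e\<^sup>\<delta>\<^sup>t V)' - c e\<^sup>(\<^sup>\<delta>\<^sup>-\<^sup>\<theta>\<^sup>)\<^sup>t \<le> 0\<close>. Stating the
  estimate as monotonicity of a fixed function lets it be chained over the sampling intervals.\<close>

lemma Gronwall_exponential_forcing: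
  fixes V V' :: "real \<Rightarrow> real"
  assumes "p \<le> q" and cont: "continuous_on {p..q} V"
    and deriv: "\<And>t. \<lbrakk>p < t; t < q\<rbrakk> \<Longrightarrow> (V has_real_derivative V' t) (at t)"
    and bound: "\<And>t. \<lbrakk>p < t; t < q\<rbrakk> \<Longrightarrow> V' t \<le> - \<delta> * V t + c * exp (- \<theta> * t)"
    and "\<delta> < \<theta>"
  shows "exp (\<delta> * q) * V q + c / (\<theta> - \<delta>) * exp ((\<delta> - \<theta>) * q)
    \<le> exp (\<delta> * p) * V p + c / (\<theta> - \<delta>) * exp ((\<delta> - \<theta>) * p)"
proof -
  let ?Y = "\<lambda>t. exp (\<delta> * t) * V t + c / (\<theta> - \<delta>) * exp ((\<delta> - \<theta>) * t)"
  have "\<exists>y. (?Y has_real_derivative y) (at t) \<and> y \<le> 0" if t: "p < t" "t < q" for t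
  proof (intro exI conjI)
    have exp_deriv: "((\<lambda>t. exp (r * t)) has_real_derivative r * exp (r * t)) (at t)" for r
      by (auto intro!: derivative_eq_intros)
    have const: "c / (\<theta> - \<delta>) * ((\<delta> - \<theta>) * exp ((\<delta> - \<theta>) * t)) = - c * exp ((\<delta> - \<theta>) * t)"
      using \<open>\<delta> < \<theta>\<close> by (simp add: divide_simps) (simp add: algebra_simps)
    show "(?Y has_real_derivative exp (\<delta> * t) * (V' t + \<delta> * V t) - c * exp ((\<delta> - \<theta>) * t)) (at t)"
      by (rule DERIV_cong[OF DERIV_add[OF DERIV_mult[OF exp_deriv[of \<delta>] deriv[OF t]]
          DERIV_cmult[OF exp_deriv[of "\<delta> - \<theta>"], of "c / (\<theta> - \<delta>)"]]])
        (simp only: const, simp add: algebra_simps)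
    have "exp (\<delta> * t) * (V' t + \<delta> * V t) \<le> exp (\<delta> * t) * (c * exp (- \<theta> * t))"
      using bound[OF t] by (intro mult_left_mono) auto
    also have "\<dots> = c * exp ((\<delta> - \<theta>) * t)" by (simp add: algebra_simps exp_diff exp_minus field_simps)
    finally show "exp (\<delta> * t) * (V' t + \<delta> * V t) - c * exp ((\<delta> - \<theta>) * t) \<le> 0" by simp
  qed
  then show ?thesis
    using \<open>p \<le> q\<close> cont by (intro DERIV_nonpos_imp_decreasing_open[of p q ?Y] continuous_intros) auto
qed

section \<open>Exponential stability\<close>

text \<open>The bound on \<open>\<gamma>\<^sub>0\<close> makes the denominator \<open>2 - C\<^sup>2 (1 + \<alpha>\<^sup>2 \<gamma>\<^sub>0)\<close> positive. Multiplied out, the lower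
  and upper bounds on \<open>\<epsilon>\<close> then say exactly that \<open>\<nu>\<^sub>0\<close> and \<open>\<nu>\<^sub>1\<close> are positive.\<close>

lemma gain_conditions:
  fixes \<alpha> C \<gamma>\<^sub>0 \<gamma>\<^sub>1 \<epsilon> :: real
  assumes \<alpha>: "\<alpha> > 0" and C: "0 \<le> C" and \<gamma>: "\<gamma>\<^sub>0 > 0" "\<gamma>\<^sub>1 > 0"
    and gains: "(\<alpha> < 2 \<and>
            \<gamma>\<^sub>0 < (2 - C\<^sup>2) / (C\<^sup>2 * max (\<alpha>\<^sup>2 + \<alpha> * C) (2 * (2 - \<alpha>\<^sup>2))) \<and> \<gamma>\<^sub>1 < 1/2) \<or>
         (\<alpha> \<ge> 2 \<and>
            \<gamma>\<^sub>0 < (2 - C\<^sup>2) / (\<alpha>\<^sup>2 * C\<^sup>2 + \<alpha> * C^3) \<and> \<gamma>\<^sub>1 < 1)"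
    and \<epsilon>: "\<epsilon> < 1 / C" "\<alpha> * \<gamma>\<^sub>0 * C\<^sup>2 / (2 - C\<^sup>2 * (1 + \<alpha>\<^sup>2 * \<gamma>\<^sub>0)) < \<epsilon>"
      "\<epsilon> < \<alpha> * (1 - \<gamma>\<^sub>1) / (2 + \<alpha>\<^sup>2 * \<gamma>\<^sub>1)"
  shows "0 < \<epsilon>" and "\<epsilon> * C < 1"
    and "0 < 2 * \<epsilon> - \<alpha> * \<gamma>\<^sub>0 * C\<^sup>2 - \<epsilon> * C\<^sup>2 * (1 + \<alpha>\<^sup>2 * \<gamma>\<^sub>0)"
    and "0 < 2 * \<alpha> - 2 * \<epsilon> - \<alpha> * (\<gamma>\<^sub>1 + 1) - \<alpha>\<^sup>2 * \<epsilon> * \<gamma>\<^sub>1"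
proof -
  \<comment> \<open>division by \<open>0\<close> is \<open>0\<close>, so \<open>C = 0\<close> would require \<open>0 < \<epsilon> < 0\<close>\<close>
  have C0: "0 < C"
  proof (rule ccontr)
    assume "\<not> 0 < C"
    with C have "C = 0" by simp
    with \<epsilon>(1,2) show False by simp
  qed
  define m where "m = \<alpha>\<^sup>2 + \<alpha> * C"
  have m: "0 < m" "\<alpha>\<^sup>2 \<le> m" using \<alpha> C0 by (simp_all add: m_def add_pos_pos)
  have "\<gamma>\<^sub>0 * (C\<^sup>2 * m) < 2 - C\<^sup>2"
    using gains
  proof (elim disjE conjE)
    assume less: "\<gamma>\<^sub>0 < (2 - C\<^sup>2) / (C\<^sup>2 * max (\<alpha>\<^sup>2 + \<alpha> * C) (2 * (2 - \<alpha>\<^sup>2)))"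
    let ?m = "max m (2 * (2 - \<alpha>\<^sup>2))"
    have "0 < C\<^sup>2 * ?m" using C0 m(1) by (simp add: less_max_iff_disj)
    then have "\<gamma>\<^sub>0 * (C\<^sup>2 * ?m) < 2 - C\<^sup>2" using less by (simp add: pos_less_divide_eq flip: m_def)
    moreover have "\<gamma>\<^sub>0 * (C\<^sup>2 * m) \<le> \<gamma>\<^sub>0 * (C\<^sup>2 * ?m)"
      using \<gamma>(1) by (intro mult_left_mono) auto
    ultimately show ?thesis by linarith
  next
    assume less: "\<gamma>\<^sub>0 < (2 - C\<^sup>2) / (\<alpha>\<^sup>2 * C\<^sup>2 + \<alpha> * C ^ 3)"
    have "\<alpha>\<^sup>2 * C\<^sup>2 + \<alpha> * C ^ 3 = C\<^sup>2 * m" by (simp add: m_def power2_eq_square power3_eq_cube algebra_simps)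
    moreover have "0 < C\<^sup>2 * m" using C0 m(1) by simp
    ultimately show ?thesis using less by (simp add: pos_less_divide_eq)
  qed
  moreover have "\<gamma>\<^sub>0 * (C\<^sup>2 * \<alpha>\<^sup>2) \<le> \<gamma>\<^sub>0 * (C\<^sup>2 * m)"
    using m(2) \<gamma>(1) by (intro mult_left_mono) auto
  ultimately have D: "0 < 2 - C\<^sup>2 * (1 + \<alpha>\<^sup>2 * \<gamma>\<^sub>0)" by (simp add: algebra_simps)
  have "0 < \<alpha> * \<gamma>\<^sub>0 * C\<^sup>2 / (2 - C\<^sup>2 * (1 + \<alpha>\<^sup>2 * \<gamma>\<^sub>0))"
    using D \<alpha> \<gamma>(1) C0 by (intro divide_pos_pos mult_pos_pos) auto
  then show "0 < \<epsilon>" using \<epsilon>(2) by linarith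
  show "\<epsilon> * C < 1" using \<epsilon>(1) C0 by (simp add: pos_less_divide_eq)
  show "0 < 2 * \<epsilon> - \<alpha> * \<gamma>\<^sub>0 * C\<^sup>2 - \<epsilon> * C\<^sup>2 * (1 + \<alpha>\<^sup>2 * \<gamma>\<^sub>0)"
    using \<epsilon>(2) unfolding pos_divide_less_eq[OF D] by (simp add: algebra_simps)
  have "0 < 2 + \<alpha>\<^sup>2 * \<gamma>\<^sub>1" using \<gamma>(2) by (simp add: add_pos_nonneg)
  from \<epsilon>(3)[unfolded pos_less_divide_eq[OF this]]
  show "0 < 2 * \<alpha> - 2 * \<epsilon> - \<alpha> * (\<gamma>\<^sub>1 + 1) - \<alpha>\<^sup>2 * \<epsilon> * \<gamma>\<^sub>1" by (simp add: algebra_simps)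
qed

theorem theorem3:
  fixes \<Omega> :: "'a::euclidean_space set"
    and \<alpha> C \<gamma>\<^sub>0 \<gamma>\<^sub>1 \<epsilon> \<nu>\<^sub>0 \<nu>\<^sub>1 \<beta> \<theta> K \<delta> :: real
    and \<eta>\<^sub>0 :: "real \<Rightarrow> real"
    and z\<^sub>0 z\<^sub>1 :: "'a \<Rightarrow> real"
    and z dz :: "real \<Rightarrow> 'a \<Rightarrow> real"
  assumes "\<alpha> > 0"
    and "open \<Omega>" and "connected \<Omega>" and "\<Omega> \<noteq> {}" and "bounded \<Omega>"
    and "C = poincare_constant \<Omega>" and "C < sqrt 2"
    and "\<gamma>\<^sub>0 > 0" and "\<gamma>\<^sub>1 > 0"
    and "(\<alpha> < 2 \<and>
            \<gamma>\<^sub>0 < (2 - C\<^sup>2) / (C\<^sup>2 * max (\<alpha>\<^sup>2 + \<alpha> * C) (2 * (2 - \<alpha>\<^sup>2))) \<and> \<gamma>\<^sub>1 < 1/2) \<or>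
         (\<alpha> \<ge> 2 \<and>
            \<gamma>\<^sub>0 < (2 - C\<^sup>2) / (\<alpha>\<^sup>2 * C\<^sup>2 + \<alpha> * C^3) \<and> \<gamma>\<^sub>1 < 1)"
    and "\<epsilon> < 1 / C"
    and "\<alpha> * \<gamma>\<^sub>0 * C\<^sup>2 / (2 - C\<^sup>2 * (1 + \<alpha>\<^sup>2 * \<gamma>\<^sub>0)) < \<epsilon>"
    and "\<epsilon> < \<alpha> * (1 - \<gamma>\<^sub>1) / (2 + \<alpha>\<^sup>2 * \<gamma>\<^sub>1)"
    and "\<nu>\<^sub>0 = 2 * \<epsilon> - \<alpha> * \<gamma>\<^sub>0 * C\<^sup>2 - \<epsilon> * C\<^sup>2 * (1 + \<alpha>\<^sup>2 * \<gamma>\<^sub>0)"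
    and "\<nu>\<^sub>1 = 2 * \<alpha> - 2 * \<epsilon> - \<alpha> * (\<gamma>\<^sub>1 + 1) - \<alpha>\<^sup>2 * \<epsilon> * \<gamma>\<^sub>1"
    and "\<beta> = min \<nu>\<^sub>0 \<nu>\<^sub>1"
    and "\<theta> > min \<nu>\<^sub>0 \<nu>\<^sub>1 / (1 + \<epsilon> * C + \<epsilon> * \<alpha> * C\<^sup>2)"
    and "\<delta> = \<beta> / (1 + \<epsilon> * C + \<epsilon> * \<alpha> * C\<^sup>2)"
    and "K = (1 + \<epsilon> * C + \<epsilon> * \<alpha> * C\<^sup>2) / (1 - \<epsilon> * C) *
             (1 + \<alpha> * (1 + \<alpha> * \<epsilon>) / (2 * (\<theta> - \<beta> / (1 + \<epsilon> * C + \<epsilon> * \<alpha> * C\<^sup>2))))"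
    and "z\<^sub>0 \<in> H10_space \<Omega>" and "z\<^sub>1 \<in> L2_space \<Omega>"
    and "\<not> ((AE x in lebesgue_on \<Omega>. z\<^sub>0 x = 0) \<and> (AE x in lebesgue_on \<Omega>. z\<^sub>1 x = 0))"
    and "\<eta>\<^sub>0 = (\<lambda>t. (1/2 * (L2_norm \<Omega> z\<^sub>1)\<^sup>2 + 1/2 * (L2_norm \<Omega> (wgrad \<Omega> z\<^sub>0))\<^sup>2
                    + \<epsilon> * (LINT x|lebesgue_on \<Omega>. z\<^sub>0 x * z\<^sub>1 x)) * exp (- \<theta> * t))"
    and "event_triggered_solution \<Omega> \<alpha> \<gamma>\<^sub>0 \<gamma>\<^sub>1 \<eta>\<^sub>0 z\<^sub>0 z\<^sub>1 z dz"
  shows "\<forall>t>0. energy \<Omega> z dz t \<le> K * exp (- \<delta> * t) * energy \<Omega> z dz 0"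
proof -
  note \<alpha> = assms(1) and \<Omega> = assms(2) and bounded = assms(5) and C_def = assms(6)
    and \<gamma> = assms(8,9) and \<nu>_def = assms(14,15) and \<beta>_def = assms(16) and \<delta>_def = assms(18)
  have C: "0 \<le> C" unfolding C_def by (rule poincare_constant_nonneg[OF \<Omega> bounded])
  note gain = gain_conditions[OF \<alpha> C \<gamma> assms(10-13)]
  have \<epsilon>: "0 \<le> \<epsilon>" and \<epsilon>C: "0 < 1 - \<epsilon> * C" using gain by auto
  have \<beta>: "0 < \<beta>" using gain(3,4) unfolding \<beta>_def \<nu>_def by simp
  define M where "M = 1 + \<epsilon> * C + \<epsilon> * \<alpha> * C\<^sup>2"
  have M: "1 \<le> M" using \<epsilon> C \<alpha> by (simp add: M_def)
  have \<delta>: "0 < \<delta>" "\<delta> * M = \<beta>" "\<delta> < \<theta>"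
    using \<beta> M assms(17) by (simp_all add: \<delta>_def \<beta>_def flip: M_def)
  define c where "c = \<alpha> * (1 + \<alpha> * \<epsilon>) / 2"
  have c: "0 \<le> c" using \<alpha> \<epsilon> by (simp add: c_def)

  have C0: "C0_H10 \<Omega> z" and C1: "C1_L2 \<Omega> z dz"
    and init: "AE x in lebesgue_on \<Omega>. z 0 x = z\<^sub>0 x" "AE x in lebesgue_on \<Omega>. dz 0 x = z\<^sub>1 x"
    and wave: "weak_wave_on \<Omega> (sampling_time \<Omega> \<gamma>\<^sub>0 \<gamma>\<^sub>1 \<eta>\<^sub>0 z dz k) (sampling_time \<Omega> \<gamma>\<^sub>0 \<gamma>\<^sub>1 \<eta>\<^sub>0 z dz (Suc k))
      (\<lambda>x. - \<alpha> * dz (real_of_ereal (sampling_time \<Omega> \<gamma>\<^sub>0 \<gamma>\<^sub>1 \<eta>\<^sub>0 z dz k)) x) z dz" for k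
    using assms(24) unfolding event_triggered_solution_def Let_def by blast+
  have H10: "z t \<in> H10_space \<Omega>" and dz: "dz t \<in> L2_space \<Omega>" if "0 \<le> t" for t
    using C0 C1 that unfolding C0_H10_def C1_L2_def by blast+
  have poincare: "L2_norm \<Omega> (z t) \<le> C * L2_norm \<Omega> (wgrad \<Omega> (z t))" if "0 \<le> t" for t
    unfolding C_def by (rule poincare_constant_ineq[OF \<Omega> bounded H10[OF that]])
  let ?E = "energy \<Omega> z dz" and ?V = "lyapunov \<Omega> \<alpha> \<epsilon> z dz"
  note bounds = lyapunov_energy_bounds[OF H10_space_L2[OF H10] dz C poincare less_imp_le[OF \<alpha>] \<epsilon>
      energy_def[of \<Omega> z dz]]
  have lower: "(1 - \<epsilon> * C) * ?E t \<le> ?E t + \<epsilon> * L2_inner \<Omega> (z t) (dz t)" if "0 \<le> t" for t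
    by (rule bounds(1)[OF that that that])
  have upper: "?V t \<le> M * ?E t" if "0 \<le> t" for t
    unfolding M_def lyapunov_def by (rule bounds(2)[OF that that that])
  have nonneg: "0 \<le> \<epsilon> * \<alpha> / 2 * (L2_norm \<Omega> (z t))\<^sup>2" for t using \<epsilon> \<alpha> by simp

  define A where "A = ?E 0 + \<epsilon> * L2_inner \<Omega> (z 0) (dz 0)"
  have \<eta>: "\<eta>\<^sub>0 t = A * exp (- \<theta> * t)" for t
  proof -
    have "L2_inner \<Omega> (z 0) (dz 0) = L2_inner \<Omega> z\<^sub>0 z\<^sub>1"
      using assms(20,21) init H10[of 0] dz[of 0] by (intro L2_inner_cong_AE) (auto intro: H10_space_L2)
    moreover have "L2_norm \<Omega> (dz 0) = L2_norm \<Omega> z\<^sub>1"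
      using assms(21) init(2) dz[of 0] by (intro L2_norm_cong_AE) auto
    moreover have "L2_norm \<Omega> (wgrad \<Omega> (z 0)) = L2_norm \<Omega> (wgrad \<Omega> z\<^sub>0)"
      using assms(20) init(1) H10[of 0] by (intro L2_norm_wgrad_cong_AE \<Omega>) (auto intro: H10_space_H1)
    ultimately show ?thesis
      unfolding assms(23) A_def energy_def by (simp add: L2_inner_def algebra_simps)
  qed
  have E0: "0 < ?E 0"
  proof (rule ccontr)
    assume "\<not> 0 < ?E 0"
    then have "L2_norm \<Omega> (dz 0) = 0" "L2_norm \<Omega> (wgrad \<Omega> (z 0)) = 0"
      by (simp_all add: energy_def not_less sum_power2_le_zero_iff)
    moreover from this(2) have "L2_norm \<Omega> (z 0) = 0"
      using poincare[of 0] L2_norm_nonneg[of \<Omega> "z 0"] by simp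
    ultimately have zero: "AE x in lebesgue_on \<Omega>. z 0 x = 0" "AE x in lebesgue_on \<Omega>. dz 0 x = 0"
      using L2_norm_eq_0_iff[OF H10_space_L2[OF H10[of 0]]] L2_norm_eq_0_iff[OF dz[of 0]] by simp_all
    have "AE x in lebesgue_on \<Omega>. z\<^sub>0 x = 0" using zero(1) init(1) by eventually_elim simp
    moreover have "AE x in lebesgue_on \<Omega>. z\<^sub>1 x = 0" using zero(2) init(2) by eventually_elim simp
    ultimately show False using assms(22) by blast
  qed
  have A: "0 < A" using lower[of 0] mult_pos_pos[OF \<epsilon>C E0] unfolding A_def by simp
  have A_V: "A \<le> ?V 0" unfolding A_def lyapunov_def using nonneg[of 0] by simp

  let ?\<tau> = "sampling_time \<Omega> \<gamma>\<^sub>0 \<gamma>\<^sub>1 \<eta>\<^sub>0 z dz"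
  let ?Y = "\<lambda>t. exp (\<delta> * t) * ?V t + c * A / (\<theta> - \<delta>) * exp ((\<delta> - \<theta>) * t)"
  have unbounded: "\<exists>k. ereal t < ?\<tau> k" for t
  proof (rule sampling_times_unbounded[OF C1_L2_continuous_on[OF C1]])
    show "0 < \<eta>\<^sub>0 t" for t using A by (simp add: \<eta>)
    show "\<eta>\<^sub>0 t \<le> \<eta>\<^sub>0 s" if "s \<le> t" for s t
      unfolding \<eta> using A \<delta> that by (intro mult_left_mono) auto
  qed (use \<gamma> in auto)
  have Y_decreasing: "?Y q \<le> ?Y p" if k: "?\<tau> k = ereal p" and pq: "p \<le> q" "ereal q \<le> ?\<tau> (Suc k)" for k p q
  proof -
    have p: "0 \<le> p" using sampling_time_nonneg[of \<Omega> \<gamma>\<^sub>0 \<gamma>\<^sub>1 \<eta>\<^sub>0 z dz k] unfolding k by simp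
    let ?f = "\<lambda>x. - \<alpha> * dz p x"
    let ?V' = "\<lambda>t. L2_inner \<Omega> ?f (dz t)
      + \<epsilon> * ((L2_norm \<Omega> (dz t))\<^sup>2 + L2_inner \<Omega> ?f (z t) - (L2_norm \<Omega> (wgrad \<Omega> (z t)))\<^sup>2)
      + \<epsilon> * \<alpha> * L2_inner \<Omega> (z t) (dz t)"
    have f: "?f \<in> L2_space \<Omega>" using dz[OF p] by (rule L2_space_mult)
    have wave_p: "weak_wave_on \<Omega> (ereal p) (?\<tau> (Suc k)) ?f z dz"
      using wave[of k] unfolding k real_of_ereal.simps .
    show ?thesis
    proof (rule Gronwall_exponential_forcing[OF pq(1) _ _ _ \<delta>(3)])
      show "continuous_on {p..q} ?V"
        using p by (intro continuous_on_subset[OF lyapunov_continuous_on[OF \<Omega> C0 C1]]) auto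
      fix t assume t: "p < t" "t < q"
      then have t': "ereal t < ?\<tau> (Suc k)" using pq(2) by (metis ereal_less(2) less_ereal.simps(1) order_less_le_trans)
      have t0: "0 \<le> t" using p t by simp
      show "(?V has_real_derivative ?V' t) (at t)"
        by (rule lyapunov_has_derivative[OF \<Omega> C0 C1 f wave_p p t(1) t'])
      have trigger: "(L2_norm \<Omega> (\<lambda>x. dz t x - dz p x))\<^sup>2
          \<le> \<gamma>\<^sub>0 * (L2_norm \<Omega> (z t))\<^sup>2 + \<gamma>\<^sub>1 * (L2_norm \<Omega> (dz t))\<^sup>2 + \<eta>\<^sub>0 t"
        using not_triggered_before_next_sample[OF k less_imp_le[OF t(1)] t'] by (rule less_imp_le)
      have "(L2_norm \<Omega> (z t))\<^sup>2 \<le> (C * L2_norm \<Omega> (wgrad \<Omega> (z t)))\<^sup>2"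
        using poincare[OF t0] L2_norm_nonneg by (rule power_mono)
      then have "(L2_norm \<Omega> (z t))\<^sup>2 \<le> C\<^sup>2 * (L2_norm \<Omega> (wgrad \<Omega> (z t)))\<^sup>2"
        by (simp only: power_mult_distrib)
      from dissipation_inequality[OF H10_space_L2[OF H10[OF t0]] dz[OF t0] dz[OF p] less_imp_le[OF \<alpha>] \<epsilon>
          less_imp_le[OF \<gamma>(1)] this trigger]
      have dissipation: "?V' t \<le> - 1/2 * (\<nu>\<^sub>1 * (L2_norm \<Omega> (dz t))\<^sup>2 + \<nu>\<^sub>0 * (L2_norm \<Omega> (wgrad \<Omega> (z t)))\<^sup>2) + c * \<eta>\<^sub>0 t"
        unfolding \<nu>_def c_def .
      have "\<beta> * (L2_norm \<Omega> (dz t))\<^sup>2 \<le> \<nu>\<^sub>1 * (L2_norm \<Omega> (dz t))\<^sup>2"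
        "\<beta> * (L2_norm \<Omega> (wgrad \<Omega> (z t)))\<^sup>2 \<le> \<nu>\<^sub>0 * (L2_norm \<Omega> (wgrad \<Omega> (z t)))\<^sup>2"
        unfolding \<beta>_def by (intro mult_right_mono; simp)+
      moreover have "\<beta> * ?E t = 1/2 * (\<beta> * (L2_norm \<Omega> (dz t))\<^sup>2 + \<beta> * (L2_norm \<Omega> (wgrad \<Omega> (z t)))\<^sup>2)"
        by (simp add: energy_def algebra_simps)
      moreover have "\<delta> * ?V t \<le> \<beta> * ?E t"
        using mult_left_mono[OF upper[OF t0] less_imp_le[OF \<delta>(1)]] \<delta>(2) by (simp flip: mult.assoc)
      ultimately have "- 1/2 * (\<nu>\<^sub>1 * (L2_norm \<Omega> (dz t))\<^sup>2 + \<nu>\<^sub>0 * (L2_norm \<Omega> (wgrad \<Omega> (z t)))\<^sup>2) + c * \<eta>\<^sub>0 t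
          \<le> - \<delta> * ?V t + c * A * exp (- \<theta> * t)"
        by (simp add: \<eta> mult.assoc)
      with dissipation show "?V' t \<le> - \<delta> * ?V t + c * A * exp (- \<theta> * t)" by (rule order_trans)
    qed
  qed
  show ?thesis
  proof (intro allI impI)
    fix t :: real assume "0 < t"
    then have t: "0 \<le> t" by simp
    have pos: "0 < \<theta> - \<delta>" using \<delta>(3) by simp
    have "?Y t \<le> ?Y 0"
      by (rule sampled_decreasing[of ?\<tau>, OF sampling_time.simps(1) sampling_time_mono unbounded _ t])
        (rule Y_decreasing)
    moreover have "0 \<le> c * A / (\<theta> - \<delta>) * exp ((\<delta> - \<theta>) * t)" using c A pos by simp
    ultimately have "exp (\<delta> * t) * ?V t \<le> ?V 0 + c * A / (\<theta> - \<delta>)" by simp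
    also have "\<dots> \<le> ?V 0 + c * ?V 0 / (\<theta> - \<delta>)"
      using A_V c pos by (intro add_left_mono divide_right_mono mult_left_mono) auto
    also have "\<dots> = (1 + c / (\<theta> - \<delta>)) * ?V 0" by (simp add: algebra_simps)
    also have "\<dots> \<le> (1 + c / (\<theta> - \<delta>)) * (M * ?E 0)"
      using upper[of 0] c pos by (intro mult_left_mono) auto
    finally have V: "exp (\<delta> * t) * ?V t \<le> (1 + c / (\<theta> - \<delta>)) * (M * ?E 0)" .
    have "(1 - \<epsilon> * C) * ?E t \<le> ?V t"
      using lower[OF t] nonneg[of t] unfolding lyapunov_def by linarith
    also have "?V t = exp (- \<delta> * t) * (exp (\<delta> * t) * ?V t)" by (simp add: exp_minus)
    also have "\<dots> \<le> exp (- \<delta> * t) * ((1 + c / (\<theta> - \<delta>)) * (M * ?E 0))"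
      using V by (intro mult_left_mono) auto
    finally have "?E t \<le> exp (- \<delta> * t) * ((1 + c / (\<theta> - \<delta>)) * (M * ?E 0)) / (1 - \<epsilon> * C)"
      using \<epsilon>C by (simp add: pos_le_divide_eq mult.commute)
    also have "\<dots> = K * exp (- \<delta> * t) * ?E 0"
    proof -
      have "c / (\<theta> - \<delta>) = \<alpha> * (1 + \<alpha> * \<epsilon>) / (2 * (\<theta> - \<delta>))" by (simp add: c_def)
      moreover have "\<beta> / M = \<delta>" unfolding \<delta>_def M_def ..
      ultimately show ?thesis unfolding assms(19) M_def[symmetric] by (simp add: mult.commute mult.left_commute)
    qed
    finally show "?E t \<le> K * exp (- \<delta> * t) * ?E 0" .
  qed
qed

end
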